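(* Let $q \geq 2$ be an integer and let $f \colon \mathbb{N}_0 \to \mathbb{U}$ be a $q$-semimultiplicative sequence. Then \[ \frac{1}{N}\sum_{n=0}^{N-1} f(n)\mu(n) \to 0 \quad \text{as } N \to \infty, \] where $\mu$ is the M\"obius function.
   Context: $\mathbb{U} = \{z \in \mathbb{C} : |z| = 1\}$ and $\mathbb{N}_0 = \{0,1,2,\dots\}$. A sequence $f \colon \mathbb{N}_0 \to \mathbb{U}$ is called $q$-semimultiplicative if $f(0) = 1$ and there exists $r \geq 0$ such that $f(n+m+k) = f(n+m)\,f(m+k)/f(m)$ for all integers $n,m,k \geq 0$ for which there is some $l \geq 0$ with $k < q^l$, $q^l \mid m$, $m < q^{l+r}$ and $q^{l+r} \mid n$. *)

theory Defs
  imports "HOL-Analysis.Analysis" "HOL-Computational_Algebra.Squarefree"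
begin

text \<open>Since 0 is not squarefree, the value at 0 is 0.\<close>

definition moebius_mu :: "nat \<Rightarrow> int" where
  "moebius_mu n = (if squarefree n then (- 1) ^ card (prime_factors n) else 0)"

text \<open>
  The notion is meant for sequences with values in the complex unit circle; this
  requirement is kept as a separate hypothesis wherever the predicate is used.
\<close>

definition semimultiplicative :: "nat \<Rightarrow> (nat \<Rightarrow> complex) \<Rightarrow> bool" where
  "semimultiplicative q f \<longleftrightarrow>
     f 0 = 1 \<and>
     (\<exists>r. \<forall>n m k.
        (\<exists>l. k < q ^ l \<and> q ^ l dvd m \<and> m < q ^ (l + r) \<and> q ^ (l + r) dvd n) \<longrightarrow>
        f (n + m + k) = f (n + m) * f (m + k) / f m)"

end

theory Submission
  imports Defs "HOL-Complex_Analysis.Complex_Analysis" "HOL-Number_Theory.Number_Theory"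
begin

text \<open>
  By the Katai criterion, orthogonality to the Moebius function can only fail if for some distinct odd
  primes \<open>p\<close>, \<open>p'\<close> not dividing \<open>q\<close> the averages of \<open>f (p n) * cnj (f (p' n))\<close> do not tend to 0.
  Multiplication by \<open>p\<close> and \<open>p'\<close> is performed digit by digit by a finite transducer, and a persistent
  average forces \<open>f (q ^ l * p * u)\<close> and \<open>f (q ^ l * p' * u)\<close> to be equal up to a square-summable error
  in \<open>l\<close>, for every \<open>u\<close>. Since \<open>p\<close> and \<open>p'\<close> produce carries at different places, this
  implies that, with the same kind of error, \<open>f (q ^ l * n)\<close> is \<open>\<omega> l ^ n\<close> for roots of unity \<open>\<omega> l\<close> of
  bounded order. A variance bound for sums of functions of few digits then shows that \<open>f\<close> is, up to a
  constant of modulus 1 that may depend on \<open>N\<close>, close in mean on \<open>{..<N}\<close> to a periodic function.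

  Periodic functions are orthogonal to the Moebius function by the prime number theorem in arithmetic
  progressions. It follows from the continuity of \<open>1 / L(s, \<xi>)\<close> on \<open>Re s \<ge> 1\<close> by a Wiener-Ikehara
  argument with the Fejer kernel; the L-functions do not vanish on \<open>Re s = 1\<close> by the 3-4-1 inequality
  and, at \<open>s = 1\<close> for real characters, by Monsky's argument with Lambert series.
\<close>
section \<open>The Katai criterion\<close>

text \<open>Square summability is the right notion of error because it occurs at both ends. In the
  transducer every state is sent to \<open>(0, 0)\<close> by two inputs with phases \<open>1\<close>
  and \<open>w\<close>, which costs the norm \<open>T l\<close> a proportion of order
  \<open>|1 - w|^2\<close>; since \<open>T\<close> is at most 1 and, in the bad case, bounded below,
  these losses are summable. At the other end, functions of far apart digit windows are
  uncorrelated, so the variance of a sum of small angles is controlled by the sum of their squares;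
  angles that merely tend to 0 would not make it small. The comparison of \<open>p\<close> with
  \<open>p'\<close> is used twice: to show that the ratio of the values at \<open>n + 1\<close> and
  \<open>n\<close> has period \<open>q ^ r\<close> in \<open>n\<close>, and, through equality of the
  powers \<open>p\<close> and \<open>p'\<close>, to bound the order of the roots of unity. Primes
  from 3 on that do not divide \<open>q\<close> are taken because three shifts by a high power of
  \<open>q\<close> must stay distinct modulo each of them, to leave a shift that avoids one bad
  class for either prime. The constant of modulus 1 is the mean phase of the first \<open>M\<close>
  digits; it need not converge, but only the modulus of the correlation with \<open>\<mu>\<close>
  matters.\<close>

lemma mult_less_iff_less_ceil_div:
  fixes d k N :: nat assumes "d > 0"
  shows "d * k < N \<longleftrightarrow> k < (N + d - 1) div d"
proof -
  have "k < (N + d - 1) div d \<longleftrightarrow> Suc k * d \<le> N + d - 1"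
    using assms by (metis Suc_le_eq less_eq_div_iff_mult_less_eq)
  also have "\<dots> \<longleftrightarrow> d * k < N" using assms by (auto simp: algebra_simps)
  finally show ?thesis by simp
qed

lemma card_multiples_lessThan:
  fixes d N :: nat assumes "d > 0"
  shows "real N / d \<le> card {n. n < N \<and> d dvd n}" "card {n. n < N \<and> d dvd n} \<le> real N / d + 1"
proof -
  have "{n. n < N \<and> d dvd n} = (\<lambda>k. d * k) ` {..<(N + d - 1) div d}"
    using mult_less_iff_less_ceil_div[OF assms] by (auto simp: dvd_def)
  moreover have "inj_on (\<lambda>k. d * k) {..<(N + d - 1) div d}" using assms by (auto simp: inj_on_def)
  ultimately have c: "card {n. n < N \<and> d dvd n} = (N + d - 1) div d" by (simp add: card_image)
  have a: "N + d - 1 < d * Suc ((N + d - 1) div d)" using assms by (metis dividend_less_times_div mult_Suc_right)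
  have "N \<le> d * ((N + d - 1) div d)" using a assms by simp
  then have "real N \<le> real d * real ((N + d - 1) div d)" by (metis of_nat_le_iff of_nat_mult)
  then show "real N / d \<le> card {n. n < N \<and> d dvd n}" using assms c by (simp add: field_simps)
  have "d * ((N + d - 1) div d) \<le> N + d - 1" by simp
  then have "d * ((N + d - 1) div d) \<le> N + d" by linarith
  then have "real d * real ((N + d - 1) div d) \<le> real N + real d" by (metis of_nat_le_iff of_nat_mult of_nat_add)
  then show "card {n. n < N \<and> d dvd n} \<le> real N / d + 1" using assms c by (simp add: field_simps)
qed

lemma sum_multiples:
  fixes F :: "nat \<Rightarrow> 'a::comm_monoid_add" assumes "d > 0"
  shows "(\<Sum>n | n < N \<and> d dvd n. F n) = (\<Sum>m | d * m < N. F (d * m))"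
  using assms by (intro sum.reindex_bij_witness[of _ "\<lambda>m. d * m" "\<lambda>n. n div d"]) auto

text \<open>Second moment method. Pairs \<open>p \<noteq> p'\<close> contribute at most
  \<open>N / (p p') + 1\<close>, so the terms of order \<open>N * S^2\<close> cancel and there
  remain \<open>N * S\<close> from the diagonal and one rounding error for each pair. As 0 counts as
  a multiple of every \<open>p\<close>, the first moment is at least \<open>N * S\<close> without
  any rounding error.\<close>

lemma turan_kubilius:
  fixes P :: "nat set" and N :: nat and S :: real
  defines "S \<equiv> (\<Sum>p\<in>P. 1 / real p)"
  defines "w \<equiv> (\<lambda>n. \<Sum>p\<in>P. if p dvd n then 1 else 0 :: real)"
  assumes "finite P" and pr: "\<And>p. p \<in> P \<Longrightarrow> prime p"
  shows "(\<Sum>n<N. (S - w n)\<^sup>2) \<le> N * S + (card P)\<^sup>2"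
proof -
  have cnt: "(\<Sum>n<N. if Q n then 1 else 0 :: real) = card {n. n < N \<and> Q n}" for Q
  proof -
    have "(\<Sum>n<N. if Q n then 1 else 0 :: real) = (\<Sum>n | n \<in> {..<N} \<and> Q n. 1)"
      by (subst sum.inter_filter) auto
    also have "\<dots> = card {n. n \<in> {..<N} \<and> Q n}" by simp
    finally show ?thesis by simp
  qed
  have pos: "p > 0" if "p \<in> P" for p using pr[OF that] by (simp add: prime_gt_0_nat)
  have S0: "S \<ge> 0" unfolding S_def by (intro sum_nonneg) auto
  have "real N * S = (\<Sum>p\<in>P. real N / p)" unfolding S_def by (simp add: sum_distrib_left)
  also have "\<dots> \<le> (\<Sum>p\<in>P. real (card {n. n < N \<and> p dvd n}))" using pos by (intro sum_mono card_multiples_lessThan)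
  also have "\<dots> = (\<Sum>n<N. w n)" unfolding w_def by (subst sum.swap) (simp add: cnt)
  finally have w1: "real N * S \<le> (\<Sum>n<N. w n)" .
  have "(\<Sum>n<N. (w n)\<^sup>2) = (\<Sum>n<N. \<Sum>p\<in>P. \<Sum>p'\<in>P. if p dvd n \<and> p' dvd n then 1 else 0)"
    unfolding w_def power2_eq_square sum_product by (intro sum.cong) auto
  also have "\<dots> = (\<Sum>p\<in>P. \<Sum>n<N. \<Sum>p'\<in>P. if p dvd n \<and> p' dvd n then 1 else 0)"
    by (rule sum.swap)
  also have "\<dots> = (\<Sum>p\<in>P. \<Sum>p'\<in>P. real (card {n. n < N \<and> p dvd n \<and> p' dvd n}))"
    by (rule sum.cong[OF refl], subst sum.swap) (simp add: cnt)
  \<comment> \<open>On the diagonal the product term serves to complete the square of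
    \<open>S\<close>; the multiples of \<open>p\<close> themselves are counted by the last
    summand.\<close>
  also have "\<dots> \<le> (\<Sum>p\<in>P. \<Sum>p'\<in>P. real N * (1/p) * (1/p') + 1 + (if p = p' then real N / p else 0))"
  proof (intro sum_mono)
    fix p p' assume p: "p \<in> P" "p' \<in> P"
    show "real (card {n. n < N \<and> p dvd n \<and> p' dvd n}) \<le> real N * (1/p) * (1/p') + 1 + (if p = p' then real N / p else 0)"
    proof (cases "p = p'")
      case True
      have "0 \<le> real N * (1 / p) * (1 / p')" by simp
      moreover have "card {n. n < N \<and> p dvd n \<and> p' dvd n} \<le> real N / p + 1"
        using True card_multiples_lessThan(2)[OF pos[OF p(1)], of N] by simp
      ultimately show ?thesis unfolding if_P[OF True] by linarith
    next
      case False
      then have "coprime p p'" using pr p by (simp add: primes_coprime)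
      then have "{n. n < N \<and> p dvd n \<and> p' dvd n} = {n. n < N \<and> p * p' dvd n}"
        by (auto intro: divides_mult dest: dvd_mult_left dvd_mult_right)
      then show ?thesis using card_multiples_lessThan(2)[of "p*p'" N] pos p False by (simp add: field_simps)
    qed
  qed
  also have "\<dots> = real N * S\<^sup>2 + (card P)\<^sup>2 + real N * S"
  proof -
    have "(\<Sum>p\<in>P. \<Sum>p'\<in>P. real N * (1/p) * (1/p')) = real N * S\<^sup>2"
      unfolding S_def power2_eq_square sum_product by (simp add: sum_distrib_left mult.assoc)
    moreover have "(\<Sum>p\<in>P. \<Sum>p'\<in>P. (if p = p' then real N / p else 0)) = real N * S"
      using assms(3) by (simp add: S_def sum_distrib_left)
    ultimately show ?thesis by (simp add: sum.distrib power2_eq_square)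
  qed
  finally have w2: "(\<Sum>n<N. (w n)\<^sup>2) \<le> real N * S\<^sup>2 + (card P)\<^sup>2 + real N * S" .
  have "(\<Sum>n<N. (S - w n)\<^sup>2) = real N * S\<^sup>2 - 2 * S * (\<Sum>n<N. w n) + (\<Sum>n<N. (w n)\<^sup>2)"
    by (simp add: power2_diff sum.distrib sum_subtractf sum_distrib_left mult.commute mult.left_commute)
  moreover have "2 * S * (\<Sum>n<N. w n) \<ge> 2 * S * (real N * S)" using w1 S0 by (intro mult_left_mono) auto
  moreover have "2 * S * (real N * S) = real N * S\<^sup>2 + real N * S\<^sup>2" by (simp add: power2_eq_square)
  ultimately show ?thesis using w2 unfolding of_nat_power by linarith
qed

lemma sum_le_sqrt_card:
  fixes x :: "nat \<Rightarrow> real"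
  assumes "(\<Sum>n<N. (x n)\<^sup>2) \<le> B"
  shows "(\<Sum>n<N. x n) \<le> sqrt (N * B)"
proof -
  have "(\<Sum>n<N. x n)\<^sup>2 \<le> (\<Sum>n<N. (x n)\<^sup>2) * N" using arith_geo_mean_sqrt sum_squared_le_sum_of_squares[of x "{..<N}"] by simp
  also have "\<dots> \<le> N * B" using assms by (metis mult.commute mult_left_mono of_nat_0_le_iff)
  finally show ?thesis using real_le_rsqrt by blast
qed

text \<open>By \<open>turan_kubilius\<close> the factor \<open>S\<close> may be replaced by the
  number \<open>w n\<close> of divisors of \<open>n\<close> in \<open>P\<close>, which turns the sum
  into one over \<open>n = p * m\<close>. Then \<open>\<nu> (p * m)\<close> is split into
  \<open>\<nu> p * \<nu> m\<close>, with an error from \<open>p dvd m\<close>, and Cauchy-Schwarz in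
  \<open>m\<close> removes the unknown \<open>\<nu> m\<close>; expanding the square leaves the
  correlations of \<open>f\<close>. The three summands of the bound belong to these three
  steps.\<close>

lemma katai_finite:
  fixes f \<nu> :: "nat \<Rightarrow> complex" and P :: "nat set" and N :: nat and S \<delta> :: real
  defines "S \<equiv> (\<Sum>p\<in>P. 1 / real p)"
  assumes fP: "finite P" and \<delta>: "\<delta> \<ge> 0" and pr: "\<And>p. p \<in> P \<Longrightarrow> prime p" and N: "N > 0"
    and f: "\<And>n. norm (f n) \<le> 1" and \<nu>: "\<And>n. norm (\<nu> n) \<le> 1"
    and mult: "\<And>p n. prime p \<Longrightarrow> \<not> p dvd n \<Longrightarrow> \<nu> (p * n) = \<nu> p * \<nu> n"
    and corr: "\<And>p p' K. p \<in> P \<Longrightarrow> p' \<in> P \<Longrightarrow> p \<noteq> p' \<Longrightarrow> K \<le> N \<Longrightarrow>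
       norm (\<Sum>n<K. f (p * n) * cnj (f (p' * n))) \<le> \<delta> * N"
  shows "S * norm (\<Sum>n<N. f n * \<nu> n) \<le> sqrt (N * (N * S + (card P)\<^sup>2))
     + (2 * N * (\<Sum>p\<in>P. 1 / (real p)\<^sup>2) + 2 * card P)
     + sqrt (N * (N * S + card P + (card P)\<^sup>2 * (\<delta> * N)))"
proof -
  define w where "w = (\<lambda>n. \<Sum>p\<in>P. if p dvd n then 1 else 0 :: real)"
  have S0: "S \<ge> 0" unfolding S_def by (intro sum_nonneg) auto
  have pos: "p > 0" if "p \<in> P" for p using pr[OF that] by (simp add: prime_gt_0_nat)
  have fin: "finite {m. p * m < N \<and> Q m}" if "p \<in> P" for p Q
    by (rule finite_subset[of _ "{..<N}"]) (use pos[OF that] in \<open>auto intro: le_less_trans[rotated]\<close>)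
  have fin': "finite {m. p * m < N}" if "p \<in> P" for p using fin[OF that, of "\<lambda>_. True"] by simp
  have e1: "norm (\<Sum>n<N. f n * \<nu> n * (S - w n)) \<le> sqrt (N * (N * S + (card P)\<^sup>2))"
  proof -
    have "norm (\<Sum>n<N. f n * \<nu> n * (S - w n)) \<le> (\<Sum>n<N. \<bar>S - w n\<bar>)"
    proof (rule sum_norm_le)
      fix n
      have "norm (f n) * norm (\<nu> n) \<le> 1" using f \<nu> by (simp add: mult_le_one)
      then have "norm (f n) * norm (\<nu> n) * \<bar>S - w n\<bar> \<le> 1 * \<bar>S - w n\<bar>" by (intro mult_right_mono) auto
      moreover have "norm (complex_of_real S - complex_of_real (w n)) = \<bar>S - w n\<bar>" by (metis norm_of_real of_real_diff)
      ultimately show "norm (f n * \<nu> n * (S - w n)) \<le> \<bar>S - w n\<bar>" by (simp add: norm_mult)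
    qed
    also have "\<dots> \<le> sqrt (N * (N * S + (card P)\<^sup>2))"
      using turan_kubilius[OF fP pr, of N] by (intro sum_le_sqrt_card) (simp add: S_def w_def)
    finally show ?thesis .
  qed
  have e2: "(\<Sum>n<N. f n * \<nu> n * w n) = (\<Sum>p\<in>P. \<Sum>m | p * m < N. f (p * m) * \<nu> (p * m))"
  proof -
    have "(\<Sum>n<N. f n * \<nu> n * w n) = (\<Sum>n<N. \<Sum>p\<in>P. if p dvd n then f n * \<nu> n else 0)"
      unfolding w_def of_real_sum sum_distrib_left by (intro sum.cong) auto
    also have "\<dots> = (\<Sum>p\<in>P. \<Sum>n<N. if p dvd n then f n * \<nu> n else 0)" by (rule sum.swap)
    also have "\<dots> = (\<Sum>p\<in>P. \<Sum>n | n < N \<and> p dvd n. f n * \<nu> n)"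
      by (rule sum.cong[OF refl], subst sum.inter_filter[symmetric]) auto
    also have "\<dots> = (\<Sum>p\<in>P. \<Sum>m | p * m < N. f (p * m) * \<nu> (p * m))"
      using pos by (intro sum.cong sum_multiples) auto
    finally show ?thesis .
  qed
  \<comment> \<open>The coefficient of \<open>\<nu> m\<close> after the splitting; it involves
    \<open>\<nu>\<close> only at the primes of \<open>P\<close>.\<close>
  define g where "g = (\<lambda>m. \<Sum>p\<in>P. if p * m < N then \<nu> p * f (p * m) else 0)"
  have e3: "norm ((\<Sum>p\<in>P. \<Sum>m | p * m < N. f (p * m) * \<nu> (p * m)) - (\<Sum>m<N. \<nu> m * g m))
     \<le> 2 * N * (\<Sum>p\<in>P. 1 / (real p)\<^sup>2) + 2 * card P"
  proof -
    have "(\<Sum>m<N. \<nu> m * g m) = (\<Sum>m<N. \<Sum>p\<in>P. if p * m < N then f (p * m) * (\<nu> p * \<nu> m) else 0)"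
      unfolding g_def sum_distrib_left by (intro sum.cong) auto
    also have "\<dots> = (\<Sum>p\<in>P. \<Sum>m<N. if p * m < N then f (p * m) * (\<nu> p * \<nu> m) else 0)" by (rule sum.swap)
    also have "\<dots> = (\<Sum>p\<in>P. \<Sum>m | p * m < N. f (p * m) * (\<nu> p * \<nu> m))"
    proof (rule sum.cong[OF refl])
      fix p assume "p \<in> P"
      then have "{m. p * m < N} = {m \<in> {..<N}. p * m < N}" using pos[of p] by (auto intro: le_less_trans[rotated])
      then show "(\<Sum>m<N. if p * m < N then f (p * m) * (\<nu> p * \<nu> m) else 0) = (\<Sum>m | p * m < N. f (p * m) * (\<nu> p * \<nu> m))"
        by (simp add: sum.inter_filter[symmetric])
    qed
    finally have "norm ((\<Sum>p\<in>P. \<Sum>m | p * m < N. f (p * m) * \<nu> (p * m)) - (\<Sum>m<N. \<nu> m * g m))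
       = norm (\<Sum>p\<in>P. \<Sum>m | p * m < N. f (p * m) * (\<nu> (p * m) - \<nu> p * \<nu> m))"
      by (simp add: sum_subtractf[symmetric] algebra_simps)
    also have "\<dots> \<le> (\<Sum>p\<in>P. 2 * (real N / (real p)\<^sup>2 + 1))"
    proof (rule sum_norm_le)
      fix p assume p: "p \<in> P"
      have "norm (\<Sum>m | p * m < N. f (p * m) * (\<nu> (p * m) - \<nu> p * \<nu> m)) \<le> (\<Sum>m | p * m < N. if p dvd m then 2 else 0)"
      proof (rule sum_norm_le)
        fix m
        show "norm (f (p * m) * (\<nu> (p * m) - \<nu> p * \<nu> m)) \<le> (if p dvd m then 2 else 0)"
        proof (cases "p dvd m")
          case True
          have "norm (\<nu> (p * m) - \<nu> p * \<nu> m) \<le> norm (\<nu> (p * m)) + norm (\<nu> p) * norm (\<nu> m)"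
            by (metis norm_triangle_ineq4 norm_mult)
          also have "\<dots> \<le> 1 + 1" using \<nu> by (intro add_mono) (auto intro: mult_le_one)
          finally have "norm (f (p * m)) * norm (\<nu> (p * m) - \<nu> p * \<nu> m) \<le> 1 * 2" using f by (intro mult_mono) auto
          then show ?thesis using True by (simp add: norm_mult)
        next
          case False then show ?thesis using mult pr p by simp
        qed
      qed
      also have "\<dots> = 2 * real (card {m. p * m < N \<and> p dvd m})"
        using fin' p by (simp add: sum.inter_filter[symmetric])
      also have "card {m. p * m < N \<and> p dvd m} \<le> card {n. n < N \<and> p * p dvd n}"
        by (rule card_inj_on_le[of "\<lambda>m. p * m"]) (use pos[OF p] in \<open>auto simp: inj_on_def\<close>)
      also have "real \<dots> \<le> real N / real (p * p) + 1" using pos[OF p] by (intro card_multiples_lessThan) simp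
      finally show "norm (\<Sum>m | p * m < N. f (p * m) * (\<nu> (p * m) - \<nu> p * \<nu> m)) \<le> 2 * (real N / (real p)\<^sup>2 + 1)"
        by (simp add: power2_eq_square)
    qed
    also have "\<dots> = 2 * N * (\<Sum>p\<in>P. 1 / (real p)\<^sup>2) + 2 * card P"
      by (simp add: sum.distrib sum_distrib_left)
    finally show ?thesis .
  qed
  have e4: "norm (\<Sum>m<N. \<nu> m * g m) \<le> sqrt (N * (N * S + card P + (card P)\<^sup>2 * (\<delta> * N)))"
  proof -
    have "norm (\<Sum>m<N. \<nu> m * g m) \<le> (\<Sum>m<N. norm (g m))"
      using \<nu> by (intro sum_norm_le) (simp add: norm_mult mult_left_le_one_le)
    also have "\<dots> \<le> sqrt (N * (N * S + card P + (card P)\<^sup>2 * (\<delta> * N)))"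
    proof (rule sum_le_sqrt_card)
      define t where "t p p' m = (if p * m < N \<and> p' * m < N then \<nu> p * cnj (\<nu> p') * (f (p * m) * cnj (f (p' * m))) else 0)" for p p' m
      have "complex_of_real (\<Sum>m<N. (norm (g m))\<^sup>2) = (\<Sum>m<N. g m * cnj (g m))"
        unfolding of_real_sum by (intro sum.cong refl complex_norm_square)
      also have "\<dots> = (\<Sum>m<N. \<Sum>p\<in>P. \<Sum>p'\<in>P. t p p' m)"
        unfolding g_def cnj_sum sum_product by (intro sum.cong) (auto simp: t_def)
      also have "\<dots> = (\<Sum>p\<in>P. \<Sum>m<N. \<Sum>p'\<in>P. t p p' m)" by (rule sum.swap)
      also have "\<dots> = (\<Sum>p\<in>P. \<Sum>p'\<in>P. \<Sum>m<N. t p p' m)" by (intro sum.cong refl sum.swap)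
      finally have "norm (complex_of_real (\<Sum>m<N. (norm (g m))\<^sup>2)) = norm (\<Sum>p\<in>P. \<Sum>p'\<in>P. \<Sum>m<N. t p p' m)"
        by (rule arg_cong)
      moreover have "0 \<le> (\<Sum>m<N. (norm (g m))\<^sup>2)" by (intro sum_nonneg) auto
      ultimately have "(\<Sum>m<N. (norm (g m))\<^sup>2) = norm (\<Sum>p\<in>P. \<Sum>p'\<in>P. \<Sum>m<N. t p p' m)"
        unfolding norm_of_real by simp
      also have "\<dots> \<le> (\<Sum>p\<in>P. \<Sum>p'\<in>P. (if p = p' then real N / p + 1 else 0) + \<delta> * N)"
      proof (intro sum_norm_le)
        fix p p' assume p: "p \<in> P" "p' \<in> P"
        show "norm (\<Sum>m<N. t p p' m) \<le> (if p = p' then real N / p + 1 else 0) + \<delta> * N"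
        proof (cases "p = p'")
          case True
          have "norm (\<Sum>m<N. t p p' m) \<le> (\<Sum>m<N. if p * m < N then 1 else 0)"
          proof (rule sum_norm_le)
            fix m
            have "norm (\<nu> p) * norm (\<nu> p) * (norm (f (p * m)) * norm (f (p * m))) \<le> 1"
              using f \<nu> by (intro mult_le_one mult_nonneg_nonneg) auto
            then show "norm (t p p' m) \<le> (if p * m < N then 1 else 0)"
              using True by (simp add: t_def norm_mult)
          qed
          also have "\<dots> = real (card {m \<in> {..<N}. p * m < N})"
            by (simp add: sum.inter_filter[symmetric])
          also have "card {m \<in> {..<N}. p * m < N} \<le> card {n. n < N \<and> p dvd n}"
            by (rule card_inj_on_le[of "\<lambda>m. p * m"]) (use pos[OF p(1)] in \<open>auto simp: inj_on_def\<close>)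
          also have "real \<dots> \<le> real N / real p + 1" using pos[OF p(1)] by (intro card_multiples_lessThan) simp
          finally show ?thesis using True \<delta> by (simp add: add_increasing2)
        next
          case False
          \<comment> \<open>Both conditions together say \<open>max p p' * m < N\<close> and thus
            restrict \<open>m\<close> to an initial segment of length \<open>K \<le> N\<close>. This
            is why the correlations are assumed small for every \<open>K \<le> N\<close>, relative
            to \<open>N\<close>.\<close>
          define d where "d = max p p'"
          define K where "K = (N + d - 1) div d"
          have d: "d > 0" using pos[OF p(1)] by (simp add: d_def less_max_iff_disj)
          have "p * m < N \<and> p' * m < N \<longleftrightarrow> d * m < N" for m
            unfolding d_def by (cases "p \<le> p'") (auto simp: max_def intro: le_less_trans[rotated])
          then have eq: "p * m < N \<and> p' * m < N \<longleftrightarrow> m < K" for m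
            using mult_less_iff_less_ceil_div[OF d] by (simp add: K_def)
          have "m < N" if "m < K" for m
            using that mult_less_iff_less_ceil_div[OF d, of m N] d by (auto simp: K_def intro: le_less_trans[rotated])
          then have KN: "K \<le> N" by (meson leI less_irrefl)
          have "(\<Sum>m<N. t p p' m) = (\<Sum>m<K. \<nu> p * cnj (\<nu> p') * (f (p * m) * cnj (f (p' * m))))"
            using KN by (intro sum.mono_neutral_cong_right) (auto simp: t_def eq)
          also have "\<dots> = \<nu> p * cnj (\<nu> p') * (\<Sum>m<K. f (p * m) * cnj (f (p' * m)))" by (simp add: sum_distrib_left)
          also have "norm \<dots> \<le> 1 * (\<delta> * N)"
            unfolding norm_mult using \<nu> corr[OF p False KN] by (intro mult_mono mult_le_one) auto
          finally show ?thesis using False by simp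
        qed
      qed
      also have "\<dots> = N * S + card P + (card P)\<^sup>2 * (\<delta> * N)"
        using fP by (simp add: sum.distrib S_def sum_distrib_left power2_eq_square)
      finally show "(\<Sum>m<N. (norm (g m))\<^sup>2) \<le> N * S + card P + (card P)\<^sup>2 * (\<delta> * N)" .
    qed
    finally show ?thesis .
  qed
  have "S * norm (\<Sum>n<N. f n * \<nu> n) = norm ((\<Sum>n<N. f n * \<nu> n * (S - w n)) + (\<Sum>n<N. f n * \<nu> n * w n))"
    using S0 by (simp add: sum.distrib[symmetric] ring_distribs sum_distrib_right[symmetric] norm_mult)
  also have "\<dots> = norm ((\<Sum>n<N. f n * \<nu> n * (S - w n)) + ((\<Sum>p\<in>P. \<Sum>m | p * m < N. f (p * m) * \<nu> (p * m)) - (\<Sum>m<N. \<nu> m * g m)) + (\<Sum>m<N. \<nu> m * g m))"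
    by (simp add: e2)
  also have "\<dots> \<le> norm (\<Sum>n<N. f n * \<nu> n * (S - w n)) + norm ((\<Sum>p\<in>P. \<Sum>m | p * m < N. f (p * m) * \<nu> (p * m)) - (\<Sum>m<N. \<nu> m * g m)) + norm (\<Sum>m<N. \<nu> m * g m)"
    by (intro order.trans[OF norm_triangle_ineq] add_mono norm_triangle_ineq order.refl)
  finally show ?thesis using e1 e3 e4 by linarith
qed


text \<open>After division by \<open>S * N\<close> the bound of \<open>katai_finite\<close> is of
  order \<open>1 / sqrt S\<close>, provided that \<open>\<delta>\<close> is small in terms of
  \<open>card P\<close> and \<open>N\<close> is large. Hence the order of the choices:
  \<open>P\<close>, then \<open>\<delta>\<close>, then \<open>N\<close>.\<close>

theorem katai_criterion:
  fixes f \<nu> :: "nat \<Rightarrow> complex" and Q :: "nat set"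
  assumes Q: "\<And>p. p \<in> Q \<Longrightarrow> prime p" and div: "\<And>B. \<exists>P. finite P \<and> P \<subseteq> Q \<and> B \<le> (\<Sum>p\<in>P. 1 / real p)"
    and f: "\<And>n. norm (f n) \<le> 1" and \<nu>: "\<And>n. norm (\<nu> n) \<le> 1"
    and mult: "\<And>p n. prime p \<Longrightarrow> \<not> p dvd n \<Longrightarrow> \<nu> (p * n) = \<nu> p * \<nu> n"
    and corr: "\<And>p p'. p \<in> Q \<Longrightarrow> p' \<in> Q \<Longrightarrow> p \<noteq> p' \<Longrightarrow>
       (\<lambda>N. (\<Sum>n<N. f (p * n) * cnj (f (p' * n))) / of_nat N) \<longlonglongrightarrow> 0"
  shows "(\<lambda>N. (\<Sum>n<N. f n * \<nu> n) / of_nat N) \<longlonglongrightarrow> 0"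
proof (rule LIMSEQ_I)
  fix \<epsilon> :: real assume \<epsilon>: "\<epsilon> > 0"
  define Z where "Z = (\<Sum>n. 1 / (real n)\<^sup>2)"
  have sZ: "summable (\<lambda>n. 1 / (real n)\<^sup>2)" using inverse_power_summable[of 2, where ?'a = real] by (simp add: field_simps)
  have Z0: "Z \<ge> 0" unfolding Z_def by (intro suminf_nonneg sZ) auto
  \<comment> \<open>The final estimate is \<open>N * (2 * Z + 6) / sqrt S\<close>; the 7 makes the
    comparison with \<open>\<epsilon>\<close> strict.\<close>
  define B where "B = max 1 (((2 * Z + 7) / \<epsilon>)\<^sup>2)"
  obtain P where P: "finite P" "P \<subseteq> Q" "B \<le> (\<Sum>p\<in>P. 1 / real p)" using div by blast
  define S where "S = (\<Sum>p\<in>P. 1 / real p)"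
  define c where "c = real (card P)"
  have S1: "S \<ge> 1" and SB: "S \<ge> ((2 * Z + 7) / \<epsilon>)\<^sup>2" using P(3) by (auto simp: S_def B_def)
  have sqS: "sqrt S \<ge> 1" using S1 by simp
  \<comment> \<open>With this choice the correlations of all pairs together cost at most
    \<open>N\<close>.\<close>
  define \<delta> where "\<delta> = 1 / (c\<^sup>2 + 1)"
  have \<delta>: "\<delta> > 0" unfolding \<delta>_def by (simp add: add_nonneg_pos)
  have c\<delta>: "c\<^sup>2 * \<delta> \<le> 1" unfolding \<delta>_def by (simp add: divide_le_eq_1 add_nonneg_pos)
  have "\<exists>N0. \<forall>N\<ge>N0. \<forall>K\<le>N. norm (\<Sum>n<K. f (p * n) * cnj (f (p' * n))) \<le> \<delta> * N"
    if "p \<in> P" "p' \<in> P" "p \<noteq> p'" for p p'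
  proof -
    have "p \<in> Q" "p' \<in> Q" using that P by auto
    from LIMSEQ_D[OF corr[OF this that(3)] \<delta>] obtain K0 where
      K0: "\<And>K. K \<ge> K0 \<Longrightarrow> norm ((\<Sum>n<K. f (p * n) * cnj (f (p' * n))) / of_nat K) < \<delta>" by auto
    obtain N0 :: nat where N0: "real K0 / \<delta> \<le> N0" using real_arch_simple by blast
    have "norm (\<Sum>n<K. f (p * n) * cnj (f (p' * n))) \<le> \<delta> * N" if NK: "N \<ge> N0" "K \<le> N" for N K
    proof (cases "K \<ge> K0 \<and> K > 0")
      case True
      then have "norm (\<Sum>n<K. f (p * n) * cnj (f (p' * n))) \<le> \<delta> * K"
        using K0[of K] by (simp add: norm_divide field_simps)
      also have "\<dots> \<le> \<delta> * N" using \<delta> NK by simp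
      finally show ?thesis .
    next
      case False
      \<comment> \<open>Short sums are covered by the trivial bound, since
        \<open>K0 \<le> \<delta> * N0\<close>.\<close>
      then have "K \<le> K0" by linarith
      have "norm (\<Sum>n<K. f (p * n) * cnj (f (p' * n))) \<le> (\<Sum>n<K. 1)"
        using f by (intro sum_norm_le) (simp add: norm_mult mult_le_one)
      also have "\<dots> \<le> K0" using \<open>K \<le> K0\<close> by simp
      also have "\<dots> \<le> \<delta> * N0" using N0 \<delta> by (simp add: field_simps)
      also have "\<dots> \<le> \<delta> * N" using \<delta> NK by simp
      finally show ?thesis .
    qed
    then show ?thesis by blast
  qed
  then obtain n0 where n0: "\<And>p p' N K. p \<in> P \<Longrightarrow> p' \<in> P \<Longrightarrow> p \<noteq> p' \<Longrightarrow> N \<ge> n0 p p' \<Longrightarrow> K \<le> N \<Longrightarrow>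
     norm (\<Sum>n<K. f (p * n) * cnj (f (p' * n))) \<le> \<delta> * N" by metis
  define M where "M = Suc (\<Sum>p\<in>P. \<Sum>p'\<in>P. n0 p p') + (card P)\<^sup>2 + card P"
  have M: "n0 p p' \<le> M" if "p \<in> P" "p' \<in> P" for p p'
  proof -
    have "n0 p p' \<le> (\<Sum>p'\<in>P. n0 p p')" using that P(1) by (intro member_le_sum) auto
    also have "\<dots> \<le> (\<Sum>p\<in>P. \<Sum>p'\<in>P. n0 p p')" using that P(1)
      by (intro member_le_sum[of p P "\<lambda>p. \<Sum>p'\<in>P. n0 p p'"]) auto
    finally show ?thesis by (simp add: M_def)
  qed
  have "norm ((\<Sum>n<N. f n * \<nu> n) / of_nat N) < \<epsilon>" if N: "N \<ge> M" for N
  proof -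
    have N0: "N > 0" using N by (simp add: M_def)
    have "(card P)\<^sup>2 \<le> N" "card P \<le> N" using N unfolding M_def by linarith+
    then have Nc: "real N \<ge> c\<^sup>2" "real N \<ge> c" unfolding c_def by (metis of_nat_le_iff of_nat_power)+
    have prP: "\<And>p. p \<in> P \<Longrightarrow> prime p" using P Q by auto
    have cr: "norm (\<Sum>n<K. f (p * n) * cnj (f (p' * n))) \<le> \<delta> * N"
      if "p \<in> P" "p' \<in> P" "p \<noteq> p'" "K \<le> N" for p p' K using n0[OF that(1-3) _ that(4)] M[OF that(1,2)] N by simp
    have main: "S * norm (\<Sum>n<N. f n * \<nu> n) \<le> sqrt (N * (N * S + (card P)\<^sup>2))
     + (2 * N * (\<Sum>p\<in>P. 1 / (real p)\<^sup>2) + 2 * card P)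
     + sqrt (N * (N * S + card P + (card P)\<^sup>2 * (\<delta> * N)))"
      unfolding S_def by (rule katai_finite[OF P(1) _ prP N0 f \<nu> mult cr]) (use \<delta> in auto)
    have "N * (N * S + (card P)\<^sup>2) \<le> N * (N * S + N * S)"
    proof (intro mult_left_mono add_left_mono)
      have "real N * 1 \<le> N * S" using S1 by (intro mult_left_mono) auto
      then show "real ((card P)\<^sup>2) \<le> N * S" using Nc(1) unfolding c_def of_nat_power by linarith
    qed auto
    also have "\<dots> \<le> 4 * (real N * real N * S)" using S1 by (simp add: algebra_simps)
    also have "\<dots> = (2 * N * sqrt S)\<^sup>2" using S1 by (simp add: power_mult_distrib power2_eq_square)
    finally have s1: "sqrt (N * (N * S + (card P)\<^sup>2)) \<le> 2 * N * sqrt S" by (rule real_le_lsqrt[rotated]) (use S1 in auto)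
    have "N * (N * S + card P + (card P)\<^sup>2 * (\<delta> * N)) \<le> N * (N * S + N * S + N * S)"
    proof (intro mult_left_mono add_mono)
      have NS: "real N * 1 \<le> N * S" using S1 by (intro mult_left_mono) auto
      then show "real (card P) \<le> N * S" using Nc by (simp add: c_def)
      have "real ((card P)\<^sup>2) * (\<delta> * N) = (c\<^sup>2 * \<delta>) * N" by (simp add: c_def)
      also have "\<dots> \<le> 1 * real N" using c\<delta> by (intro mult_right_mono) auto
      finally show "real ((card P)\<^sup>2) * (\<delta> * N) \<le> N * S" using NS by simp
    qed auto
    also have "\<dots> \<le> 4 * (real N * real N * S)" using S1 by (simp add: algebra_simps)
    also have "\<dots> = (2 * N * sqrt S)\<^sup>2" using S1 by (simp add: power_mult_distrib power2_eq_square)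
    finally have s2: "sqrt (N * (N * S + card P + (card P)\<^sup>2 * (\<delta> * N))) \<le> 2 * N * sqrt S" by (rule real_le_lsqrt[rotated]) (use S1 in auto)
    have "(\<Sum>p\<in>P. 1 / (real p)\<^sup>2) \<le> Z" unfolding Z_def by (intro sum_le_suminf sZ P) auto
    then have "2 * N * (\<Sum>p\<in>P. 1 / (real p)\<^sup>2) \<le> 2 * N * Z" by (intro mult_left_mono) auto
    moreover have "2 * real (card P) \<le> 2 * N" using Nc by (simp add: c_def)
    ultimately have "S * norm (\<Sum>n<N. f n * \<nu> n) \<le> 4 * N * sqrt S + 2 * N * (Z + 1)"
      using main s1 s2 by (simp add: algebra_simps)
    also have "\<dots> \<le> 4 * N * sqrt S + 2 * N * (Z + 1) * sqrt S"
      using sqS Z0 mult_left_mono[OF sqS, of "2 * N * (Z + 1)"] by simp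
    also have "\<dots> = N * sqrt S * (2 * Z + 6)" by (simp add: algebra_simps)
    finally have "sqrt S * (sqrt S * norm (\<Sum>n<N. f n * \<nu> n)) \<le> sqrt S * (N * (2 * Z + 6))"
      using S1 by (simp add: mult.assoc[symmetric] mult.commute mult.left_commute)
    then have le: "sqrt S * norm (\<Sum>n<N. f n * \<nu> n) \<le> N * (2 * Z + 6)" using sqS by simp
    have "(2 * Z + 7) / \<epsilon> \<le> sqrt S" using SB Z0 \<epsilon> by (intro real_le_rsqrt)
    then have "2 * Z + 6 < \<epsilon> * sqrt S" using \<epsilon> by (simp add: field_simps)
    then have "N * (2 * Z + 6) < N * (\<epsilon> * sqrt S)" using N0 by simp
    with le have "sqrt S * norm (\<Sum>n<N. f n * \<nu> n) < sqrt S * (\<epsilon> * N)" by (simp add: algebra_simps)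
    then have "norm (\<Sum>n<N. f n * \<nu> n) < \<epsilon> * N" using sqS by simp
    then show ?thesis using N0 by (simp add: norm_divide field_simps)
  qed
  then show "\<exists>M. \<forall>N\<ge>M. norm ((\<Sum>n<N. f n * \<nu> n) / of_nat N - 0) < \<epsilon>" by auto
qed

section \<open>Correlations along two dilations\<close>

text \<open>Each fibre costs at most its cardinality, and the one that contains both
  \<open>u1\<close> and \<open>u2\<close> saves \<open>2 - norm (\<Psi> u1 + \<Psi> u2)\<close>.
  This saving is what makes \<open>T\<close> decrease in \<open>T_step\<close>.\<close>

lemma sum_norm_fibre_le:
  fixes \<Psi> :: "'a \<Rightarrow> complex" and h :: "'a \<Rightarrow> 'b"
  assumes fin: "finite U" "finite S" and h: "h ` U \<subseteq> S" and unit: "\<And>u. u \<in> U \<Longrightarrow> norm (\<Psi> u) = 1"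
    and u: "u1 \<in> U" "u2 \<in> U" "u1 \<noteq> u2" "h u1 = h u2"
  shows "(\<Sum>s\<in>S. norm (\<Sum>u | u \<in> U \<and> h u = s. \<Psi> u)) \<le> real (card U) - 2 + norm (\<Psi> u1 + \<Psi> u2)"
proof -
  \<comment> \<open>A termwise majorant: \<open>u1\<close> and \<open>u2\<close> share the norm of
    their sum equally, so that the bounds for the fibres add up to a single sum over
    \<open>U\<close>.\<close>
  define c where "c = (\<lambda>u. if u = u1 \<or> u = u2 then norm (\<Psi> u1 + \<Psi> u2) / 2 else 1)"
  have split: "V = {u1, u2} \<union> (V - {u1, u2})" if "u1 \<in> V" "u2 \<in> V" for V using that by auto
  have le: "norm (\<Sum>u | u \<in> U \<and> h u = s. \<Psi> u) \<le> (\<Sum>u | u \<in> U \<and> h u = s. c u)" for s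
  proof (cases "h u1 = s")
    case True
    define V where "V = {u. u \<in> U \<and> h u = s}"
    have V: "finite V" "u1 \<in> V" "u2 \<in> V" "V \<subseteq> U" using fin u True by (auto simp: V_def)
    have "(\<Sum>u\<in>V. \<Psi> u) = \<Psi> u1 + \<Psi> u2 + (\<Sum>u\<in>V - {u1, u2}. \<Psi> u)"
      by (subst split[OF V(2,3)], subst sum.union_disjoint) (use V u in auto)
    moreover have "norm (\<Sum>u\<in>V - {u1, u2}. \<Psi> u) \<le> (\<Sum>u\<in>V - {u1, u2}. 1)"
      using unit V(4) by (intro sum_norm_le) auto
    moreover have "(\<Sum>u\<in>V. c u) = c u1 + c u2 + (\<Sum>u\<in>V - {u1, u2}. c u)"
      by (subst split[OF V(2,3)], subst sum.union_disjoint) (use V u in auto)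
    moreover have "(\<Sum>u\<in>V - {u1, u2}. c u) = (\<Sum>u\<in>V - {u1, u2}. 1)" by (intro sum.cong) (auto simp: c_def)
    ultimately show ?thesis unfolding V_def[symmetric] using norm_triangle_ineq[of "\<Psi> u1 + \<Psi> u2" "\<Sum>u\<in>V - {u1, u2}. \<Psi> u"]
      by (simp add: c_def)
  next
    case False
    then show ?thesis using u unit by (intro sum_norm_le) (auto simp: c_def)
  qed
  have "(\<Sum>s\<in>S. norm (\<Sum>u | u \<in> U \<and> h u = s. \<Psi> u)) \<le> (\<Sum>s\<in>S. \<Sum>u | u \<in> U \<and> h u = s. c u)"
    by (intro sum_mono le)
  also have "\<dots> = (\<Sum>u\<in>U. c u)" using sum.group[OF fin h] by simp
  also have "\<dots> = norm (\<Psi> u1 + \<Psi> u2) + real (card (U - {u1, u2}))"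
  proof -
    have "(\<Sum>u\<in>U. c u) = c u1 + c u2 + (\<Sum>u\<in>U - {u1, u2}. c u)"
      by (subst split[OF u(1,2)], subst sum.union_disjoint) (use fin u in auto)
    moreover have "(\<Sum>u\<in>U - {u1, u2}. c u) = (\<Sum>u\<in>U - {u1, u2}. 1)" by (intro sum.cong) (auto simp: c_def)
    ultimately show ?thesis by (simp add: c_def)
  qed
  also have "real (card (U - {u1, u2})) = real (card U) - 2"
  proof -
    have "card {u1, u2} = 2" using u by simp
    moreover have "card {u1, u2} \<le> card U" using u fin by (intro card_mono) auto
    ultimately show ?thesis using u fin by (subst card_Diff_subset) auto
  qed
  finally show ?thesis by simp
qed

text \<open>By the parallelogram law the square of the left side is \<open>4 - t\<close>, where
  \<open>t\<close> is the square of \<open>norm (1 - w)\<close>; and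
  \<open>sqrt (4 - t) \<le> 2 - t / 4\<close>.\<close>

lemma norm_add_unit_le:
  fixes w :: complex assumes "norm w = 1"
  shows "norm (1 + w) \<le> 2 - (norm (1 - w))\<^sup>2 / 4"
proof -
  define t where "t = (norm (1 - w))\<^sup>2"
  have eq: "(norm (1 + w))\<^sup>2 = 4 - t"
    using assms unfolding t_def cmod_power2 by (simp add: cmod_def power2_eq_square algebra_simps)
  have t4: "t \<le> 4" using eq by (metis diff_ge_0_iff_ge zero_le_power2)
  have "(norm (1 + w))\<^sup>2 \<le> (2 - t/4)\<^sup>2" unfolding eq by (simp add: power2_eq_square algebra_simps)
  then show ?thesis unfolding t_def[symmetric] by (rule power2_le_imp_le) (use t4 in simp)
qed

lemma sum_blocks:
  fixes F :: "nat \<Rightarrow> 'a::comm_monoid_add"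
  shows "(\<Sum>n<a * b. F n) = (\<Sum>u<a. \<Sum>v<b. F (b * u + v))"
proof (induction a)
  case (Suc a)
  have "(\<Sum>n<Suc a * b. F n) = (\<Sum>n<a * b. F n) + (\<Sum>n\<in>{a*b..<a*b+b}. F n)"
    by (simp add: add.commute lessThan_atLeast0 sum.atLeastLessThan_concat)
  also have "(\<Sum>n\<in>{a*b..<a*b+b}. F n) = (\<Sum>v<b. F (b * a + v))"
    by (simp add: sum.nat_group lessThan_atLeast0 sum.shift_bounds_nat_ivl[of F 0 "a*b" b, simplified add_0] algebra_simps sum.atLeastLessThan_shift_0[of F "a*b"])
  finally show ?case using Suc by simp
qed simp

text \<open>\<open>star\<close> is the defining relation with \<open>m = q^l * z\<close>, multiplied
  out. The digits of \<open>z\<close> from position \<open>r\<close> on can be counted towards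
  \<open>n\<close>, so \<open>z\<close> ranges over all numbers; see
  \<open>semimultiplicative_star\<close>.\<close>

locale semimult =
  fixes q r :: nat and f :: "nat \<Rightarrow> complex"
  assumes q2: "q \<ge> 2" and unit: "norm (f n) = 1" and f0: "f 0 = 1"
    and star: "k < q^l \<Longrightarrow> q^(l + r) dvd n \<Longrightarrow> f (n + q^l * z + k) * f (q^l * z) = f (q^l * z + k) * f (n + q^l * z)"
begin

lemma nz: "f n \<noteq> 0" using unit[of n] by auto

lemma q_pos: "q ^ l > 0" using q2 by simp

lemma split_zero: "k < q^l \<Longrightarrow> q^(l + r) dvd n \<Longrightarrow> f (n + k) = f n * f k"
  using star[of k l n 0] f0 by simp

lemma mult_cnj_self: "f n * cnj (f n) = 1" using unit by (metis complex_norm_square one_power2 of_real_1)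

context
  fixes a b :: nat assumes ab: "a > 0" "b > 0"
begin

text \<open>
  The state of \<open>v < q ^ (l + r)\<close> consists of the carries out of position \<open>l + r\<close> together with the top
  \<open>r\<close> digits in the products \<open>a * v\<close> and \<open>b * v\<close>; by \<open>star\<close> it is all that the value at
  \<open>q ^ (l + r) * x + v\<close> remembers of \<open>v\<close> apart from the factor \<open>g v\<close>. The quantity \<open>T l\<close> is the
  \<open>l1\<close>-norm of the vector of averages of \<open>g\<close> over the states.
\<close>

definition g where "g v = f (a * v) * cnj (f (b * v))"

definition st where "st l v = (a * v div q^l, b * v div q^l)"

text \<open>The factor that the digits \<open>x\<close> above the block add when the block is in
  state \<open>s\<close>; see \<open>g_step\<close>.\<close>

definition Ps where "Ps l s x = (case s of (z, z') \<Rightarrow>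
  f (q^(l+r) * (a * x) + q^l * z) / f (q^l * z) * cnj (f (q^(l+r) * (b * x) + q^l * z') / f (q^l * z')))"

text \<open>Transition function of the transducer, \<open>u\<close> being the block of the next
  \<open>K\<close> digits; see \<open>st_step\<close>.\<close>

definition nx where "nx K s u = (case s of (z, z') \<Rightarrow> ((q^r * (a * u) + z) div q^K, (q^r * (b * u) + z') div q^K))"

definition H where "H l s = (\<Sum>v | v < q^(l+r) \<and> st l v = s. g v)"

definition ST where "ST = {..<a * q^r} \<times> {..<b * q^r}"

definition T where "T l = (\<Sum>s\<in>ST. norm (H l s)) / q^(l+r)"

lemma norm_g: "norm (g v) = 1" by (simp add: g_def norm_mult unit)

lemma norm_Ps: "norm (Ps l s x) = 1" by (simp add: Ps_def norm_mult norm_divide unit split: prod.split)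

lemma finite_ST: "finite ST" by (simp add: ST_def)

lemma st_in: assumes "v < q^(l+r)" shows "st l v \<in> ST"
proof -
  have "c * v div q^l < c * q^r" if "c > 0" for c
  proof -
    have "c * v < c * q^(l+r)" using assms that by simp
    then show ?thesis using q_pos[of l] by (simp add: less_mult_imp_div_less power_add algebra_simps)
  qed
  then show ?thesis using ab by (auto simp: st_def ST_def)
qed

lemma f_step: assumes "v < q^(l+r)"
  shows "f (c * (q^(l+r) * x + v)) = f (c * v) * (f (q^(l+r) * (c * x) + q^l * (c * v div q^l)) / f (q^l * (c * v div q^l)))"
proof -
  have e: "c * (q^(l+r) * x + v) = q^(l+r) * (c * x) + q^l * (c * v div q^l) + (c * v) mod q^l"
    by (simp add: algebra_simps)
  have e2: "q^l * (c * v div q^l) + (c * v) mod q^l = c * v" by simp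
  have "f (c * (q^(l+r) * x + v)) * f (q^l * (c * v div q^l)) = f (c * v) * f (q^(l+r) * (c * x) + q^l * (c * v div q^l))"
    unfolding e using star[of "(c * v) mod q^l" l "q^(l+r) * (c * x)" "c * v div q^l"] q_pos[of l] e2 by simp
  then show ?thesis using nz by (simp add: field_simps)
qed

lemma g_step: "v < q^(l+r) \<Longrightarrow> g (q^(l+r) * x + v) = g v * Ps l (st l v) x"
  by (simp add: g_def f_step Ps_def st_def)

lemma st_step: "st (l + K) (q^(l+r) * u + v) = nx K (st l v) u"
proof -
  have "c * (q^(l+r) * u + v) div q^(l+K) = (q^r * (c * u) + c * v div q^l) div q^K" for c
  proof -
    have "c * (q^(l+r) * u + v) = q^l * (q^r * (c * u)) + c * v" by (simp add: algebra_simps power_add)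
    then have "c * (q^(l+r) * u + v) div q^l = q^r * (c * u) + c * v div q^l"
      using q_pos[of l] by (metis div_mult_self4 less_not_refl2 add.commute)
    then show ?thesis by (simp add: power_add div_mult2_eq)
  qed
  then show ?thesis by (simp add: st_def nx_def)
qed

lemma T_nonneg: "T l \<ge> 0" unfolding T_def by (intro divide_nonneg_nonneg sum_nonneg) auto

lemma T_le_1: "T l \<le> 1"
proof -
  have "(\<Sum>s\<in>ST. norm (H l s)) \<le> (\<Sum>s\<in>ST. \<Sum>v | v \<in> {..<q^(l+r)} \<and> st l v = s. 1)"
    unfolding H_def by (intro sum_mono) (use norm_g in \<open>auto intro!: sum_norm_le[THEN order.trans]\<close>)
  also have "\<dots> = (\<Sum>v\<in>{..<q^(l+r)}. 1)" by (rule sum.group) (use finite_ST st_in in auto)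
  finally show ?thesis unfolding T_def using q_pos[of "l+r"] by (simp add: field_simps)
qed

text \<open>The digits above the block act only through phases that depend on its state, so the
  bound is uniform in \<open>x\<close>.\<close>

lemma block_le: "norm (\<Sum>v<q^(l+r). g (q^(l+r) * x + v)) \<le> q^(l+r) * T l"
proof -
  have "(\<Sum>v<q^(l+r). g (q^(l+r) * x + v)) = (\<Sum>v<q^(l+r). g v * Ps l (st l v) x)"
    by (intro sum.cong) (auto simp: g_step)
  also have "\<dots> = (\<Sum>s\<in>ST. \<Sum>v | v \<in> {..<q^(l+r)} \<and> st l v = s. g v * Ps l (st l v) x)"
    by (rule sum.group[symmetric]) (use finite_ST st_in in auto)
  also have "\<dots> = (\<Sum>s\<in>ST. H l s * Ps l s x)"
    unfolding H_def sum_distrib_right by (intro sum.cong) auto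
  also have "norm \<dots> \<le> (\<Sum>s\<in>ST. norm (H l s))" by (intro sum_norm_le) (simp add: norm_mult norm_Ps)
  finally show ?thesis unfolding T_def using q_pos[of "l+r"] by (simp add: field_simps)
qed

lemma corr_le: "norm (\<Sum>n<N. g n) \<le> N * T l + q^(l+r)"
proof -
  define Q where "Q = q^(l+r)"
  have Q: "Q > 0" unfolding Q_def by (rule q_pos)
  define d where "d = N div Q"
  have N: "d * Q \<le> N" "N < d * Q + Q" using Q dividend_less_div_times[of Q N] unfolding d_def by (auto simp: algebra_simps)
  have "(\<Sum>n<N. g n) = (\<Sum>n<d*Q. g n) + (\<Sum>n\<in>{d*Q..<N}. g n)"
    using N by (simp add: lessThan_atLeast0 sum.atLeastLessThan_concat)
  moreover have "norm (\<Sum>n<d*Q. g n) \<le> N * T l"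
  proof -
    have "norm (\<Sum>n<d*Q. g n) \<le> (\<Sum>u<d. Q * T l)" unfolding sum_blocks
      using block_le[of l] by (intro sum_norm_le) (simp add: Q_def)
    also have "\<dots> = real (d * Q) * T l" by simp
    also have "\<dots> \<le> N * T l" using N T_nonneg by (intro mult_right_mono) (auto simp del: of_nat_mult)
    finally show ?thesis .
  qed
  moreover have "norm (\<Sum>n\<in>{d*Q..<N}. g n) \<le> (\<Sum>n\<in>{d*Q..<N}. 1)" by (intro sum_norm_le) (simp add: norm_g)
  moreover have "N - d * Q \<le> Q" using N by simp
  then have "(\<Sum>n\<in>{d*Q..<N}. 1 :: real) \<le> Q" by (simp del: of_nat_diff)
  ultimately show ?thesis unfolding Q_def[symmetric]
    using norm_triangle_ineq[of "\<Sum>n<d*Q. g n" "\<Sum>n\<in>{d*Q..<N}. g n"] by simp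
qed

lemma H_step: "H (l + K) s' = (\<Sum>s\<in>ST. H l s * (\<Sum>u | u \<in> {..<q^K} \<and> nx K s u = s'. Ps l s u))"
proof -
  define Q where "Q = q^(l+r)"
  have "H (l + K) s' = (\<Sum>v<q^K * Q. if st (l+K) v = s' then g v else 0)"
    unfolding H_def Q_def by (subst sum.inter_filter[symmetric]) (auto simp: power_add algebra_simps)
  also have "\<dots> = (\<Sum>u<q^K. \<Sum>v<Q. if nx K (st l v) u = s' then g v * Ps l (st l v) u else 0)"
    unfolding sum_blocks by (intro sum.cong refl) (auto simp: Q_def st_step g_step)
  also have "\<dots> = (\<Sum>v<Q. \<Sum>u<q^K. if nx K (st l v) u = s' then g v * Ps l (st l v) u else 0)" by (rule sum.swap)
  also have "\<dots> = (\<Sum>v<Q. g v * (\<Sum>u | u \<in> {..<q^K} \<and> nx K (st l v) u = s'. Ps l (st l v) u))"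
    unfolding sum_distrib_left by (rule sum.cong[OF refl], subst sum.inter_filter) auto
  also have "\<dots> = (\<Sum>s\<in>ST. \<Sum>v | v \<in> {..<Q} \<and> st l v = s. g v * (\<Sum>u | u \<in> {..<q^K} \<and> nx K (st l v) u = s'. Ps l (st l v) u))"
    by (rule sum.group[symmetric]) (use finite_ST st_in in \<open>auto simp: Q_def\<close>)
  also have "\<dots> = (\<Sum>s\<in>ST. H l s * (\<Sum>u | u \<in> {..<q^K} \<and> nx K s u = s'. Ps l s u))"
    unfolding H_def sum_distrib_right by (intro sum.cong) (auto simp: Q_def)
  finally show ?thesis .
qed

lemma nx_in: assumes "s \<in> ST" "u < q^K" shows "nx K s u \<in> ST"
proof -
  have "(q^r * (c * u) + z) div q^K < c * q^r" if "z < c * q^r" for c z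
  proof -
    have "q^r * (c * u) + z < c * q^r * Suc u" using that by (simp add: algebra_simps)
    also have "\<dots> \<le> c * q^r * q^K" using assms by (intro mult_left_mono) auto
    finally show ?thesis by (simp add: less_mult_imp_div_less)
  qed
  then show ?thesis using assms by (auto simp: nx_def ST_def)
qed

text \<open>The transition from any state has \<open>l1\<close>-norm at most \<open>q^K\<close>, and
  the merging of two inputs in the state \<open>(0, 0)\<close> lowers this by a quarter of the
  square of \<open>norm (1 - w)\<close>, whatever the state. \<open>K0\<close> zero digits flush the
  carries out before \<open>u\<close> is read, so that \<open>w\<close> does not depend on the
  state; \<open>K\<close> digits are enough to flush out \<open>a * u\<close> and
  \<open>b * u\<close> as well.\<close>

lemma T_step:
  assumes K0: "a * q^r \<le> q^K0" "b * q^r \<le> q^K0" and u: "u > 0"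
    and K: "q^(r+K0) * (a * u) + a * q^r \<le> q^K" "q^(r+K0) * (b * u) + b * q^r \<le> q^K"
  shows "T (l + K) \<le> T l * (1 - (norm (f (q^(l+r+K0) * (a * u)) - f (q^(l+r+K0) * (b * u))))\<^sup>2 / (4 * q^K))"
proof -
  define w where "w = f (q^(l+r+K0) * (a * u)) * cnj (f (q^(l+r+K0) * (b * u)))"
  have w1: "norm w = 1" by (simp add: w_def norm_mult unit)
  have nw: "norm (1 - w) = norm (f (q^(l+r+K0) * (a * u)) - f (q^(l+r+K0) * (b * u)))"
  proof -
    define x y where "x = f (q^(l+r+K0) * (a * u))" and "y = f (q^(l+r+K0) * (b * u))"
    have "(x - y) * cnj y = x * cnj y - 1" unfolding y_def using mult_cnj_self by (simp add: algebra_simps)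
    then have "norm (x - y) * norm y = norm (w - 1)" by (metis norm_mult complex_mod_cnj w_def x_def y_def)
    then show ?thesis unfolding x_def y_def using unit by (simp add: norm_minus_commute)
  qed
  define t where "t = (norm (1 - w))\<^sup>2 / 4"
  have inner: "(\<Sum>s'\<in>ST. norm (\<Sum>u | u \<in> {..<q^K} \<and> nx K s u = s'. Ps l s u)) \<le> q^K - t" if s: "s \<in> ST" for s
  proof -
    obtain z z' where zz: "s = (z, z')" "z < a * q^r" "z' < b * q^r" using s by (auto simp: ST_def)
    txt \<open>From every state, the inputs \<open>0\<close> and \<open>q ^ K0 * u\<close> both lead to the state \<open>(0, 0)\<close>, with phases \<open>1\<close> and \<open>w\<close>.\<close>
    have 1: "Ps l s 0 = 1" using nz by (simp add: zz Ps_def)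
    have h: "f (q^(l+r) * (c * (q^K0 * u)) + q^l * x) / f (q^l * x) = f (q^(l+r+K0) * (c * u))"
      if "x < c * q^r" "c * q^r \<le> q^K0" for c x
    proof -
      have "q^l * x < q^(l+K0)" using that q_pos[of l] by (simp add: power_add)
      then have "f (q^(l+r+K0) * (c * u) + q^l * x) = f (q^(l+r+K0) * (c * u)) * f (q^l * x)"
        by (rule split_zero) (simp add: power_add ac_simps)
      moreover have "q^(l+r) * (c * (q^K0 * u)) = q^(l+r+K0) * (c * u)" by (simp add: power_add ac_simps)
      ultimately show ?thesis using nz by (simp only: nonzero_mult_div_cancel_right[OF nz])
    qed
    have 2: "Ps l s (q^K0 * u) = w" unfolding zz(1) Ps_def w_def prod.case h[OF zz(2) K0(1)] h[OF zz(3) K0(2)] ..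
    have 3: "nx K s 0 = (0, 0)"  using zz K by (auto simp: nx_def)
    have 4: "nx K s (q^K0 * u) = (0, 0)" using zz K by (auto simp: nx_def power_add ac_simps)
    have "1 * (q^K0 * u) \<le> q^r * a * (q^K0 * u)" using ab q_pos[of r] by (intro mult_right_mono) (auto simp: Suc_le_eq)
    then have "q^K0 * u \<le> q^(r+K0) * (a * u)" by (simp add: power_add ac_simps)
    moreover have "a * q^r > 0" using ab q_pos[of r] by simp
    ultimately have 5: "q^K0 * u < q^K" using K by linarith
    have "(\<Sum>s'\<in>ST. norm (\<Sum>u | u \<in> {..<q^K} \<and> nx K s u = s'. Ps l s u)) \<le> real (card {..<q^K}) - 2 + norm (Ps l s 0 + Ps l s (q^K0 * u))"
      by (rule sum_norm_fibre_le) (use finite_ST nx_in[OF s] norm_Ps 3 4 5 q_pos[of K] q_pos[of K0] u in auto)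
    also have "\<dots> \<le> q^K - t" using norm_add_unit_le[OF w1] 1 2 by (simp add: t_def)
    finally show ?thesis .
  qed
  have "(\<Sum>s'\<in>ST. norm (H (l + K) s')) \<le> (\<Sum>s'\<in>ST. \<Sum>s\<in>ST. norm (H l s) * norm (\<Sum>u | u \<in> {..<q^K} \<and> nx K s u = s'. Ps l s u))"
    unfolding H_step by (intro sum_mono sum_norm_le) (simp add: norm_mult)
  also have "\<dots> = (\<Sum>s\<in>ST. norm (H l s) * (\<Sum>s'\<in>ST. norm (\<Sum>u | u \<in> {..<q^K} \<and> nx K s u = s'. Ps l s u)))"
    unfolding sum_distrib_left by (rule sum.swap)
  also have "\<dots> \<le> (\<Sum>s\<in>ST. norm (H l s) * (q^K - t))" by (intro sum_mono mult_left_mono inner) auto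
  also have "\<dots> = (\<Sum>s\<in>ST. norm (H l s)) * (q^K - t)" by (simp add: sum_distrib_right)
  finally have "T (l + K) \<le> (\<Sum>s\<in>ST. norm (H l s)) * (q^K - t) / q^(l+K+r)"
    unfolding T_def using q_pos[of "l+K+r"] by (intro divide_right_mono) auto
  also have "\<dots> = T l * (1 - t / q^K)" unfolding T_def using q_pos[of K] q_pos[of "l+r"] by (simp add: power_add field_simps)
  finally show ?thesis unfolding t_def nw by simp
qed

text \<open>If \<open>T\<close> came arbitrarily close to 0, \<open>corr_le\<close> would make the
  averages tend to 0. Hence \<open>T \<ge> \<tau> > 0\<close>, and each use of \<open>T_step\<close>
  costs at least a fixed multiple of the squared distance at level \<open>l + r + K0\<close>. Since
  \<open>T\<close> stays in \<open>[0, 1]\<close>, the total cost is bounded.\<close>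

lemma corr_or_summable:
  assumes "\<not> ((\<lambda>N. (\<Sum>n<N. f (a * n) * cnj (f (b * n))) / of_nat N) \<longlonglongrightarrow> 0)"
  shows "summable (\<lambda>l. (norm (f (q^l * (a * u)) - f (q^l * (b * u))))\<^sup>2)"
proof (cases "u = 0")
  case False
  then have u: "u > 0" by simp
  have "\<exists>\<tau>>0. \<forall>l. T l \<ge> \<tau>"
  proof (rule ccontr)
    assume no: "\<not> ?thesis"
    have "(\<lambda>N. (\<Sum>n<N. g n) / of_nat N) \<longlonglongrightarrow> 0"
    proof (rule LIMSEQ_I)
      fix \<epsilon> :: real assume \<epsilon>: "\<epsilon> > 0"
      then obtain l where l: "T l < \<epsilon> / 2" using no by (metis half_gt_zero not_le)
      obtain N0 :: nat where N0: "q^(l+r) / (\<epsilon>/2) < N0" using reals_Archimedean2 by blast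
      have "norm ((\<Sum>n<N. g n) / of_nat N - 0) < \<epsilon>" if "N \<ge> Suc N0" for N
      proof -
        have N: "real N > 0" "real N \<ge> N0" using that by auto
        have "q^(l+r) < \<epsilon>/2 * N0" using N0 \<epsilon> by (simp add: field_simps)
        also have "\<dots> \<le> \<epsilon>/2 * N" using N \<epsilon> by (intro mult_left_mono) auto
        finally have "real (q^(l+r)) < \<epsilon>/2 * N" by simp
        moreover have "N * T l \<le> \<epsilon>/2 * N" using l N by (simp add: mult.commute)
        ultimately have "norm (\<Sum>n<N. g n) < \<epsilon> * N" using corr_le[of N l] by (simp add: field_simps)
        then show ?thesis using N by (simp add: norm_divide field_simps)
      qed
      then show "\<exists>no. \<forall>N\<ge>no. norm ((\<Sum>n<N. g n) / of_nat N - 0) < \<epsilon>" by blast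
    qed
    then show False using assms by (simp add: g_def)
  qed
  then obtain \<tau> where \<tau>: "\<tau> > 0" "\<And>l. T l \<ge> \<tau>" by blast
  have big: "\<exists>k. m \<le> q^k" for m using q2 by (metis less_exp order.trans less_imp_le power_mono zero_le)
  obtain K0 where "(a + b) * q^r \<le> q^K0" using big by blast
  then have K0: "a * q^r \<le> q^K0" "b * q^r \<le> q^K0" by (auto simp: algebra_simps)
  obtain K where "q^(r+K0) * ((a+b) * u) + (a+b) * q^r \<le> q^K" using big by blast
  then have K: "q^(r+K0) * (a * u) + a * q^r \<le> q^K" "q^(r+K0) * (b * u) + b * q^r \<le> q^K" by (auto simp: algebra_simps)
  define d where "d = (\<lambda>l. (norm (f (q^l * (a * u)) - f (q^l * (b * u))))\<^sup>2)"
  have d0: "d l \<ge> 0" for l by (simp add: d_def)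
  define C where "C = \<tau> / (4 * q^K)"
  have C: "C > 0" using \<tau> q_pos[of K] by (simp add: C_def)
  have step: "C * d (l + (r + K0)) \<le> T l - T (l + K)" for l
  proof -
    have "C * d (l + (r + K0)) = \<tau> * (d (l + (r + K0)) / (4 * q^K))" by (simp add: C_def)
    also have "\<dots> \<le> T l * (d (l + (r + K0)) / (4 * q^K))" using \<tau>(2) d0 by (intro mult_right_mono) auto
    also have "\<dots> \<le> T l - T (l + K)" using T_step[OF K0 u K, of l] by (simp add: d_def algebra_simps add.assoc)
    finally show ?thesis .
  qed
  \<comment> \<open>Telescoping with step \<open>K\<close> leaves the first \<open>K\<close> values
    of \<open>T\<close>, each at most 1.\<close>
  have tele: "(\<Sum>l<n. T l - T (l + K)) \<le> K" for n
  proof -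
    have "(\<Sum>l<n. T l) \<le> (\<Sum>l<n+K. T l)" using T_nonneg by (intro sum_mono2) auto
    also have "\<dots> = (\<Sum>l<K. T l) + (\<Sum>l<n. T (l + K))"
    proof -
      have "(\<Sum>l<K + n. T l) = (\<Sum>l<K. T l) + (\<Sum>l<n. T (K + l))" by (induction n) (simp_all add: add.assoc)
      then show ?thesis by (simp add: add.commute)
    qed
    also have "(\<Sum>l<K. T l) \<le> (\<Sum>l<K. 1)" using T_le_1 by (intro sum_mono)
    finally show ?thesis by (simp add: sum_subtractf)
  qed
  have "(\<Sum>l<n. d (l + (r + K0))) \<le> K / C" for n
  proof -
    have "C * (\<Sum>l<n. d (l + (r + K0))) \<le> (\<Sum>l<n. T l - T (l + K))"
      unfolding sum_distrib_left by (intro sum_mono step)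
    also have "\<dots> \<le> K" by (rule tele)
    finally show ?thesis using C by (simp add: field_simps)
  qed
  then have "summable (\<lambda>l. d (l + (r + K0)))" using d0 by (intro summableI_nonneg_bounded) auto
  then have "summable d" by (simp add: summable_iff_shift)
  then show ?thesis unfolding d_def .
qed simp

end

end

section \<open>Square-summable closeness\<close>

text \<open>A congruence for products and conjugates of sequences of modulus 1, and compatible with
  shifts. Such sequences modulo \<open>\<doteq>\<close> form a group, in which the identities of the
  next section are computed.\<close>

definition l2_close :: "(nat \<Rightarrow> complex) \<Rightarrow> (nat \<Rightarrow> complex) \<Rightarrow> bool" (infix "\<doteq>" 50) where
  "u \<doteq> v \<longleftrightarrow> summable (\<lambda>l. (norm (u l - v l))\<^sup>2)"

lemma l2_close_refl [simp]: "u \<doteq> u" by (simp add: l2_close_def)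

lemma l2_close_sym: "u \<doteq> v \<Longrightarrow> v \<doteq> u" by (simp add: l2_close_def norm_minus_commute)

lemma summable_square_add_le:
  fixes x y z :: "nat \<Rightarrow> real"
  assumes "summable (\<lambda>l. (x l)\<^sup>2)" "summable (\<lambda>l. (y l)\<^sup>2)" "\<And>l. 0 \<le> z l" "\<And>l. z l \<le> x l + y l"
  shows "summable (\<lambda>l. (z l)\<^sup>2)"
proof (rule summable_comparison_test')
  show "summable (\<lambda>l. 2 * ((x l)\<^sup>2 + (y l)\<^sup>2))" using assms by (intro summable_mult summable_add)
  fix l
  have "(z l)\<^sup>2 \<le> (x l + y l)\<^sup>2" using assms by (intro power_mono) auto
  also have "\<dots> \<le> 2 * ((x l)\<^sup>2 + (y l)\<^sup>2)" using sum_squares_bound[of "x l" "y l"] by (simp add: power2_sum)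
  finally show "norm ((z l)\<^sup>2) \<le> 2 * ((x l)\<^sup>2 + (y l)\<^sup>2)" by simp
qed

lemma l2_close_trans [trans]:
  assumes "u \<doteq> v" "v \<doteq> w" shows "u \<doteq> w"
  unfolding l2_close_def
proof (rule summable_square_add_le[where x = "\<lambda>l. norm (u l - v l)" and y = "\<lambda>l. norm (v l - w l)"])
  fix l show "norm (u l - w l) \<le> norm (u l - v l) + norm (v l - w l)"
    using norm_triangle_ineq[of "u l - v l" "v l - w l"] by simp
qed (use assms in \<open>auto simp: l2_close_def\<close>)

lemma l2_close_mult:
  assumes "u \<doteq> v" "u' \<doteq> v'" "\<And>l. norm (u' l) = 1" "\<And>l. norm (v l) = 1"
  shows "(\<lambda>l. u l * u' l) \<doteq> (\<lambda>l. v l * v' l)"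
  unfolding l2_close_def
proof (rule summable_square_add_le[where x = "\<lambda>l. norm (u l - v l)" and y = "\<lambda>l. norm (u' l - v' l)"])
  fix l
  have "u l * u' l - v l * v' l = (u l - v l) * u' l + v l * (u' l - v' l)" by (simp add: algebra_simps)
  then show "norm (u l * u' l - v l * v' l) \<le> norm (u l - v l) + norm (u' l - v' l)"
    using assms(3,4) norm_triangle_ineq[of "(u l - v l) * u' l" "v l * (u' l - v' l)"] by (simp add: norm_mult)
qed (use assms in \<open>auto simp: l2_close_def\<close>)

lemma l2_close_power:
  assumes "u \<doteq> v" "\<And>l. norm (u l) = 1" "\<And>l. norm (v l) = 1"
  shows "(\<lambda>l. u l ^ n) \<doteq> (\<lambda>l. v l ^ n)"
proof (induction n)
  case (Suc n)
  then show ?case using l2_close_mult[OF assms(1) Suc] assms by (simp add: norm_power)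
qed simp

lemma l2_close_cnj: "u \<doteq> v \<Longrightarrow> (\<lambda>l. cnj (u l)) \<doteq> (\<lambda>l. cnj (v l))"
  unfolding l2_close_def complex_cnj_diff[symmetric] complex_mod_cnj .

lemma l2_close_shift: "(\<lambda>l. u (l + c)) \<doteq> (\<lambda>l. v (l + c)) \<longleftrightarrow> u \<doteq> v"
  unfolding l2_close_def using summable_iff_shift[of "\<lambda>l. (norm (u l - v l))\<^sup>2" c] by simp

text \<open>Conjugation inverts numbers of modulus 1, so this is the passage from
  \<open>A / B = C / D\<close> to \<open>A / C = B / D\<close>.\<close>

lemma l2_close_rearrange:
  assumes "(\<lambda>l. A l * cnj (B l)) \<doteq> (\<lambda>l. C l * cnj (D l))"
    and "\<And>l. norm (A l) = 1" "\<And>l. norm (B l) = 1" "\<And>l. norm (C l) = 1" "\<And>l. norm (D l) = 1"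
  shows "(\<lambda>l. A l * cnj (C l)) \<doteq> (\<lambda>l. B l * cnj (D l))"
proof -
  have m: "x * cnj x = 1" if "norm x = 1" for x :: complex using that by (metis complex_norm_square one_power2 of_real_1)
  have "(\<lambda>l. (A l * cnj (B l)) * (B l * cnj (C l))) \<doteq> (\<lambda>l. (C l * cnj (D l)) * (B l * cnj (C l)))"
    by (rule l2_close_mult[OF assms(1)]) (use assms in \<open>auto simp: norm_mult\<close>)
  moreover have "(A l * cnj (B l)) * (B l * cnj (C l)) = A l * cnj (C l)" for l
    using m[OF assms(3), of l] by (metis mult.assoc mult.commute mult.left_neutral)
  moreover have "(C l * cnj (D l)) * (B l * cnj (C l)) = B l * cnj (D l)" for l
    using m[OF assms(4), of l] by (metis mult.assoc mult.commute mult.left_neutral)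
  ultimately show ?thesis by simp
qed

section \<open>Values of f along powers of q, modulo square-summable errors\<close>

context semimult
begin

definition F where "F n = (\<lambda>l. f (q^l * n))"
text \<open>The quotient \<open>F n / F m\<close>, written with a conjugate because \<open>f\<close>
  has modulus 1.\<close>

definition E where "E n m = (\<lambda>l. f (q^l * n) * cnj (f (q^l * m)))"

lemma norm_F [simp]: "norm (F n l) = 1" and norm_E [simp]: "norm (E n m l) = 1"
  by (simp_all add: F_def E_def unit norm_mult)

lemma F_shift: "F (q^c * n) = (\<lambda>l. F n (l + c))" and E_shift: "E (q^c * n) (q^c * m) = (\<lambda>l. E n m (l + c))"
  by (auto simp: F_def E_def power_add ac_simps)

lemma E_swap: "E a b \<doteq> E c d \<Longrightarrow> E a c \<doteq> E b d"
  using l2_close_rearrange[of "\<lambda>l. f (q^l * a)" "\<lambda>l. f (q^l * b)" "\<lambda>l. f (q^l * c)" "\<lambda>l. f (q^l * d)"] unit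
  by (simp add: E_def)

lemma E_chain: "E a b \<doteq> u \<Longrightarrow> E b c \<doteq> v \<Longrightarrow> (\<And>l. norm (u l) = 1) \<Longrightarrow> E a c \<doteq> (\<lambda>l. u l * v l)"
proof -
  assume "E a b \<doteq> u" "E b c \<doteq> v" "\<And>l. norm (u l) = 1"
  then have "(\<lambda>l. E a b l * E b c l) \<doteq> (\<lambda>l. u l * v l)" by (intro l2_close_mult) auto
  moreover have "E a b l * E b c l = E a c l" for l
    using mult_cnj_self[of "q^l * b"] unfolding E_def by (metis mult.assoc mult.commute mult.left_neutral)
  ultimately show ?thesis by simp
qed

text \<open>Digits of \<open>w\<close> are separated from \<open>n\<close> and \<open>m\<close> by
  \<open>r\<close> zeros, so they contribute the same factor to both values and cancel in the
  quotient.\<close>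

lemma E_far:
  assumes "n < q^c" "m < q^c"
  shows "E (q^(c+r) * w + n) (q^(c+r) * w + m) = E n m"
proof
  fix l
  have h: "f (q^l * (q^(c+r) * w + n)) = f (q^l * (q^(c+r) * w)) * f (q^l * n)" if "n < q^c" for n
    unfolding distrib_left by (rule split_zero[of _ "l + c"]) (use that q_pos[of l] in \<open>auto simp: power_add\<close>)
  show "E (q^(c+r) * w + n) (q^(c+r) * w + m) l = E n m l"
    unfolding E_def h[OF assms(1)] h[OF assms(2)] using mult_cnj_self[of "q^l * (q^(c+r) * w)"]
    by (simp add: algebra_simps)
qed

context
  fixes p p' :: nat
  assumes FF: "\<And>u. F (p * u) \<doteq> F (p' * u)"
begin

text \<open>
  In the quotient group modulo \<open>\<doteq>\<close>, writing \<open>F n\<close> for the class of \<open>f (q ^ l * n)\<close>: the ratio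
  \<open>F (q ^ r * p * x + z) / F z\<close> with \<open>z = \<lfloor>p t\<rfloor>\<close> equals the same ratio for \<open>p'\<close>. As \<open>t\<close> grows, the two
  floors jump at different times unless \<open>t\<close> is an integer, so the ratio does not change when \<open>z\<close>
  increases by 1 to a non-multiple of \<open>p\<close>.
\<close>

lemma E_floor:
  "E (q^r * (p * x) + p * y div q^c) (p * y div q^c) \<doteq> E (q^r * (p' * x) + p' * y div q^c) (p' * y div q^c)"
proof -
  \<comment> \<open>By \<open>star\<close> the low part \<open>k\<close> of \<open>p * y\<close>
    cancels in the quotient, and the factor \<open>q^c\<close> becomes a shift of \<open>l\<close>,
    harmless by \<open>l2_close_shift\<close>.\<close>
  have key: "E (p * (q^(c+r) * x + y)) (p * y) = (\<lambda>l. E (q^r * (p * x) + p * y div q^c) (p * y div q^c) (l + c))" for p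
  proof
    fix l
    define z k where "z = p * y div q^c" and "k = p * y mod q^c"
    have py: "p * y = q^c * z + k" by (simp add: z_def k_def)
    have "q^l * k < q^(l + c)" using q_pos[of l] q_pos[of c] by (simp add: power_add k_def)
    then have "f (q^(l+c+r) * (p * x) + q^(l+c) * z + q^l * k) * f (q^(l+c) * z) = f (q^(l+c) * z + q^l * k) * f (q^(l+c+r) * (p * x) + q^(l+c) * z)"
      by (intro star) auto
    moreover have "q^(l+c+r) * (p * x) + q^(l+c) * z + q^l * k = q^l * (p * (q^(c+r) * x + y))"
      unfolding distrib_left py by (simp add: algebra_simps power_add)
    moreover have "q^(l+c) * z + q^l * k = q^l * (p * y)" unfolding py by (simp add: algebra_simps power_add)
    moreover have "q^(l+c+r) * (p * x) + q^(l+c) * z = q^(l+c) * (q^r * (p * x) + z)" by (simp add: algebra_simps power_add)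
    ultimately have e: "f (q^l * (p * (q^(c+r) * x + y))) * f (q^(l+c) * z) = f (q^l * (p * y)) * f (q^(l+c) * (q^r * (p * x) + z))" by simp
    have "f (q^l * (p * (q^(c+r) * x + y))) = f (q^l * (p * (q^(c+r) * x + y))) * f (q^(l+c) * z) * cnj (f (q^(l+c) * z))"
      using mult_cnj_self[of "q^(l+c) * z"] by (simp add: mult.assoc)
    then have "f (q^l * (p * (q^(c+r) * x + y))) * cnj (f (q^l * (p * y))) = f (q^l * (p * y)) * cnj (f (q^l * (p * y))) * (f (q^(l+c) * (q^r * (p * x) + z)) * cnj (f (q^(l+c) * z)))"
      unfolding e by simp
    then show "E (p * (q^(c+r) * x + y)) (p * y) l = E (q^r * (p * x) + p * y div q^c) (p * y div q^c) (l + c)"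
      unfolding E_def z_def mult_cnj_self by simp
  qed
  have "E (p * (q^(c+r) * x + y)) (p * y) \<doteq> E (p' * (q^(c+r) * x + y)) (p' * y)"
    using l2_close_mult[OF FF[of "q^(c+r) * x + y"] l2_close_cnj[OF FF[of y]]] unit by (simp add: E_def F_def)
  then show ?thesis unfolding key l2_close_shift .
qed

lemma D_periodic:
  assumes cop: "coprime p p'" and pos: "p > 0" "p' > 0" and z: "\<not> p dvd Suc z"
  shows "E (q^r * (p * x) + Suc z) (q^r * (p * x) + z) \<doteq> E (Suc z) z"
proof -
  \<comment> \<open>\<open>y / Q\<close> plays the role of the real number \<open>t\<close>. The
    grid has to be fine enough to separate distinct jump points \<open>i / p\<close> and
    \<open>j / p'\<close>, which differ by at least \<open>1 / (p * p')\<close>.\<close>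
  obtain c where c: "p * p' < q^c" using q2 by (metis less_exp order.strict_trans2 power_mono zero_le)
  define Q where "Q = q^c"
  \<comment> \<open>The first grid point at or after \<open>t = (z + 1) / p\<close>, where the floor
    for \<open>p\<close> jumps to \<open>z + 1\<close>; \<open>y1\<close> is the last grid point
    before it.\<close>
  define y2 where "y2 = (Suc z * Q + p - 1) div p"
  have Q: "Q > p * p'" "Q > 0" using c q_pos[of c] unfolding Q_def by blast+
  have Qp: "p < Q" using Q pos by (metis le_less_trans mult_le_mono2 nat_mult_1_right Suc_leI One_nat_def)
  have y2: "Suc z * Q \<le> p * y2" "p * y2 < Suc z * Q + p"
  proof -
    have "Suc z * Q + p - 1 < p * Suc ((Suc z * Q + p - 1) div p)" using pos by (metis dividend_less_times_div mult_Suc_right)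
    then show "Suc z * Q \<le> p * y2" using pos unfolding y2_def by simp
    have "p * y2 \<le> Suc z * Q + p - 1" unfolding y2_def by simp
    then show "p * y2 < Suc z * Q + p" using pos by linarith
  qed
  have y20: "y2 > 0" using y2(1) Q by (metis gr0I mult_0_right mult_eq_0_iff le_zero_eq not_less0 nat.distinct(1))
  define y1 where "y1 = y2 - 1"
  have y12: "y2 = Suc y1" using y20 y1_def by simp
  have y1: "p * y1 < Suc z * Q" "Suc z * Q \<le> p * y1 + p" using y2 unfolding y12 by auto
  have z2: "p * y2 div Q = Suc z"
    using y2 Qp by (intro div_nat_eqI) (auto simp: algebra_simps)
  have z1: "p * y1 div Q = z"
    using y1 Qp by (intro div_nat_eqI) (auto simp: algebra_simps)
  have same: "p' * y1 div Q = p' * y2 div Q"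
  proof (rule ccontr)
    assume ne: "p' * y1 div Q \<noteq> p' * y2 div Q"
    define j where "j = p' * y2 div Q"
    have "p' * y1 div Q \<le> j" unfolding j_def y12 by (intro div_le_mono) auto
    then have "p' * y1 div Q < j" using ne j_def by simp
    then have j1: "p' * y1 < j * Q" using Q by (metis div_less_iff_less_mult)
    have j2: "j * Q \<le> p' * y2" by (simp add: j_def)
    txt \<open>Both \<open>j p Q\<close> and \<open>p' (z+1) Q\<close> lie within \<open>p p' < Q\<close> of \<open>p p' y2\<close>, so the integers \<open>j p\<close> and \<open>p' (z+1)\<close> agree.\<close>
    have a1: "p * p' * y1 < j * p * Q" using j1 pos by (metis mult.assoc mult.commute nat_mult_less_cancel1)
    have a2: "j * p * Q \<le> p * p' * y1 + p * p'" using mult_le_mono2[OF j2, of p] unfolding y12 by (simp add: algebra_simps)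
    have a3: "p * p' * y1 < p' * Suc z * Q" using y1(1) pos by (metis mult.assoc mult.commute nat_mult_less_cancel1)
    have a4: "p' * Suc z * Q \<le> p * p' * y1 + p * p'" using mult_le_mono2[OF y1(2), of p'] by (simp add: algebra_simps)
    have "j * p * Q < (p' * Suc z + 1) * Q" "p' * Suc z * Q < (j * p + 1) * Q" unfolding add_mult_distrib mult_1 using a1 a2 a3 a4 Q by linarith+
    then have "j * p < p' * Suc z + 1" "p' * Suc z < j * p + 1" using Q by (metis mult_less_cancel2)+
    then have "j * p = p' * Suc z" by linarith
    then have "p dvd p' * Suc z" by (metis dvd_triv_right)
    then show False using coprime_dvd_mult_right_iff[OF cop, of "Suc z"] z by blast
  qed
  have "E (q^r * (p * x) + Suc z) (Suc z) \<doteq> E (q^r * (p' * x) + p' * y2 div Q) (p' * y2 div Q)"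
    using E_floor[of x y2 c] z2 by (simp add: Q_def)
  also have "\<dots> \<doteq> E (q^r * (p * x) + z) z"
    using E_floor[of x y1 c, THEN l2_close_sym] z1 same by (simp add: Q_def)
  finally show ?thesis by (rule E_swap)
qed

end

text \<open>\<open>D_periodic\<close> gives the shifts by multiples of \<open>q^r * p\<close> and of
  \<open>q^r * p'\<close>, and Bezout combines them to a shift by \<open>q^r\<close>. The conditions
  on divisibility are met by adding \<open>q^(c+r) * w\<close>, which \<open>E_far\<close> makes
  invisible: among \<open>w = 0, 1, 2\<close> each prime excludes at most one value, as it is at
  least 3 and coprime to \<open>q\<close>.\<close>

lemma D_periodic_qr:
  assumes FF: "\<And>u. F (p * u) \<doteq> F (p' * u)"
    and p: "prime p" "prime p'" "p \<noteq> p'" "p \<ge> 3" "p' \<ge> 3" "coprime p q" "coprime p' q"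
  shows "E (Suc (z + q^r)) (z + q^r) \<doteq> E (Suc z) z"
proof -
  have cop: "coprime p p'" using p by (simp add: primes_coprime)
  have pos: "p > 0" "p' > 0" using p by auto
  obtain x x' where xx: "p * x = p' * x' + 1"
  proof -
    obtain x y where "p * x = p' * y + gcd p p'" using bezout_nat[of p p'] pos by auto
    then show ?thesis using cop that by simp
  qed
  obtain c where c: "Suc (z + q^r) < q^c" using q2 by (metis less_exp order.strict_trans2 power_mono zero_le)
  have inj: "w = w'" if "prime p" "p \<ge> 3" "coprime p q" "p dvd A + q^(c+r) * w" "p dvd A + q^(c+r) * w'" "w \<in> {0,1,2}" "w' \<in> {0,1,2}" for w w' A p :: nat
  proof -
    have mono: "w = w'" if le: "w \<le> w'" and d: "p dvd A + q^(c+r) * w" "p dvd A + q^(c+r) * w'" "w' \<le> 2" for w w'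
    proof -
      have "p dvd (A + q^(c+r) * w') - (A + q^(c+r) * w)" using d dvd_diff_nat by blast
      also have "\<dots> = q^(c+r) * (w' - w)" using le by (simp add: algebra_simps)
      finally have "p dvd w' - w" using \<open>coprime p q\<close> by (simp add: coprime_dvd_mult_right_iff)
      moreover have "w' - w < p" using d \<open>p \<ge> 3\<close> by simp
      ultimately show ?thesis using le nat_dvd_not_less by fastforce
    qed
    have "w \<le> 2" "w' \<le> 2" using that(6,7) by auto
    then show ?thesis using mono[OF _ that(4,5)] mono[OF _ that(5,4)] by (metis nat_le_linear)
  qed
  have "\<exists>w. \<not> p dvd Suc z + q^(c+r) * w \<and> \<not> p' dvd Suc (z + q^r) + q^(c+r) * w"
  proof (rule ccontr)
    assume "\<not> ?thesis"
    then have all: "p dvd Suc z + q^(c+r) * w \<or> p' dvd Suc (z + q^r) + q^(c+r) * w" for w by blast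
    have "(0::nat) = 1 \<or> (0::nat) = 2 \<or> (1::nat) = 2"
      using all[of 0] all[of 1] all[of 2] inj[OF p(1,4,6), of "Suc z"] inj[OF p(2,5,7), of "Suc (z + q^r)"] by blast
    then show False by simp
  qed
  then obtain w where w: "\<not> p dvd Suc z + q^(c+r) * w" "\<not> p' dvd Suc (z + q^r) + q^(c+r) * w" by blast
  define y where "y = q^(c+r) * w"
  have far: "E (y + Suc z) (y + z) = E (Suc z) z" "E (y + Suc (z + q^r)) (y + (z + q^r)) = E (Suc (z + q^r)) (z + q^r)"
    unfolding y_def by (rule E_far; use c in simp)+
  have FF': "F (p' * u) \<doteq> F (p * u)" for u using FF l2_close_sym by blast
  have eq: "q^r * (p' * x') + Suc (y + z + q^r) = q^r * (p * x) + Suc (y + z)" "q^r * (p' * x') + (y + z + q^r) = q^r * (p * x) + (y + z)"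
    unfolding xx by (simp_all add: algebra_simps)
  have "E (q^r * (p' * x') + Suc (y + z + q^r)) (q^r * (p' * x') + (y + z + q^r)) \<doteq> E (Suc (y + z + q^r)) (y + z + q^r)"
    by (rule D_periodic[OF FF']) (use w cop pos in \<open>auto simp: y_def coprime_commute ac_simps\<close>)
  then have "E (Suc (z + q^r)) (z + q^r) \<doteq> E (q^r * (p * x) + Suc (y + z)) (q^r * (p * x) + (y + z))"
    using far(2) unfolding eq by (simp add: l2_close_sym add.assoc)
  also have "E (q^r * (p * x) + Suc (y + z)) (q^r * (p * x) + (y + z)) \<doteq> E (Suc (y + z)) (y + z)"
    by (rule D_periodic[OF FF]) (use w cop pos in \<open>auto simp: y_def ac_simps\<close>)
  also have "\<dots> = E (Suc z) z" using far(1) by simp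
  finally show ?thesis .
qed

text \<open>By \<open>D_periodic_qr\<close> the quotient of \<open>F (z + q^r)\<close> and
  \<open>F z\<close> does not depend on \<open>z\<close>, so \<open>F\<close> is a power along
  multiples of \<open>q^r\<close>; and passing from \<open>n\<close> to \<open>q^r * n\<close> is
  only a shift of \<open>l\<close>.\<close>

lemma F_power:
  assumes FF: "\<And>u. F (p * u) \<doteq> F (p' * u)"
    and p: "prime p" "prime p'" "p \<noteq> p'" "p \<ge> 3" "p' \<ge> 3" "coprime p q" "coprime p' q"
  shows "F n \<doteq> (\<lambda>l. F 1 l ^ n)"
proof -
  have E0: "E n 0 = F n" for n by (auto simp: E_def F_def f0)
  have 1: "E (z + q^r) z \<doteq> F (q^r)" for z
  proof (induction z)
    case 0 then show ?case by (simp add: E0)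
  next
    case (Suc z)
    have "E (Suc (z + q^r)) (Suc z) \<doteq> E (z + q^r) z" by (rule E_swap[OF D_periodic_qr[OF assms]])
    also have "\<dots> \<doteq> F (q^r)" by (rule Suc)
    finally show ?case by simp
  qed
  have "F (q^r * n) \<doteq> (\<lambda>l. F (q^r) l ^ n)"
  proof (induction n)
    case 0 then show ?case by (simp add: F_def f0)
  next
    case (Suc n)
    have "E (q^r * n + q^r) 0 \<doteq> (\<lambda>l. F (q^r) l * F (q^r) l ^ n)"
      by (rule E_chain[OF 1]) (use Suc in \<open>auto simp: E0\<close>)
    then show ?case by (simp add: E0 algebra_simps)
  qed
  then have "(\<lambda>l. F n (l + r)) \<doteq> (\<lambda>l. F 1 (l + r) ^ n)"
    using F_shift[of r n] F_shift[of r 1] by simp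
  then show ?thesis using l2_close_shift[of "F n" r "\<lambda>l. F 1 l ^ n"] by simp
qed

end

section \<open>Periodic approximation\<close>

lemma norm_cis_minus_one_sq: "(norm (cis x - 1))\<^sup>2 = 2 - 2 * cos x"
  unfolding cmod_power2 using sin_cos_squared_add[of x] by (simp add: power2_eq_square algebra_simps)

lemma norm_cis_diff_le: "norm (cis x - cis y) \<le> \<bar>x - y\<bar>"
proof -
  have "cis x - cis y = cis y * (cis (x - y) - 1)" by (simp add: algebra_simps cis_mult)
  then have "norm (cis x - cis y) = norm (cis (x - y) - 1)" by (simp add: norm_mult)
  also have "\<dots> \<le> \<bar>x - y\<bar>"
  proof (rule power2_le_imp_le)
    define t where "t = (x - y) / 2"
    have t2: "x - y = 2 * t" by (simp add: t_def)
    have "(norm (cis (x - y) - 1))\<^sup>2 = 2 - 2 * cos (2 * t)" unfolding norm_cis_minus_one_sq t2 ..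
    also have "\<dots> = 4 * (sin t)\<^sup>2" using cos_double_sin[of t] by simp
    also have "\<dots> \<le> 4 * t\<^sup>2" using abs_sin_x_le_abs_x[of t] by (simp add: abs_le_square_iff)
    finally show "(norm (cis (x - y) - 1))\<^sup>2 \<le> \<bar>x - y\<bar>\<^sup>2" by (simp add: t_def power2_eq_square)
  qed simp
  finally show ?thesis .
qed

lemma norm_root_of_unity:
  fixes \<omega> :: complex assumes "\<omega> ^ d = 1" "d > 0" shows "norm \<omega> = 1"
proof -
  have "norm \<omega> ^ d = 1" using assms(1) by (metis norm_one norm_power)
  then show ?thesis using assms(2) by (metis norm_ge_zero power_eq_1_iff abs_norm_cancel real_norm_def less_numeral_extra(3))
qed

text \<open>Write \<open>u = cis \<theta>\<close> and
  \<open>d * \<theta> = 2 * pi * j + \<beta>\<close> with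
  \<open>\<bar>\<beta>\<bar> \<le> pi\<close>. Then \<open>u\<close> differs from the root of unity
  belonging to \<open>j\<close> by the angle \<open>\<beta> / d\<close>, and \<open>u ^ d\<close>
  differs from 1 by the larger angle \<open>\<beta>\<close>; up to \<open>pi\<close> chords grow
  with the angle.\<close>

lemma nearest_root_of_unity:
  fixes u :: complex assumes "norm u = 1" and d: "d > 0"
  shows "\<exists>\<omega>. \<omega> ^ d = 1 \<and> norm (u - \<omega>) \<le> norm (u ^ d - 1)"
proof -
  define \<theta> where "\<theta> = Arg u"
  have u: "u = cis \<theta>" using assms cis_Arg[of u] by (cases "u = 0") (auto simp: \<theta>_def sgn_div_norm)
  define j where "j = round (d * \<theta> / (2 * pi))"
  define \<beta> where "\<beta> = d * \<theta> - 2 * pi * j"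
  define \<omega> where "\<omega> = cis (2 * pi * j / d)"
  have "\<bar>of_int j - d * \<theta> / (2 * pi)\<bar> \<le> 1 / 2" unfolding j_def by (rule of_int_round_abs_le)
  then have "2 * pi * \<bar>of_int j - d * \<theta> / (2 * pi)\<bar> \<le> 2 * pi * (1/2)" by (intro mult_left_mono) auto
  moreover have "2 * pi * \<bar>of_int j - d * \<theta> / (2 * pi)\<bar> = \<bar>2 * pi * (of_int j - d * \<theta> / (2 * pi))\<bar>"
    unfolding abs_mult by simp
  moreover have "2 * pi * (of_int j - d * \<theta> / (2 * pi)) = - \<beta>" unfolding \<beta>_def by (simp add: field_simps)
  ultimately have \<beta>: "\<bar>\<beta>\<bar> \<le> pi" by simp
  have "\<omega> ^ d = cis (real d * (2 * pi * j / d))" unfolding \<omega>_def by (rule Complex.DeMoivre)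
  also have "real d * (2 * pi * j / d) = 2 * pi * j" using d by simp
  also have "cis (2 * pi * j) = 1" by (rule cis_multiple_2pi) simp
  finally have \<omega>1: "\<omega> ^ d = 1" .
  have ud: "u ^ d = cis \<beta>"
    unfolding u Complex.DeMoivre \<beta>_def cis_divide[symmetric] using cis_multiple_2pi[of j] by simp
  have "u = \<omega> * cis (\<beta> / d)" unfolding u \<omega>_def cis_mult \<beta>_def using d by (simp add: field_simps)
  then have "norm (u - \<omega>) = norm (\<omega> * (cis (\<beta> / d) - 1))" by (simp add: algebra_simps)
  also have "\<dots> = norm (cis (\<beta> / d) - 1)" by (simp add: norm_mult \<omega>_def)
  also have "\<dots> \<le> norm (cis \<beta> - 1)"
  proof (rule power2_le_imp_le)
    have "\<bar>\<beta> / d\<bar> \<le> \<bar>\<beta>\<bar>" using d by (simp add: abs_div_pos[symmetric] divide_le_eq mult_left_le_one_le mult_le_cancel_left1)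
    then have "cos \<bar>\<beta> / d\<bar> \<ge> cos \<bar>\<beta>\<bar>" using \<beta> by (intro cos_monotone_0_pi_le) auto
    then show "(norm (cis (\<beta> / d) - 1))\<^sup>2 \<le> (norm (cis \<beta> - 1))\<^sup>2" by (simp add: norm_cis_minus_one_sq cos_abs_real del: abs_divide)
  qed simp
  finally show ?thesis using \<omega>1 ud by (intro exI[of _ \<omega>]) simp
qed

lemma roots_of_unity_separated:
  assumes d: "d > 0"
  shows "\<exists>\<delta>>0. \<forall>x y :: complex. x ^ d = 1 \<longrightarrow> y ^ d = 1 \<longrightarrow> norm (x - y) < \<delta> \<longrightarrow> x = y"
proof -
  define S where "S = {z :: complex. z ^ d = 1}"
  define A where "A = (\<lambda>(x, y). norm (x - y)) ` (S \<times> S - Id)"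
  have fin: "finite S" unfolding S_def using d finite_nth_roots[of d 1] by simp
  then have fA: "finite (insert 1 A)" unfolding A_def by auto
  have pos: "a > 0" if "a \<in> insert 1 A" for a using that by (auto simp: A_def)
  have "Min (insert 1 A) \<le> norm (x - y)" if "x ^ d = 1" "y ^ d = 1" "x \<noteq> y" for x y :: complex
    by (rule Min_le[OF fA]) (use that in \<open>force simp: A_def S_def\<close>)
  moreover have "Min (insert 1 A) > 0" using fA pos by (subst Min_gr_iff) auto
  ultimately show ?thesis by (metis not_le)
qed

text \<open>The factor 8 comes from the points with \<open>norm (z - 1) \<ge> 1/2\<close>, where
  only \<open>\<bar>Arg z\<bar> \<le> pi < 4\<close> is used; closer to 1 the logarithm gives the
  factor 2.\<close>

lemma abs_Arg_le:
  fixes z :: complex assumes "norm z = 1" shows "\<bar>Arg z\<bar> \<le> 8 * norm (z - 1)"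
proof (cases "norm (z - 1) < 1/2")
  case True
  have "z \<noteq> 0" using assms by auto
  then have "\<bar>Arg z\<bar> = \<bar>Im (Ln z)\<bar>" by (simp add: Arg_eq_Im_Ln)
  also have "\<dots> \<le> norm (Ln (1 + (z - 1)))" using abs_Im_le_cmod[of "Ln z"] by simp
  also have "\<dots> \<le> 2 * norm (z - 1)" by (rule norm_Ln_le[OF True])
  finally show ?thesis by simp
next
  case False
  have "\<bar>Arg z\<bar> \<le> pi" using mpi_less_Arg[of z] Arg_le_pi[of z] by simp
  also have "\<dots> \<le> 4" using pi_less_4 by simp
  finally show ?thesis using False by simp
qed

text \<open>For \<open>x\<close> uniform below \<open>q^(M+R)\<close>, the summands are functions of
  windows of \<open>R\<close> digits, and windows at distance at least \<open>R\<close> are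
  independent, so the centred summands are orthogonal. For the other pairs, at most
  \<open>2 * R\<close> for each index, centring doubles the bound to \<open>2 * s b\<close>, and the
  product is split by \<open>2 x y \<le> x^2 + y^2\<close>; this adds up to the factor 8.\<close>

lemma digit_variance:
  fixes \<phi> :: "nat \<Rightarrow> nat \<Rightarrow> real" and s :: "nat \<Rightarrow> real"
  assumes q: "q \<ge> (2::nat)" and bd: "\<And>b w. w < q^R \<Longrightarrow> \<bar>\<phi> b w\<bar> \<le> s b"
  shows "\<exists>m. (\<Sum>x<q^(M+R). ((\<Sum>b<M. \<phi> b (x div q^b mod q^R)) - m)\<^sup>2) \<le> 8 * R * q^(M+R) * (\<Sum>b<M. (s b)\<^sup>2)"
proof -
  have qp: "q^n > 0" for n using q by simp
  define av where "av b = (\<Sum>w<q^R. \<phi> b w) / q^R" for b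
  define \<psi> where "\<psi> b w = \<phi> b w - av b" for b w
  define Y where "Y b x = \<psi> b (x div q^b mod q^R)" for b x
  define X where "X = q^(M+R)"
  have s0: "s b \<ge> 0" for b using bd[of 0 b] qp[of R] by linarith
  have avb: "\<bar>av b\<bar> \<le> s b" for b
  proof -
    have "\<bar>\<Sum>w<q^R. \<phi> b w\<bar> \<le> (\<Sum>w<q^R. s b)" by (intro order.trans[OF sum_abs] sum_mono bd) auto
    then show ?thesis unfolding av_def using qp[of R] by (simp add: abs_div_pos[symmetric] divide_le_eq mult.commute)
  qed
  have \<psi>b: "\<bar>\<psi> b w\<bar> \<le> 2 * s b" if "w < q^R" for b w using bd[OF that, of b] avb[of b] unfolding \<psi>_def by linarith
  have Yb: "\<bar>Y b x\<bar> \<le> 2 * s b" for b x unfolding Y_def using qp[of R] by (intro \<psi>b) simp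
  have \<psi>0: "(\<Sum>w<q^R. \<psi> b w) = 0" for b unfolding \<psi>_def av_def using qp[of R] by (simp add: sum_subtractf)
  \<comment> \<open>With \<open>x = q^(b+R) * u + v\<close> the first factor depends on
    \<open>v\<close> only and the second on \<open>u\<close> only, and the sum of the first over
    \<open>v\<close> is 0.\<close>
  have orth: "(\<Sum>x<X. Y b x * Y b' x) = 0" if "b < M" "b + R \<le> b'" for b b'
  proof -
    have X: "X = q^(M-b) * q^(b+R)" unfolding X_def using that by (simp add: power_add[symmetric])
    define e where "e = b' - (b + R)"
    have e: "b' = b + R + e" using that by (simp add: e_def)
    have "(\<Sum>x<X. Y b x * Y b' x) = (\<Sum>u<q^(M-b). \<Sum>v<q^(b+R). \<psi> b (v div q^b) * \<psi> b' (u div q^e mod q^R))"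
      unfolding X sum_blocks
    proof (intro sum.cong refl)
      fix u v assume v: "v \<in> {..<q^(b+R)}"
      have "(q^(b+R) * u + v) div q^b = q^R * u + v div q^b"
        using qp[of b] by (simp add: power_add mult.assoc)
      moreover have "v div q^b < q^R" using v by (simp add: less_mult_imp_div_less power_add mult.commute)
      moreover have "(q^(b+R) * u + v) div q^b' = u div q^e"
        using v qp[of "b+R"] by (simp add: e power_add[of q "b+R" e] div_mult2_eq)
      ultimately show "Y b (q^(b+R) * u + v) * Y b' (q^(b+R) * u + v) = \<psi> b (v div q^b) * \<psi> b' (u div q^e mod q^R)"
        unfolding Y_def by simp
    qed
    also have "\<dots> = (\<Sum>u<q^(M-b). (\<Sum>v<q^(b+R). \<psi> b (v div q^b)) * \<psi> b' (u div q^e mod q^R))"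
      by (simp add: sum_distrib_right)
    also have "(\<Sum>v<q^(b+R). \<psi> b (v div q^b)) = (\<Sum>w<q^R. \<Sum>t<q^b. \<psi> b ((q^b * w + t) div q^b))"
      using sum_blocks[of "\<lambda>v. \<psi> b (v div q^b)" "q^R" "q^b"] by (simp add: power_add mult.commute)
    also have "\<dots> = (\<Sum>w<q^R. \<Sum>t<q^b. \<psi> b w)" by (intro sum.cong refl) (use qp[of b] in auto)
    also have "\<dots> = q^b * (\<Sum>w<q^R. \<psi> b w)" by (simp add: sum_distrib_left)
    finally show ?thesis by (simp add: \<psi>0)
  qed
  define near where "near b b' \<longleftrightarrow> b' < b + R \<and> b < b' + R" for b b'
  have c: "(\<Sum>x<X. Y b x * Y b' x) \<le> (if near b b' then 2 * X * ((s b)\<^sup>2 + (s b')\<^sup>2) else 0)" if "b < M" "b' < M" for b b'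
  proof (cases "near b b'")
    case True
    have "(\<Sum>x<X. Y b x * Y b' x) \<le> (\<Sum>x<X. 2 * ((s b)\<^sup>2 + (s b')\<^sup>2))"
    proof (rule sum_mono)
      fix x
      have "Y b x * Y b' x \<le> \<bar>Y b x\<bar> * \<bar>Y b' x\<bar>" by (metis abs_ge_self abs_mult)
      also have "\<dots> \<le> (2 * s b) * (2 * s b')" using s0 by (intro mult_mono Yb) auto
      also have "\<dots> \<le> 2 * ((s b)\<^sup>2 + (s b')\<^sup>2)" using sum_squares_bound[of "s b" "s b'"] by simp
      finally show "Y b x * Y b' x \<le> 2 * ((s b)\<^sup>2 + (s b')\<^sup>2)" .
    qed
    then show ?thesis using True by (simp add: algebra_simps)
  next
    case False
    then have "b + R \<le> b' \<or> b' + R \<le> b" by (auto simp: near_def)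
    then have "(\<Sum>x<X. Y b x * Y b' x) = 0" using orth[of b b'] orth[of b' b] that by (auto simp: mult.commute)
    then show ?thesis using False by simp
  qed
  have cardn: "card {b'. b' < M \<and> near b b'} \<le> 2 * R" for b
  proof -
    have "card {b'. b' < M \<and> near b b'} \<le> card {b - R..<b + R}" by (rule card_mono) (auto simp: near_def)
    then show ?thesis by simp
  qed
  have nsum: "(\<Sum>b<M. \<Sum>b'<M. if near b b' then (s b)\<^sup>2 else 0) \<le> 2 * R * (\<Sum>b<M. (s b)\<^sup>2)"
  proof -
    have "(\<Sum>b'<M. if near b b' then (s b)\<^sup>2 else 0) \<le> 2 * R * (s b)\<^sup>2" for b
    proof -
      have "(\<Sum>b'<M. if near b b' then (s b)\<^sup>2 else 0) = (\<Sum>b' | b' \<in> {..<M} \<and> near b b'. (s b)\<^sup>2)"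
        by (subst sum.inter_filter) auto
      also have "\<dots> = real (card {b'. b' < M \<and> near b b'}) * (s b)\<^sup>2" by simp
      also have "\<dots> \<le> real (2 * R) * (s b)\<^sup>2" using cardn[of b] by (intro mult_right_mono) (auto simp del: of_nat_mult)
      finally show ?thesis by simp
    qed
    then show ?thesis unfolding sum_distrib_left by (intro sum_mono)
  qed
  have nsum': "(\<Sum>b<M. \<Sum>b'<M. if near b b' then (s b')\<^sup>2 else 0) \<le> 2 * R * (\<Sum>b<M. (s b)\<^sup>2)"
    using nsum by (subst sum.swap) (simp add: near_def conj_commute)
  define m where "m = (\<Sum>b<M. av b)"
  have "(\<Sum>x<X. ((\<Sum>b<M. \<phi> b (x div q^b mod q^R)) - m)\<^sup>2) = (\<Sum>x<X. \<Sum>b<M. \<Sum>b'<M. Y b x * Y b' x)"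
    unfolding m_def sum_subtractf[symmetric] power2_eq_square sum_product Y_def \<psi>_def ..
  also have "\<dots> = (\<Sum>b<M. \<Sum>x<X. \<Sum>b'<M. Y b x * Y b' x)" by (rule sum.swap)
  also have "\<dots> = (\<Sum>b<M. \<Sum>b'<M. \<Sum>x<X. Y b x * Y b' x)" by (rule sum.cong[OF refl], rule sum.swap)
  also have "\<dots> \<le> (\<Sum>b<M. \<Sum>b'<M. if near b b' then 2 * X * ((s b)\<^sup>2 + (s b')\<^sup>2) else 0)" by (intro sum_mono c) auto
  also have "\<dots> = (\<Sum>b<M. \<Sum>b'<M. 2 * X * ((if near b b' then (s b)\<^sup>2 else 0) + (if near b b' then (s b')\<^sup>2 else 0)))"
    by (intro sum.cong refl) auto
  also have "\<dots> = 2 * X * ((\<Sum>b<M. \<Sum>b'<M. if near b b' then (s b)\<^sup>2 else 0) + (\<Sum>b<M. \<Sum>b'<M. if near b b' then (s b')\<^sup>2 else 0))"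
    by (simp only: sum_distrib_left[symmetric] sum.distrib)
  also have "\<dots> \<le> 2 * X * (2 * R * (\<Sum>b<M. (s b)\<^sup>2) + 2 * R * (\<Sum>b<M. (s b)\<^sup>2))"
    by (intro mult_left_mono add_mono nsum nsum') auto
  also have "\<dots> = 8 * real R * real q^(M+R) * (\<Sum>b<M. (s b)\<^sup>2)" by (simp add: X_def)
  finally show ?thesis unfolding X_def by blast
qed

lemma summable_square_sum:
  fixes x :: "nat \<Rightarrow> nat \<Rightarrow> real"
  assumes "\<And>w. summable (\<lambda>l. (x w l)\<^sup>2)" "\<And>w l. x w l \<ge> 0"
  shows "summable (\<lambda>l. (\<Sum>w<n. x w l)\<^sup>2)"
proof (induction n)
  case (Suc n)
  show ?case by (rule summable_square_add_le[OF Suc assms(1)[of n]]) (auto intro: add_nonneg_nonneg sum_nonneg assms(2))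
qed simp

lemma summable_tail_less:
  fixes a :: "nat \<Rightarrow> real"
  assumes "summable a" "\<And>n. a n \<ge> 0" "\<epsilon> > 0"
  shows "\<exists>L0. \<forall>L\<ge>L0. \<forall>M. (\<Sum>b<M. a (L + b)) < \<epsilon>"
proof -
  obtain N where N: "\<And>m n. m \<ge> N \<Longrightarrow> norm (sum a {m..<n}) < \<epsilon>" using assms by (metis summable_Cauchy)
  have "(\<Sum>b<M. a (L + b)) < \<epsilon>" if "L \<ge> N" for L M
  proof -
    have "(\<Sum>b<M. a (L + b)) = sum a {L..<L+M}" by (induction M) (simp_all add: ac_simps)
    also have "\<dots> < \<epsilon>" using N[OF that, of "L+M"] by simp
    finally show ?thesis .
  qed
  then show ?thesis by blast
qed


section \<open>From powers of roots of unity to a periodic function\<close>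

context semimult
begin

text \<open>\<open>F q\<close> is \<open>F 1\<close> shifted by one, so
  \<open>\<omega> (l + 1)\<close> and \<open>\<omega> l ^ q\<close> are square-summably close. Both
  are roots of unity of order dividing \<open>d\<close>, a finite set, hence they are equal from
  some point on.\<close>

lemma eventually_root_of_unity:
  assumes pw: "\<And>n. F n \<doteq> (\<lambda>l. F 1 l ^ n)" and d: "d > 0" "(\<lambda>l. F 1 l ^ d) \<doteq> (\<lambda>_. 1)"
  shows "\<exists>\<omega> L. (\<forall>l. \<omega> l ^ d = 1) \<and> (\<forall>n. F n \<doteq> (\<lambda>l. \<omega> l ^ n)) \<and> (\<forall>l\<ge>L. \<omega> (Suc l) = \<omega> l ^ q)"
proof -
  have "\<exists>\<omega>. \<omega> ^ d = 1 \<and> norm (F 1 l - \<omega>) \<le> norm (F 1 l ^ d - 1)" for l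
    using nearest_root_of_unity[OF norm_F d(1)] by blast
  then obtain \<omega> where \<omega>: "\<And>l. \<omega> l ^ d = 1" "\<And>l. norm (F 1 l - \<omega> l) \<le> norm (F 1 l ^ d - 1)" by metis
  have n1: "norm (\<omega> l) = 1" for l by (rule norm_root_of_unity[OF \<omega>(1) d(1)])
  have "F 1 \<doteq> \<omega>" unfolding l2_close_def
    by (rule summable_comparison_test'[OF d(2)[unfolded l2_close_def]]) (use \<omega>(2) in \<open>simp add: power_mono\<close>)
  then have Fn: "F n \<doteq> (\<lambda>l. \<omega> l ^ n)" for n
    using l2_close_trans[OF pw l2_close_power] n1 by simp
  have "(\<lambda>l. \<omega> (l + 1)) \<doteq> (\<lambda>l. \<omega> l ^ q)"
  proof (rule l2_close_trans[OF l2_close_sym])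
    show "F q \<doteq> (\<lambda>l. \<omega> l ^ q)" by (rule Fn)
    have "(\<lambda>l. F 1 (l + 1)) \<doteq> (\<lambda>l. \<omega> (l + 1))" unfolding l2_close_shift using Fn[of 1] by simp
    then show "F q \<doteq> (\<lambda>l. \<omega> (l + 1))" using F_shift[of 1 1] by simp
  qed
  then have "(\<lambda>l. (norm (\<omega> (l + 1) - \<omega> l ^ q))\<^sup>2) \<longlonglongrightarrow> 0" unfolding l2_close_def by (rule summable_LIMSEQ_zero)
  then have lim: "(\<lambda>l. norm (\<omega> (l + 1) - \<omega> l ^ q)) \<longlonglongrightarrow> 0"
    using tendsto_real_sqrt[of "\<lambda>l. (norm (\<omega> (l + 1) - \<omega> l ^ q))\<^sup>2" 0] by simp
  obtain \<delta> where \<delta>: "\<delta> > 0" "\<And>x y :: complex. x ^ d = 1 \<Longrightarrow> y ^ d = 1 \<Longrightarrow> norm (x - y) < \<delta> \<Longrightarrow> x = y"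
    using roots_of_unity_separated[OF d(1)] by blast
  obtain L where L: "\<And>l. l \<ge> L \<Longrightarrow> norm (\<omega> (l + 1) - \<omega> l ^ q) < \<delta>"
    using LIMSEQ_D[OF lim \<delta>(1)] by auto
  have "\<omega> (Suc l) = \<omega> l ^ q" if "l \<ge> L" for l
  proof (rule \<delta>(2)[OF \<omega>(1)])
    show "(\<omega> l ^ q) ^ d = 1" using \<omega>(1)[of l] by (metis power_mult mult.commute power_one)
  qed (use L[OF that] in simp)
  then show ?thesis using \<omega>(1) Fn by blast
qed

text \<open>\<open>h\<close> is \<open>f\<close> divided by its expected value. Removing the lowest
  digit changes \<open>h\<close> by a phase \<open>\<kappa>\<close> that \<open>star\<close> makes a
  function of \<open>r + 1\<close> digits, so \<open>h x\<close> is the exponential of a sum of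
  angles to which \<open>digit_variance\<close> applies; its centre \<open>m\<close> yields
  \<open>c = cis m\<close>. The level \<open>L\<close> is taken in the tail of the squared angles,
  independently of \<open>M\<close>, and beyond \<open>L0\<close> so that \<open>\<omega>\<close> at
  higher levels is a power of \<open>\<omega> L\<close>.\<close>

lemma concentration:
  fixes \<epsilon> :: real
  assumes \<omega>: "\<And>l. norm (\<omega> l) = 1" "\<And>n. F n \<doteq> (\<lambda>l. \<omega> l ^ n)" "\<And>l. l \<ge> L0 \<Longrightarrow> \<omega> (Suc l) = \<omega> l ^ q" and \<epsilon>: "\<epsilon> > 0"
  shows "\<exists>L. \<forall>M. \<exists>c. norm c = 1 \<and> (\<Sum>x<q^M. (norm (f (q^L * x) - c * \<omega> L ^ x))\<^sup>2) \<le> \<epsilon> * q^M"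
proof -
  \<comment> \<open>One digit to be removed and the \<open>r\<close> digits above it that
    \<open>star\<close> remembers.\<close>
  define R where "R = Suc r"
  define e where "e l = (\<Sum>w<q^R. norm (f (q^l * w) - \<omega> l ^ w))" for l
  have e0: "e l \<ge> 0" for l unfolding e_def by (intro sum_nonneg) auto
  have se: "summable (\<lambda>l. (e l)\<^sup>2)" unfolding e_def
    by (rule summable_square_sum) (use \<omega>(2) in \<open>auto simp: l2_close_def F_def\<close>)
  define s where "s l = 8 * (e l + e (Suc l))" for l
  have ss: "summable (\<lambda>l. (s l)\<^sup>2)"
  proof (rule summable_square_add_le[of "\<lambda>l. 8 * e l" "\<lambda>l. 8 * e (Suc l)"])
    show "summable (\<lambda>l. (8 * e l)\<^sup>2)" using summable_mult[OF se, of 64] by (simp add: power_mult_distrib)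
    have "summable (\<lambda>l. (e (Suc l))\<^sup>2)" using se by (subst summable_Suc_iff)
    then show "summable (\<lambda>l. (8 * e (Suc l))\<^sup>2)" using summable_mult[of "\<lambda>l. (e (Suc l))\<^sup>2" 64] by (simp add: power_mult_distrib)
  qed (use e0 in \<open>auto simp: s_def\<close>)
  \<comment> \<open>The factor \<open>8 * R\<close> is that of \<open>digit_variance\<close>;
    \<open>q^R\<close> is lost in passing from \<open>q^M\<close> to \<open>q^(M+R)\<close>
    summands.\<close>
  define C where "C = 8 * real R * q^R"
  have C: "C > 0" using q_pos[of R] by (simp add: C_def R_def)
  obtain L1 where L1: "\<And>L M. L \<ge> L1 \<Longrightarrow> (\<Sum>b<M. (s (L + b))\<^sup>2) < \<epsilon> / C"
    using summable_tail_less[OF ss, of "\<epsilon> / C"] C \<epsilon> by auto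
  define L where "L = max L0 L1"
  have \<omega>pow: "\<omega> (L + b) = \<omega> L ^ (q^b)" for b
    by (induction b) (use \<omega>(3) in \<open>simp_all add: L_def power_mult[symmetric] mult.commute\<close>)
  define h where "h x = f (q^L * x) * cnj (\<omega> L ^ x)" for x
  have cc: "z * cnj z = 1" if "norm z = 1" for z :: complex using that by (metis complex_norm_square one_power2 of_real_1)
  have nh: "norm (h x) = 1" for x by (simp add: h_def norm_mult norm_power unit \<omega>)
  have hb: "norm (h (q^b * w) - 1) \<le> e (L + b)" if "w < q^R" for b w
  proof -
    have "norm (h (q^b * w) - 1) = norm ((h (q^b * w) - 1) * \<omega> L ^ (q^b * w))" by (simp add: norm_mult norm_power \<omega>)
    also have "(h (q^b * w) - 1) * \<omega> L ^ (q^b * w) = f (q^(L+b) * w) - \<omega> (L + b) ^ w"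
    proof -
      have "h (q^b * w) * \<omega> L ^ (q^b * w) = f (q^L * (q^b * w)) * (\<omega> L ^ (q^b * w) * cnj (\<omega> L ^ (q^b * w)))"
        unfolding h_def by (simp add: mult_ac)
      also have "\<dots> = f (q^(L+b) * w)" using cc[of "\<omega> L ^ (q^b * w)"] \<omega>(1) by (simp add: norm_power power_add mult_ac)
      finally show ?thesis unfolding \<omega>pow by (simp add: left_diff_distrib power_mult)
    qed
    also have "norm \<dots> \<le> e (L + b)" unfolding e_def by (rule member_le_sum) (use that in auto)
    finally show ?thesis .
  qed
  \<comment> \<open>It is used for \<open>w < q^R\<close> only, where both factors are close to 1 by
    \<open>hb\<close>; \<open>rec\<close> then transfers it to arbitrary \<open>w\<close>.\<close>
  define \<kappa> where "\<kappa> b w = h (q^b * w) * cnj (h (q^Suc b * (w div q)))" for b w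
  have n\<kappa>: "norm (\<kappa> b w) = 1" for b w by (simp add: \<kappa>_def norm_mult nh)
  have \<kappa>b: "\<bar>Arg (\<kappa> b w)\<bar> \<le> s (L + b)" if "w < q^R" for b w
  proof -
    define A B where "A = h (q^b * w)" and "B = h (q^Suc b * (w div q))"
    have "w div q < q^R" using that by (meson div_le_dividend le_less_trans)
    then have B: "norm (B - 1) \<le> e (Suc (L + b))" unfolding B_def using hb[of "w div q" "Suc b"] by simp
    have A: "norm (A - 1) \<le> e (L + b)" unfolding A_def by (rule hb[OF that])
    have "\<kappa> b w - 1 = (A - B) * cnj B" using cc[OF nh, of "q^Suc b * (w div q)"] unfolding \<kappa>_def A_def[symmetric] B_def[symmetric] by (simp add: algebra_simps)
    then have "norm (\<kappa> b w - 1) = norm (A - B)" by (simp add: norm_mult B_def nh)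
    also have "\<dots> \<le> norm (A - 1) + norm (B - 1)" using norm_triangle_ineq4[of "A - 1" "B - 1"] by simp
    also have "\<dots> \<le> e (L + b) + e (Suc (L + b))" using A B by (rule add_mono)
    finally have "8 * norm (\<kappa> b w - 1) \<le> s (L + b)" unfolding s_def by (rule mult_left_mono) simp
    then show ?thesis using abs_Arg_le[OF n\<kappa>, of b w] by (rule order.trans[rotated])
  qed
  have rec: "h (q^b * w) = \<kappa> b (w mod q^R) * h (q^Suc b * (w div q))" for b w
  proof -
    define w0 w1 z0 where "w0 = w mod q^R" and "w1 = w div q^R" and "z0 = w0 div q"
    have w: "w = q^R * w1 + w0" by (simp add: w0_def w1_def)
    have wd: "w div q = q^r * w1 + z0" unfolding w z0_def R_def using q2 by (simp add: mult.assoc)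
    have w0: "w0 = q * z0 + w0 mod q" by (simp add: z0_def)
    have k: "q^(L+b) * (w0 mod q) < q^(L+b+1)" using q2 q_pos[of "L+b"] by simp
    have a1: "f (q^(L+b+1+r) * w1 + q^(L+b+1) * z0 + q^(L+b) * (w0 mod q)) * f (q^(L+b+1) * z0)
      = f (q^(L+b+1) * z0 + q^(L+b) * (w0 mod q)) * f (q^(L+b+1+r) * w1 + q^(L+b+1) * z0)"
      by (rule star[OF k]) simp
    have a2: "q^(L+b+1) * z0 + q^(L+b) * (w0 mod q) = q^L * (q^b * w0)"
    proof -
      have "q^(L+b+1) * z0 + q^(L+b) * (w0 mod q) = q^L * (q^b * (q * z0 + w0 mod q))" by (simp add: power_add algebra_simps)
      then show ?thesis using w0 by simp
    qed
    have a3: "q^(L+b+1+r) * w1 + q^(L+b+1) * z0 + q^(L+b) * (w0 mod q) = q^L * (q^b * w)"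
    proof -
      have "q^L * (q^b * w) = q^(L+b+1+r) * w1 + q^L * (q^b * w0)" by (subst w) (simp add: power_add R_def algebra_simps)
      then show ?thesis using a2 by simp
    qed
    have a4: "q^(L+b+1+r) * w1 + q^(L+b+1) * z0 = q^L * (q^Suc b * (w div q))" unfolding wd by (simp add: power_add algebra_simps)
    have a5: "q^(L+b+1) * z0 = q^L * (q^Suc b * z0)" by (simp add: power_add)
    have st: "f (q^L * (q^b * w)) * f (q^L * (q^Suc b * z0)) = f (q^L * (q^b * w0)) * f (q^L * (q^Suc b * (w div q)))"
      by (rule a1[unfolded a3, unfolded a2, unfolded a4, unfolded a5])
    \<comment> \<open>The exponents of \<open>\<omega> L\<close> on both sides agree, so
      \<open>h\<close> inherits from \<open>f\<close> the relation given by
      \<open>star\<close>.\<close>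
    have ex: "q^b * w + q^Suc b * z0 = q^b * w0 + q^Suc b * (w div q)"
    proof -
      have "w + q * z0 = w0 + q * (q^r * w1 + z0)" using w by (simp add: R_def algebra_simps)
      then have "q^b * (w + q * z0) = q^b * (w0 + q * (w div q))" unfolding wd by simp
      then show ?thesis by (simp add: algebra_simps)
    qed
    have "h (q^b * w) * h (q^Suc b * z0) = (f (q^L * (q^b * w)) * f (q^L * (q^Suc b * z0))) * cnj (\<omega> L ^ (q^b * w + q^Suc b * z0))"
      unfolding h_def power_add by (simp add: mult_ac)
    also have "\<dots> = h (q^b * w0) * h (q^Suc b * (w div q))"
      unfolding st ex h_def power_add by (simp add: mult_ac)
    finally have e1: "h (q^b * w) * h (q^Suc b * z0) = h (q^b * w0) * h (q^Suc b * (w div q))" .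
    have "h (q^b * w) = (h (q^b * w) * h (q^Suc b * z0)) * cnj (h (q^Suc b * z0))"
      using cc[OF nh, of "q^Suc b * z0"] by (simp only: mult.assoc mult_1_right)
    also have "\<dots> = \<kappa> b w0 * h (q^Suc b * (w div q))" unfolding e1 unfolding \<kappa>_def z0_def by (simp only: mult_ac)
    finally show ?thesis by (simp add: w0_def)
  qed
  define \<Phi> where "\<Phi> M x = (\<Sum>b<M. Arg (\<kappa> b (x div q^b mod q^R)))" for M x
  have prod: "h x = cis (\<Phi> M x) * h (q^M * (x div q^M))" for M x
  proof (induction M)
    case (Suc M)
    have "h (q^M * (x div q^M)) = \<kappa> M (x div q^M mod q^R) * h (q^Suc M * (x div q^Suc M))"
      unfolding rec[of M "x div q^M"] by (simp add: div_mult2_eq[symmetric] mult.commute)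
    moreover have "\<kappa> M (x div q^M mod q^R) = cis (Arg (\<kappa> M (x div q^M mod q^R)))"
      using cis_Arg[of "\<kappa> M (x div q^M mod q^R)"] n\<kappa>[of M "x div q^M mod q^R"] by (cases "\<kappa> M (x div q^M mod q^R) = 0") (auto simp: sgn_div_norm)
    ultimately show ?case unfolding Suc by (simp add: \<Phi>_def cis_mult[symmetric] mult.assoc)
  qed (simp add: \<Phi>_def)
  have "\<exists>c. norm c = 1 \<and> (\<Sum>x<q^M. (norm (f (q^L * x) - c * \<omega> L ^ x))\<^sup>2) \<le> \<epsilon> * q^M" for M
  proof -
    obtain m where m: "(\<Sum>x<q^(M+R). (\<Phi> M x - m)\<^sup>2) \<le> 8 * real R * real q^(M+R) * (\<Sum>b<M. (s (L + b))\<^sup>2)"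
      using digit_variance[OF q2, of R "\<lambda>b w. Arg (\<kappa> b w)" "\<lambda>b. s (L + b)" M] \<kappa>b unfolding \<Phi>_def by blast
    have "(\<Sum>x<q^M. (norm (f (q^L * x) - cis m * \<omega> L ^ x))\<^sup>2) \<le> (\<Sum>x<q^M. (\<Phi> M x - m)\<^sup>2)"
    proof (rule sum_mono)
      fix x assume x: "x \<in> {..<q^M}"
      have hx: "h x = cis (\<Phi> M x)" using prod[of x M] x by (simp add: h_def f0)
      have "f (q^L * x) = h x * \<omega> L ^ x" using cc[of "\<omega> L ^ x"] \<omega>(1) unfolding h_def by (simp add: norm_power mult.assoc mult.commute)
      then have "f (q^L * x) - cis m * \<omega> L ^ x = (cis (\<Phi> M x) - cis m) * \<omega> L ^ x" unfolding hx by (simp add: left_diff_distrib)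
      then have "norm (f (q^L * x) - cis m * \<omega> L ^ x) \<le> \<bar>\<Phi> M x - m\<bar>"
        using norm_cis_diff_le[of "\<Phi> M x" m] \<omega>(1) by (simp add: norm_mult norm_power)
      then have "(norm (f (q^L * x) - cis m * \<omega> L ^ x))\<^sup>2 \<le> \<bar>\<Phi> M x - m\<bar>\<^sup>2" by (intro power_mono) auto
      then show "(norm (f (q^L * x) - cis m * \<omega> L ^ x))\<^sup>2 \<le> (\<Phi> M x - m)\<^sup>2" by simp
    qed
    also have "\<dots> \<le> (\<Sum>x<q^(M+R). (\<Phi> M x - m)\<^sup>2)"
      using q2 by (intro sum_mono2) (auto intro: order.strict_trans2 power_increasing)
    also have "\<dots> \<le> C * q^M * (\<Sum>b<M. (s (L + b))\<^sup>2)" using m by (simp add: C_def power_add mult_ac)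
    also have "\<dots> \<le> C * q^M * (\<epsilon> / C)" using L1[of L M] C by (intro mult_left_mono) (auto simp: L_def)
    finally show ?thesis using C by (intro exI[of _ "cis m"]) (simp add: mult.commute)
  qed
  then show ?thesis by blast
qed

text \<open>The ratio of \<open>f n\<close> to the value at \<open>n\<close> with its lowest
  \<open>L\<close> digits cleared depends by \<open>star\<close> on \<open>L + r\<close> digits,
  hence is exactly periodic. Only the values at multiples of \<open>Q = q^L\<close> have to be
  approximated, and there \<open>concentration\<close> supplies the power of the root of
  unity.\<close>

lemma periodic_approximation:
  assumes FF: "\<And>u. F (p * u) \<doteq> F (p' * u)"
    and p: "prime p" "prime p'" "p \<noteq> p'" "p \<ge> 3" "p' \<ge> 3" "coprime p q" "coprime p' q"
    and \<epsilon>: "\<epsilon> > (0::real)"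
  shows "\<exists>P m N0. m > 0 \<and> (\<forall>n. P (n + m) = P n) \<and>
     (\<forall>N\<ge>N0. \<exists>c. norm c = 1 \<and> (\<Sum>n<N. norm (f n - c * P n)) \<le> \<epsilon> * N)"
proof -
  have pw: "F n \<doteq> (\<lambda>l. F 1 l ^ n)" for n by (rule F_power[OF FF p])
  have pp: "(\<lambda>l. F 1 l ^ p) \<doteq> (\<lambda>l. F 1 l ^ p')"
    using l2_close_trans[OF l2_close_sym[OF pw[of p]] l2_close_trans[OF FF[of 1, simplified] pw[of p']]] .
  \<comment> \<open>Equality of the powers \<open>p\<close> and \<open>p'\<close> makes
    \<open>F 1\<close>, modulo \<open>\<doteq>\<close>, a root of unity of order dividing the
    difference of the two primes.\<close>
  obtain d where d: "d > 0" "(\<lambda>l. F 1 l ^ d) \<doteq> (\<lambda>_. 1)"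
  proof -
    have *: "(\<lambda>l. F 1 l ^ (b - a)) \<doteq> (\<lambda>_. 1)" if "a < b" "(\<lambda>l. F 1 l ^ a) \<doteq> (\<lambda>l. F 1 l ^ b)" for a b
    proof -
      have "norm (F 1 l ^ (b - a) - 1) = norm (F 1 l ^ a - F 1 l ^ b)" for l
      proof -
        have "F 1 l ^ b - F 1 l ^ a = F 1 l ^ a * (F 1 l ^ (b - a) - 1)" using that(1) by (simp add: algebra_simps power_add[symmetric])
        then have "norm (F 1 l ^ b - F 1 l ^ a) = norm (F 1 l ^ (b - a) - 1)" by (simp add: norm_mult norm_power)
        then show ?thesis by (simp add: norm_minus_commute)
      qed
      then show ?thesis using that(2) by (simp add: l2_close_def)
    qed
    show ?thesis
    proof (cases "p < p'")
      case True then show ?thesis using that[of "p' - p"] *[OF True pp] by simp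
    next
      case False then have "p' < p" using p(3) by simp
      then show ?thesis using that[of "p - p'"] *[OF _ l2_close_sym[OF pp]] by simp
    qed
  qed
  obtain \<omega> L0 where \<omega>: "\<And>l. \<omega> l ^ d = 1" "\<And>n. F n \<doteq> (\<lambda>l. \<omega> l ^ n)" "\<And>l. l \<ge> L0 \<Longrightarrow> \<omega> (Suc l) = \<omega> l ^ q"
    using eventually_root_of_unity[OF pw d] by blast
  have n1: "norm (\<omega> l) = 1" for l by (rule norm_root_of_unity[OF \<omega>(1) d(1)])
  \<comment> \<open>Cauchy-Schwarz takes a square root, the passage to a full power of
    \<open>q\<close> costs a factor \<open>q\<close>, and \<open>X * Q \<le> 2 * N\<close> accounts
    for the rest.\<close>
  define \<epsilon>' where "\<epsilon>' = \<epsilon>\<^sup>2 / (4 * q)"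
  have q0: "real q > 0" using q2 by simp
  have \<epsilon>': "\<epsilon>' > 0" using \<epsilon> q0 by (simp add: \<epsilon>'_def)
  obtain L where L: "\<And>M. \<exists>c. norm c = 1 \<and> (\<Sum>x<q^M. (norm (f (q^L * x) - c * \<omega> L ^ x))\<^sup>2) \<le> \<epsilon>' * q^M"
    using concentration[OF n1 \<omega>(2,3) \<epsilon>'] by blast
  define Q where "Q = q^L"
  have Q: "Q > 0" unfolding Q_def by (rule q_pos)
  \<comment> \<open>This equals \<open>f n / f (Q * (n div Q))\<close>; with \<open>n div Q\<close>
    reduced modulo \<open>q^r\<close> its periodicity is visible.\<close>
  define B where "B n = (let w = n div Q mod q^r; k = n mod Q in f (Q * w + k) * cnj (f (Q * w)))" for n
  define P where "P n = \<omega> L ^ (n div Q) * B n" for n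
  define m where "m = Q * q^r * d"
  have "P (n + m) = P n" for n
  proof -
    have 1: "(n + m) div Q = n div Q + q^r * d" unfolding m_def using Q by (simp add: mult.assoc)
    have 2: "(n + m) mod Q = n mod Q" unfolding m_def by (simp add: mult.assoc)
    have 3: "\<omega> L ^ (n div Q + q^r * d) = \<omega> L ^ (n div Q)" using \<omega>(1)[of L] by (simp add: power_add power_mult mult.commute[of "q^r"])
    show ?thesis unfolding P_def B_def 1 2 3 by simp
  qed
  moreover have "m > 0" using Q q_pos[of r] d by (simp add: m_def)
  moreover have "\<exists>c. norm c = 1 \<and> (\<Sum>n<N. norm (f n - c * P n)) \<le> \<epsilon> * N" if N: "N \<ge> Q" for N
  proof -
    define X where "X = N div Q + 1"
    have X: "N \<le> X * Q" "X * Q \<le> 2 * N"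
    proof -
      have "X * Q = N div Q * Q + Q" by (simp add: X_def algebra_simps)
      then show "N \<le> X * Q" "X * Q \<le> 2 * N"
        using N Q dividend_less_div_times[of Q N] div_times_less_eq_dividend[of N Q] by linarith+
    qed
    \<comment> \<open>\<open>concentration\<close> speaks of segments of length \<open>q^M\<close>
      only, so the least power of \<open>q\<close> that reaches \<open>X\<close> is taken.\<close>
    obtain M where M: "X \<le> q^M" "q^M \<le> q * X"
    proof -
      define M where "M = (LEAST M. X \<le> q^M)"
      have ex: "\<exists>M. X \<le> q^M" using q2 by (metis less_exp order.trans less_imp_le power_mono zero_le)
      have M: "X \<le> q^M" unfolding M_def using ex by (metis LeastI_ex)
      have "q^M \<le> q * X"
      proof (cases M)
        case 0 then show ?thesis using q2 by (simp add: X_def)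
      next
        case (Suc M')
        have "\<not> X \<le> q^M'" using not_less_Least[of M' "\<lambda>M. X \<le> q^M"] Suc unfolding M_def[symmetric] by simp
        then show ?thesis using Suc by simp
      qed
      then show ?thesis using M that by blast
    qed
    obtain c where c: "norm c = 1" "(\<Sum>x<q^M. (norm (f (Q * x) - c * \<omega> L ^ x))\<^sup>2) \<le> \<epsilon>' * q^M" using L[of M] unfolding Q_def by blast
    \<comment> \<open>The lower digits enter \<open>f\<close> and \<open>P\<close> through the same
      factor, so the error is constant on blocks of length \<open>Q\<close>.\<close>
    have fB: "norm (f n - c * P n) = norm (f (Q * (n div Q)) - c * \<omega> L ^ (n div Q))" for n
    proof -
      define z w k z1 where "z = n div Q" and "w = z mod q^r" and "k = n mod Q" and "z1 = z div q^r"
      have n: "n = q^(L + r) * z1 + q^L * w + k"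
      proof -
        have "z = q^r * z1 + w" unfolding w_def z1_def by simp
        moreover have "n = Q * z + k" unfolding z_def k_def by simp
        ultimately show ?thesis unfolding Q_def by (simp add: algebra_simps power_add)
      qed
      have z: "q^(L + r) * z1 + q^L * w = Q * z"
      proof -
        have "z = q^r * z1 + w" unfolding w_def z1_def by simp
        then show ?thesis unfolding Q_def by (simp add: algebra_simps power_add)
      qed
      have k: "k < q^L" unfolding k_def Q_def using q_pos[of L] by simp
      have "f n * f (Q * w) = f (Q * w + k) * f (Q * z)"
        using star[OF k, of "q^(L+r) * z1" w] n z unfolding Q_def by simp
      then have "f n * (f (Q * w) * cnj (f (Q * w))) = f (Q * z) * (f (Q * w + k) * cnj (f (Q * w)))" by (metis mult.assoc mult.commute)
      then have fn: "f n = f (Q * z) * B n" unfolding mult_cnj_self B_def Let_def w_def[symmetric] k_def[symmetric] z_def[symmetric] by simp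
      have "f n - c * P n = (f (Q * z) - c * \<omega> L ^ z) * B n" unfolding fn P_def z_def[symmetric] by (simp add: algebra_simps)
      moreover have "norm (B n) = 1" by (simp add: B_def Let_def norm_mult unit)
      ultimately show ?thesis by (simp add: norm_mult z_def)
    qed
    define a where "a x = norm (f (Q * x) - c * \<omega> L ^ x)" for x
    have "(\<Sum>n<N. norm (f n - c * P n)) \<le> (\<Sum>n<X * Q. a (n div Q))"
      unfolding fB a_def using X(1) by (intro sum_mono2) auto
    also have "\<dots> = (\<Sum>x<X. \<Sum>v<Q. a x)" unfolding sum_blocks using Q by (intro sum.cong refl) auto
    also have "\<dots> = Q * (\<Sum>x<X. a x)" by (simp add: sum_distrib_left)
    also have "(\<Sum>x<X. a x) \<le> sqrt (X * (\<epsilon>' * (q * X)))"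
    proof (rule sum_le_sqrt_card)
      have "(\<Sum>x<X. (a x)\<^sup>2) \<le> (\<Sum>x<q^M. (a x)\<^sup>2)" using M by (intro sum_mono2) auto
      also have "\<dots> \<le> \<epsilon>' * real (q^M)" using c(2) by (simp add: a_def)
      also have "\<dots> \<le> \<epsilon>' * real (q * X)" using M(2) \<epsilon>' by (intro mult_left_mono) (simp_all del: of_nat_mult of_nat_power)
      finally show "(\<Sum>x<X. (a x)\<^sup>2) \<le> \<epsilon>' * (q * X)" by simp
    qed
    also have "sqrt (X * (\<epsilon>' * (q * X))) = \<epsilon> / 2 * X"
    proof -
      have "X * (\<epsilon>' * (q * X)) = (\<epsilon> / 2 * X)\<^sup>2" unfolding \<epsilon>'_def using q0 by (simp add: power2_eq_square field_simps)
      then show ?thesis using \<epsilon> by simp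
    qed
    finally have "(\<Sum>n<N. norm (f n - c * P n)) \<le> Q * (\<epsilon> / 2 * X)" using Q by (simp add: mult_left_mono)
    also have "\<dots> = \<epsilon> / 2 * real (X * Q)" by simp
    also have "\<dots> \<le> \<epsilon> / 2 * real (2 * N)" using X(2) \<epsilon> by (intro mult_left_mono) (simp_all del: of_nat_mult)
    finally show ?thesis using c(1) by (intro exI[of _ c]) simp
  qed
  ultimately show ?thesis by blast
qed

end

section \<open>Dirichlet characters\<close>

definition dchar :: "nat \<Rightarrow> (nat \<Rightarrow> complex) \<Rightarrow> bool" where
  "dchar m \<xi> \<longleftrightarrow> \<xi> 1 = 1 \<and> (\<forall>a b. \<xi> (a * b) = \<xi> a * \<xi> b) \<and> (\<forall>n. \<xi> (n + m) = \<xi> n) \<and>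
     (\<forall>n. \<xi> n \<noteq> 0 \<longleftrightarrow> coprime n m)"

lemma periodic_mult:
  fixes \<phi> :: "nat \<Rightarrow> 'a" assumes "\<And>n. \<phi> (n + m) = \<phi> n" shows "\<phi> (n + m * k) = \<phi> n"
proof (induction k)
  case (Suc k)
  have "\<phi> (n + m * Suc k) = \<phi> ((n + m * k) + m)" by (simp add: ac_simps)
  then show ?case using Suc assms by simp
qed simp

lemma periodic_cong:
  fixes \<phi> :: "nat \<Rightarrow> 'a" assumes per: "\<And>n. \<phi> (n + m) = \<phi> n" and "[a = b] (mod m)" shows "\<phi> a = \<phi> b"
proof -
  have "\<phi> a = \<phi> (a mod m)" for a using periodic_mult[of \<phi> m, OF per, of "a mod m" "a div m"] by (simp add: mult.commute)
  then show ?thesis using assms(2) unfolding cong_def by metis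
qed

lemma cnj_root_of_unity_power:
  assumes "k > 0" shows "cnj (cis (2 * pi * real i / real k)) ^ k = 1"
proof -
  have "cis (2 * pi * real i / real k) ^ k = cis (real k * (2 * pi * real i / real k))" by (rule Complex.DeMoivre)
  also have "real k * (2 * pi * real i / real k) = 2 * pi * real i" using assms by simp
  also have "cis (2 * pi * real i) = 1" by (rule cis_multiple_2pi) simp
  finally have "cis (2 * pi * real i / real k) ^ k = 1" .
  then show ?thesis unfolding complex_cnj_power[symmetric] by simp
qed

lemma sum_roots_of_unity:
  assumes "i < k"
  shows "(\<Sum>j<k. cnj (cis (2 * pi * real j / real k)) ^ i) = (if i = 0 then of_nat k else 0)"
proof (cases "i = 0")
  case False
  define z where "z = cnj (cis (2 * pi * i / k))"
  have k: "k > 0" using assms by simp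
  have zk: "z ^ k = 1" unfolding z_def using k by (rule cnj_root_of_unity_power)
  have "z \<noteq> 1"
  proof
    assume "z = 1"
    then have "cis (2 * pi * i / k) = 1" unfolding z_def by (metis complex_cnj_cancel_iff complex_cnj_one)
    then have "cos (2 * pi * i / k) = 1" by (simp add: complex_eq_iff)
    then obtain x :: int where "2 * pi * i / k = real_of_int x * 2 * pi" unfolding cos_one_2pi_int by blast
    then have "real i = of_int x * real k" using k by (simp add: field_simps)
    then have "int i = x * int k" by (metis of_int_eq_iff of_int_mult of_int_of_nat_eq)
    then have "k dvd i" by (metis dvd_triv_right int_dvd_int_iff)
    then show False using False assms by (simp add: dvd_imp_le leD)
  qed
  have "(\<Sum>j<k. cnj (cis (2 * pi * real j / real k)) ^ i) = (\<Sum>j<k. z ^ j)"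
    unfolding z_def cis_cnj Complex.DeMoivre by (intro sum.cong refl) (simp add: mult_ac)
  also have "\<dots> = 0" using geometric_sum[OF \<open>z \<noteq> 1\<close>, of k] zk by simp
  finally show ?thesis using False by simp
qed simp

definition unit_periodic :: "nat \<Rightarrow> (nat \<Rightarrow> complex) \<Rightarrow> bool" where
  "unit_periodic m \<phi> \<longleftrightarrow> (\<forall>n. \<phi> (n + m) = \<phi> n) \<and> (\<forall>n. \<not> coprime n m \<longrightarrow> \<phi> n = 0)"

definition eigen :: "nat set \<Rightarrow> (nat \<Rightarrow> complex) \<Rightarrow> bool" where
  "eigen S \<phi> \<longleftrightarrow> (\<forall>g\<in>S. \<exists>a. \<forall>n. \<phi> (g * n) = a * \<phi> n)"

text \<open>
  Every function on the units modulo \<open>m\<close> is a sum of characters: the translation by a unit \<open>g\<close> has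
  finite order, so a function splits into eigenfunctions of it, and the projections commute with all
  other translations. A common eigenfunction is a multiple of a character.
\<close>

lemma eigen_projection_sum:
  assumes m: "m > 0" and \<phi>: "unit_periodic m \<phi>" "eigen S \<phi>" and g: "coprime g m"
  shows "\<exists>k \<Phi>. (\<forall>j<k. unit_periodic m (\<Phi> j) \<and> eigen (insert g S) (\<Phi> j)) \<and> \<phi> = (\<lambda>n. \<Sum>j<(k::nat). \<Phi> j n)"
proof -
  define k where "k = totient m"
  have k: "k > 0" using m by (simp add: k_def)
  have per: "\<phi> (n + m) = \<phi> n" for n using \<phi> by (simp add: unit_periodic_def)
  have gk: "\<phi> (g ^ k * n) = \<phi> n" for n
  proof (rule periodic_cong[of \<phi> m, OF per])
    have "[g ^ k = 1] (mod m)" unfolding k_def by (rule euler_theorem[OF g])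
    then show "[g ^ k * n = n] (mod m)" using cong_scalar_right by fastforce
  qed
  define z where "z j = cis (2 * pi * real j / real k)" for j
  have z1: "z j * cnj (z j) = 1" for j unfolding z_def cis_cnj cis_mult by simp
  have zk: "cnj (z j) ^ k = 1" for j unfolding z_def using k by (rule cnj_root_of_unity_power)
  \<comment> \<open>Projection to the eigenspace of \<open>z j\<close> by averaging over the powers
    of \<open>g\<close>, whose order divides \<open>k\<close>.\<close>
  define \<Phi> where "\<Phi> j n = (\<Sum>i<k. cnj (z j) ^ i * \<phi> (g ^ i * n)) / of_nat k" for j n
  have "\<phi> n = (\<Sum>j<k. \<Phi> j n)" for n
  proof -
    have "(\<Sum>j<k. \<Phi> j n) = (\<Sum>j<k. \<Sum>i<k. cnj (z j) ^ i * \<phi> (g ^ i * n)) / of_nat k"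
      unfolding \<Phi>_def by (simp add: sum_divide_distrib)
    also have "(\<Sum>j<k. \<Sum>i<k. cnj (z j) ^ i * \<phi> (g ^ i * n)) = (\<Sum>i<k. \<Sum>j<k. cnj (z j) ^ i * \<phi> (g ^ i * n))" by (rule sum.swap)
    also have "\<dots> = (\<Sum>i<k. (\<Sum>j<k. cnj (z j) ^ i) * \<phi> (g ^ i * n))" by (simp add: sum_distrib_right)
    also have "\<dots> = (\<Sum>i<k. if i = 0 then of_nat k * \<phi> n else 0)"
      unfolding z_def using sum_roots_of_unity by (intro sum.cong refl) auto
    also have "\<dots> = of_nat k * \<phi> n" using k by simp
    finally show ?thesis using k by simp
  qed
  moreover have "unit_periodic m (\<Phi> j)" for j unfolding unit_periodic_def
  proof (intro conjI allI impI)
    fix n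
    have "\<phi> (g ^ i * (n + m)) = \<phi> (g ^ i * n)" for i
      using periodic_mult[of \<phi> m, OF per, of "g ^ i * n" "g ^ i"] by (simp add: algebra_simps)
    then show "\<Phi> j (n + m) = \<Phi> j n" by (simp add: \<Phi>_def)
  next
    fix n assume "\<not> coprime n m"
    then have "\<phi> (g ^ i * n) = 0" for i using \<phi> unfolding unit_periodic_def by simp
    then show "\<Phi> j n = 0" by (simp add: \<Phi>_def)
  qed
  moreover have "eigen (insert g S) (\<Phi> j)" for j unfolding eigen_def
  proof
    fix h assume "h \<in> insert g S"
    then consider "h = g" | "h \<in> S" by blast
    then show "\<exists>a. \<forall>n. \<Phi> j (h * n) = a * \<Phi> j n"
    proof cases
      case 1
      have "\<Phi> j (g * n) = z j * \<Phi> j n" for n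
      proof -
        define t where "t i = cnj (z j) ^ i * \<phi> (g ^ i * n)" for i
        have tk: "t k = t 0" unfolding t_def using zk gk by simp
        have "cnj (z j) ^ i * \<phi> (g ^ i * (g * n)) = z j * t (Suc i)" for i
        proof -
          have "z j * t (Suc i) = (z j * cnj (z j)) * (cnj (z j) ^ i * \<phi> (g ^ Suc i * n))" by (simp add: t_def mult_ac)
          then show ?thesis by (simp add: z1 mult_ac)
        qed
        then have "(\<Sum>i<k. cnj (z j) ^ i * \<phi> (g ^ i * (g * n))) = z j * (\<Sum>i<k. t (Suc i))" by (simp add: sum_distrib_left)
        also have "(\<Sum>i<k. t (Suc i)) = (\<Sum>i<k. t i)" using tk sum.lessThan_Suc_shift[of t k] by simp
        finally show ?thesis unfolding \<Phi>_def t_def by simp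
      qed
      then show ?thesis using 1 by blast
    next
      case 2
      then obtain l where l: "\<And>n. \<phi> (h * n) = l * \<phi> n" using \<phi> unfolding eigen_def by blast
      have *: "\<phi> (g ^ i * (h * n)) = l * \<phi> (g ^ i * n)" for i n using l[of "g ^ i * n"] by (simp add: mult_ac)
      have "\<Phi> j (h * n) = (\<Sum>i<k. l * (cnj (z j) ^ i * \<phi> (g ^ i * n))) / of_nat k" for n
        unfolding \<Phi>_def * by (simp add: mult.left_commute)
      then have "\<Phi> j (h * n) = l * \<Phi> j n" for n unfolding \<Phi>_def sum_distrib_left[symmetric] by simp
      then show ?thesis by blast
    qed
  qed
  ultimately show ?thesis by blast
qed

text \<open>The eigenvalue for a unit \<open>a\<close> is \<open>\<phi> a / \<phi> 1\<close>, whence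
  multiplicativity; if \<open>\<phi> 1 = 0\<close>, then \<open>\<phi>\<close> vanishes on all
  units. In that case \<open>c = 0\<close>, and nothing is said about \<open>\<xi>\<close>.\<close>

lemma eigen_all_imp_dchar:
  assumes m: "m > 0" and \<phi>: "unit_periodic m \<phi>" "eigen {g. g < m \<and> coprime g m} \<phi>"
  shows "\<exists>c \<xi>. (c = 0 \<or> dchar m \<xi>) \<and> \<phi> = (\<lambda>n. c * \<xi> n)"
proof -
  have per: "\<phi> (n + m) = \<phi> n" for n using \<phi> by (simp add: unit_periodic_def)
  have ev: "\<exists>a. \<forall>n. \<phi> (g * n) = a * \<phi> n" if "coprime g m" for g
  proof -
    have "g mod m < m" "coprime (g mod m) m" using m that by simp_all
    then obtain l where "\<And>n. \<phi> (g mod m * n) = l * \<phi> n" using \<phi>(2) unfolding eigen_def by blast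
    moreover have "\<phi> (g * n) = \<phi> (g mod m * n)" for n
      by (rule periodic_cong[of \<phi> m, OF per]) (simp add: cong_def mod_mult_left_eq)
    ultimately show ?thesis by metis
  qed
  have split: "\<phi> (a * b) * \<phi> 1 = \<phi> a * \<phi> b" for a b
  proof (cases "coprime a m")
    case True
    then obtain l where "\<And>n. \<phi> (a * n) = l * \<phi> n" using ev by blast
    from this[of b] this[of 1] show ?thesis by simp
  next
    case False
    then show ?thesis using \<phi>(1) unfolding unit_periodic_def by simp
  qed
  show ?thesis
  proof (cases "\<phi> 1 = 0")
    case True
    have "\<phi> n = 0" for n
    proof (cases "coprime n m")
      case c: True
      then obtain l where "\<And>k. \<phi> (n * k) = l * \<phi> k" using ev by blast
      from this[of 1] show ?thesis using True by simp
    qed (use \<phi>(1) in \<open>auto simp: unit_periodic_def\<close>)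
    then show ?thesis by (intro exI[of _ 0]) auto
  next
    case False
    define \<xi> where "\<xi> n = \<phi> n / \<phi> 1" for n
    have "\<xi> n \<noteq> 0 \<longleftrightarrow> coprime n m" for n
    proof
      assume c: "coprime n m"
      then obtain x where "[n * x = 1] (mod m)" using cong_solve_coprime_nat[OF c] by (auto simp only: One_nat_def)
      then have "\<phi> (n * x) = \<phi> 1" by (rule periodic_cong[of \<phi> m, OF per])
      then show "\<xi> n \<noteq> 0" using split[of n x] False by (auto simp: \<xi>_def)
    next
      assume "\<xi> n \<noteq> 0" then show "coprime n m" using \<phi>(1) by (auto simp: \<xi>_def unit_periodic_def)
    qed
    moreover have "\<xi> (a * b) = \<xi> a * \<xi> b" for a b using split[of a b] False by (simp add: \<xi>_def field_simps)
    moreover have "\<xi> 1 = 1" "\<And>n. \<xi> (n + m) = \<xi> n" using False per by (auto simp: \<xi>_def)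
    ultimately have "dchar m \<xi>" unfolding dchar_def by blast
    then show ?thesis using False by (intro exI[of _ "\<phi> 1"] exI[of _ \<xi>]) (auto simp: \<xi>_def)
  qed
qed

text \<open>For proving linear statements it suffices to treat characters. The translations are
  adjoined one after the other: \<open>eigen_projection_sum\<close> writes an eigenfunction for
  \<open>S\<close> as a sum of eigenfunctions for one translation more.\<close>

lemma unit_periodic_induct:
  assumes m: "m > 0" and "unit_periodic m \<phi>"
    and zero: "Pr (\<lambda>_. 0)" and add: "\<And>\<phi> \<psi>. Pr \<phi> \<Longrightarrow> Pr \<psi> \<Longrightarrow> Pr (\<lambda>n. \<phi> n + \<psi> n)"
    and char: "\<And>c \<xi>. dchar m \<xi> \<Longrightarrow> Pr (\<lambda>n. c * \<xi> n)"
  shows "Pr \<phi>"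
proof -
  have fs: "Pr (\<lambda>n. \<Sum>j<k. \<Phi> j n)" if "\<And>j. j < k \<Longrightarrow> Pr (\<Phi> j)" for k :: nat and \<Phi>
    using that
  proof (induction k)
    case (Suc k)
    then show ?case using add[of "\<lambda>n. \<Sum>j<k. \<Phi> j n" "\<Phi> k"] by simp
  qed (simp add: zero)
  have gen: "finite S \<Longrightarrow> S \<subseteq> {g. coprime g m} \<Longrightarrow> (\<And>\<phi>. unit_periodic m \<phi> \<Longrightarrow> eigen S \<phi> \<Longrightarrow> Pr \<phi>) \<Longrightarrow> unit_periodic m \<phi> \<Longrightarrow> Pr \<phi>" for S \<phi>
  proof (induction S arbitrary: \<phi> rule: finite_induct)
    case empty then show ?case by (simp add: eigen_def)
  next
    case (insert g S)
    show ?case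
    proof (rule insert.IH)
      show "S \<subseteq> {g. coprime g m}" using insert.prems by auto
      show "unit_periodic m \<phi>" by fact
      fix \<psi> assume \<psi>: "unit_periodic m \<psi>" "eigen S \<psi>"
      have "coprime g m" using insert.prems by auto
      from eigen_projection_sum[OF m \<psi> this] obtain k \<Phi> where
        k: "\<forall>j<k. unit_periodic m (\<Phi> j) \<and> eigen (insert g S) (\<Phi> j)" "\<psi> = (\<lambda>n. \<Sum>j<(k::nat). \<Phi> j n)" by blast
      show "Pr \<psi>" unfolding k(2) by (rule fs, rule insert.prems(2)) (use k(1) in auto)
    qed
  qed
  show ?thesis
  proof (rule gen[of "{g. g < m \<and> coprime g m}"])
    fix \<psi> assume \<psi>: "unit_periodic m \<psi>" "eigen {g. g < m \<and> coprime g m} \<psi>"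
    from eigen_all_imp_dchar[OF m this] obtain c \<xi> where "c = 0 \<or> dchar m \<xi>" "\<psi> = (\<lambda>n. c * \<xi> n)" by blast
    then show "Pr \<psi>" using zero char by auto
  qed (use assms in auto)
qed

section \<open>Euler products\<close>

lemma moebius_mu_one: "moebius_mu 1 = 1" by (simp add: moebius_mu_def)

lemma moebius_mu_mult_prime:
  assumes p: "prime p" and m: "m \<noteq> 0"
  shows "moebius_mu (p * m) = (if p dvd m then 0 else - moebius_mu m)"
proof (cases "p dvd m")
  case True
  then obtain k where "m = p * k" by blast
  then have "p ^ 2 dvd p * m" by (simp add: power2_eq_square)
  then have "\<not> squarefree (p * m)" using p by (metis squarefreeD not_prime_unit)
  then show ?thesis using True by (simp add: moebius_mu_def)
next
  case False
  then have cop: "coprime p m" using p by (simp add: prime_imp_coprime)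
  have sq: "squarefree (p * m) \<longleftrightarrow> squarefree m"
    using squarefree_mult_coprime[OF cop] squarefree_prime[OF p] squarefree_multD(2) by blast
  have "prime_factors (p * m) = insert p (prime_factors m)"
    using p m by (subst prime_factorization_mult) (auto simp: prime_factorization_prime prime_gt_0_nat)
  moreover have "p \<notin> prime_factors m" using False by auto
  ultimately have "card (prime_factors (p * m)) = Suc (card (prime_factors m))" by simp
  then show ?thesis using False by (simp add: moebius_mu_def sq)
qed

lemma norm_moebius_mu_le: "norm (of_int (moebius_mu n) :: complex) \<le> 1"
  by (simp add: moebius_mu_def norm_power)

lemma abs_moebius_mu_le: "\<bar>real_of_int (moebius_mu n)\<bar> \<le> 1"
  by (simp add: moebius_mu_def)

definition primes_upto :: "nat \<Rightarrow> nat set" where "primes_upto N = {p. prime p \<and> p \<le> N}"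

lemma finite_primes_upto [simp]: "finite (primes_upto N)"
  by (rule finite_subset[of _ "{..N}"]) (auto simp: primes_upto_def)

locale cmult =
  fixes c :: "nat \<Rightarrow> complex"
  assumes c0: "c 0 = 0" and c1: "c 1 = 1" and mult: "c (a * b) = c a * c b" and abs: "(\<lambda>n. norm (c n)) summable_on UNIV"
begin

definition free :: "nat set \<Rightarrow> nat set" where "free P = {n. \<forall>p\<in>P. \<not> p dvd n}"

lemma free_insert:
  assumes p: "prime p" "p \<notin> P" and P: "\<And>p. p \<in> P \<Longrightarrow> prime p"
  shows "free P = free (insert p P) \<union> (\<lambda>m. p * m) ` free P" "free (insert p P) \<inter> (\<lambda>m. p * m) ` free P = {}"
proof -
  have dv: "x dvd p * m \<longleftrightarrow> x dvd m" if "x \<in> P" for x m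
  proof -
    have "x \<noteq> p" "prime x" using that p P by auto
    then have "coprime x p" using p by (simp add: primes_coprime)
    then show ?thesis by (simp add: coprime_dvd_mult_right_iff)
  qed
  have "n \<in> (\<lambda>m. p * m) ` free P" if "n \<in> free P" "p dvd n" for n
  proof -
    from \<open>p dvd n\<close> obtain m where "n = p * m" by (rule dvdE)
    then show ?thesis using that dv by (auto simp: free_def)
  qed
  then show "free P = free (insert p P) \<union> (\<lambda>m. p * m) ` free P" using dv by (auto simp: free_def)
  show "free (insert p P) \<inter> (\<lambda>m. p * m) ` free P = {}" by (auto simp: free_def)
qed

lemma abs_bounded_mult:
  assumes "\<And>n. norm (g n) \<le> 1" shows "(\<lambda>n. norm (g n * c n)) summable_on A"
proof -
  have "(\<lambda>n. norm (c n)) summable_on A" using abs by (rule summable_on_subset_banach) simp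
  then show ?thesis by (rule Infinite_Sum.abs_summable_on_comparison_test) (use assms in \<open>simp add: norm_mult mult_left_le_one_le\<close>)
qed

lemma summ: "g \<in> {\<lambda>n. 1, \<lambda>n. of_int (moebius_mu n)} \<Longrightarrow> (\<lambda>n. g n * c n) summable_on A"
  by (rule Infinite_Sum.abs_summable_summable, rule abs_bounded_mult) (auto simp: abs_moebius_mu_le)

text \<open>
  Removing the multiples of one prime after the other from the series of \<open>c\<close> and from that of
  \<open>\<mu> c\<close> multiplies the sum by \<open>1 - c p\<close> and by its inverse, respectively.
\<close>

lemma sieve_step:
  assumes p: "prime p" "p \<notin> P" and P: "\<And>p. p \<in> P \<Longrightarrow> prime p"
  shows "infsum c (free (insert p P)) = (1 - c p) * infsum c (free P)"
    and "infsum (\<lambda>n. of_int (moebius_mu n) * c n) (free P) = (1 - c p) * infsum (\<lambda>n. of_int (moebius_mu n) * c n) (free (insert p P))"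
proof -
  define A B where "A = free (insert p P)" and "B = (\<lambda>m. p * m) ` free P"
  have AB: "free P = A \<union> B" "A \<inter> B = {}" unfolding A_def B_def by (rule free_insert[OF p], use P in blast)+
  have inj: "inj_on (\<lambda>m. p * m) A" for A using p by (auto simp: inj_on_def prime_gt_0_nat)
  have s: "c summable_on A" "(\<lambda>n. of_int (moebius_mu n) * c n) summable_on A" for A
    using summ[of "\<lambda>n. 1"] summ[of "\<lambda>n. of_int (moebius_mu n)"] by auto
  have "infsum c (free P) = infsum c A + infsum c B"
    unfolding AB(1) by (rule infsum_Un_disjoint) (use s AB(2) in \<open>auto\<close>)
  also have "infsum c B = infsum (\<lambda>m. c p * c m) (free P)"
    unfolding B_def by (subst infsum_reindex[OF inj]) (simp add: o_def mult)
  also have "\<dots> = c p * infsum c (free P)" by (rule infsum_cmult_right')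
  finally show "infsum c (free (insert p P)) = (1 - c p) * infsum c (free P)" unfolding A_def by (metis add_diff_cancel_right' left_diff_distrib mult_1)
  define h where "h = (\<lambda>n. of_int (moebius_mu n) * c n)"
  have h0: "h 0 = 0" by (simp add: h_def c0)
  have hp: "h (p * m) = (if p dvd m then 0 else - c p * h m)" for m
    using moebius_mu_mult_prime[OF p(1), of m] h0 by (cases "m = 0") (auto simp: h_def mult)
  have "infsum h (free P) = infsum h A + infsum h B"
    unfolding AB(1) by (rule infsum_Un_disjoint) (use s AB(2) in \<open>auto simp: h_def\<close>)
  also have "infsum h B = infsum (\<lambda>m. h (p * m)) (free P)"
    unfolding B_def by (subst infsum_reindex[OF inj]) (simp add: o_def)
  \<comment> \<open>Terms with \<open>p dvd m\<close> vanish because \<open>p * m\<close> is then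
    not squarefree, so the sum shrinks to the numbers free of \<open>p\<close>. This puts the factor
    \<open>1 - c p\<close> on the opposite side compared with the series of
    \<open>c\<close>.\<close>
  also have "\<dots> = infsum (\<lambda>m. - c p * h m) (free (insert p P))"
    by (rule infsum_cong_neutral) (auto simp: hp free_def)
  also have "\<dots> = - c p * infsum h (free (insert p P))" by (rule infsum_cmult_right')
  finally show "infsum (\<lambda>n. of_int (moebius_mu n) * c n) (free P) = (1 - c p) * infsum (\<lambda>n. of_int (moebius_mu n) * c n) (free (insert p P))"
    unfolding h_def[symmetric] A_def by (simp add: algebra_simps)
qed

lemma sieve:
  assumes "finite P" "\<And>p. p \<in> P \<Longrightarrow> prime p"
  shows "infsum c (free P) = (\<Prod>p\<in>P. 1 - c p) * infsum c UNIV"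
    and "infsum (\<lambda>n. of_int (moebius_mu n) * c n) UNIV = (\<Prod>p\<in>P. 1 - c p) * infsum (\<lambda>n. of_int (moebius_mu n) * c n) (free P)"
proof -
  have "infsum c (free P) = (\<Prod>p\<in>P. 1 - c p) * infsum c UNIV \<and>
    infsum (\<lambda>n. of_int (moebius_mu n) * c n) UNIV = (\<Prod>p\<in>P. 1 - c p) * infsum (\<lambda>n. of_int (moebius_mu n) * c n) (free P)"
    using assms
  proof (induction P rule: finite_induct)
    case empty then show ?case by (simp add: free_def)
  next
    case (insert p P)
    then have p: "prime p" "p \<notin> P" "\<And>p. p \<in> P \<Longrightarrow> prime p" by auto
    show ?case using insert.IH[OF p(3)] insert.hyps sieve_step[OF p] by (simp add: mult_ac)
  qed
  then show "infsum c (free P) = (\<Prod>p\<in>P. 1 - c p) * infsum c UNIV"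
    and "infsum (\<lambda>n. of_int (moebius_mu n) * c n) UNIV = (\<Prod>p\<in>P. 1 - c p) * infsum (\<lambda>n. of_int (moebius_mu n) * c n) (free P)"
    by blast+
qed

text \<open>Every \<open>n \<ge> 2\<close> without prime factors up to \<open>N\<close> exceeds
  \<open>N\<close>, so besides \<open>n = 1\<close> only a part of the tail of an absolutely
  convergent series survives.\<close>

lemma free_tendsto:
  assumes g: "\<And>n. norm (g n) \<le> 1" "g 1 = 1"
  shows "(\<lambda>N. infsum (\<lambda>n. g n * c n) (free (primes_upto N))) \<longlonglongrightarrow> 1"
proof -
  define h where "h n = g n * c n" for n
  have h0: "h 0 = 0" "h 1 = 1" using g c1 by (auto simp: h_def c0)
  have ha: "(\<lambda>n. norm (h n)) summable_on A" for A unfolding h_def by (rule abs_bounded_mult[OF g(1)])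
  have hs: "summable (\<lambda>n. norm (h n))" using ha[of UNIV] by (simp add: summable_on_UNIV_nonneg_real_iff)
  have tail: "(\<lambda>N. \<Sum>n. norm (h (n + Suc N))) \<longlonglongrightarrow> 0"
    using LIMSEQ_Suc[OF suminf_exist_split2[OF hs]] by simp
  have "norm (infsum h (free (primes_upto N)) - 1) \<le> (\<Sum>n. norm (h (n + Suc N)))" for N
  proof -
    have sub: "free (primes_upto N) - {0, 1} \<subseteq> {Suc N..}"
    proof
      fix n assume n: "n \<in> free (primes_upto N) - {0, 1}"
      then obtain p where p: "prime p" "p dvd n" using prime_factor_nat[of n] by auto
      then have "p > N" using n by (force simp: free_def primes_upto_def)
      moreover have "p \<le> n" using p n by (auto intro: dvd_imp_le)
      ultimately show "n \<in> {Suc N..}" by simp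
    qed
    have one: "1 \<in> free (primes_upto N)" by (auto simp: free_def primes_upto_def)
    have "infsum h (free (primes_upto N)) = infsum h ({1} \<union> (free (primes_upto N) - {0, 1}))"
      by (rule infsum_cong_neutral) (use h0 one in auto)
    also have "\<dots> = h 1 + infsum h (free (primes_upto N) - {0, 1})"
      by (subst infsum_Un_disjoint) (auto intro!: Infinite_Sum.abs_summable_summable[OF ha])
    finally have "norm (infsum h (free (primes_upto N)) - 1) = norm (infsum h (free (primes_upto N) - {0, 1}))" using h0 by simp
    also have "\<dots> \<le> infsum (\<lambda>n. norm (h n)) (free (primes_upto N) - {0, 1})" by (rule norm_infsum_bound[OF ha])
    also have "\<dots> \<le> infsum (\<lambda>n. norm (h n)) {Suc N..}"
      by (rule infsum_mono_neutral) (use sub ha in auto)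
    also have "{Suc N..} = (\<lambda>n. n + Suc N) ` UNIV" by (auto simp: image_iff) (metis le_add_diff_inverse2 add_Suc_right Suc_le_eq)
    also have "infsum (\<lambda>n. norm (h n)) ((\<lambda>n. n + Suc N) ` UNIV) = infsum (\<lambda>n. norm (h (n + Suc N))) UNIV"
      by (subst infsum_reindex) (auto simp: o_def inj_def)
    also have "\<dots> = (\<Sum>n. norm (h (n + Suc N)))"
    proof (rule sums_unique, rule has_sum_imp_sums, rule has_sum_infsum)
      have "summable (\<lambda>n. norm (h (n + Suc N)))" by (rule summable_ignore_initial_segment[OF hs])
      then show "(\<lambda>n. norm (h (n + Suc N))) summable_on UNIV" by (subst summable_on_UNIV_nonneg_real_iff) auto
    qed
    finally show ?thesis .
  qed
  then have "(\<lambda>N. infsum h (free (primes_upto N)) - 1) \<longlonglongrightarrow> 0"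
    by (intro Lim_null_comparison[OF _ tail] always_eventually) auto
  then show ?thesis unfolding h_def using LIM_zero_iff by blast
qed

lemma euler: "(\<lambda>N. (\<Prod>p\<in>primes_upto N. 1 - c p) * infsum c UNIV) \<longlonglongrightarrow> 1"
  using free_tendsto[of "\<lambda>_. 1"] sieve(1)[OF finite_primes_upto] by (simp add: primes_upto_def)

text \<open>Both sieved series tend to 1. By the two sieve identities their product equals that of
  the unsieved series for every \<open>N\<close>, since the finite Euler product moves from one
  factor to the other.\<close>

lemma moebius_inverse: "infsum (\<lambda>n. of_int (moebius_mu n) * c n) UNIV * infsum c UNIV = 1"
proof -
  define M where "M = infsum (\<lambda>n. of_int (moebius_mu n) * c n) UNIV"
  have "(\<lambda>N. infsum (\<lambda>n. of_int (moebius_mu n) * c n) (free (primes_upto N))) \<longlonglongrightarrow> 1"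
    by (rule free_tendsto) (auto simp: abs_moebius_mu_le moebius_mu_one simp del: One_nat_def)
  from tendsto_mult[OF euler this]
  have "(\<lambda>N. M * infsum c UNIV) \<longlonglongrightarrow> 1"
    unfolding M_def using sieve(2)[OF finite_primes_upto] by (simp add: primes_upto_def mult_ac)
  then show ?thesis unfolding M_def by (simp add: LIMSEQ_const_iff)
qed

end

text \<open>For \<open>x = \<rho> * z\<close> with \<open>z\<close> of modulus 1, compare the power
  series of the logarithms: the coefficients contain
  \<open>3 + 4 cos a + cos (2 a) = 2 (1 + cos a)^2\<close>. The third factor
  \<open>1 - \<rho> * z^2\<close> is the local factor of the squared character; for
  \<open>x = 0\<close> the quotient is \<open>0 / 0 = 0\<close> and the product is 1.\<close>

lemma three_four_one_local:
  fixes x :: complex assumes x: "norm x < 1"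
  shows "norm ((1 - of_real (norm x)) ^ 3 * (1 - x) ^ 4 * (1 - x\<^sup>2 / of_real (norm x))) \<le> 1"
proof (cases "x = 0")
  case False
  define \<rho> where "\<rho> = norm x"
  define z where "z = x / of_real \<rho>"
  have \<rho>: "\<rho> > 0" "\<rho> < 1" using x False by (auto simp: \<rho>_def)
  have z1: "norm z = 1" unfolding z_def \<rho>_def using False by (simp add: norm_divide)
  have x: "x = of_real \<rho> * z" using \<rho> by (simp add: z_def)
  have x2: "x\<^sup>2 / of_real (norm x) = of_real \<rho> * z\<^sup>2" unfolding \<rho>_def[symmetric] using \<rho> by (simp add: x power2_eq_square)
  have ser: "(\<lambda>n. - (\<rho> ^ n / n) * Re (w ^ n)) sums Re (Ln (1 - of_real \<rho> * w))" if "norm w = 1" for w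
  proof -
    have "norm (- (of_real \<rho> * w)) < 1" using \<rho> that by (simp add: norm_mult)
    from Ln_series[OF this] have "(\<lambda>n. (-1) ^ Suc n / of_nat n * (- (of_real \<rho> * w)) ^ n) sums Ln (1 - of_real \<rho> * w)" by simp
    moreover have "(-1) ^ Suc n / of_nat n * (- (of_real \<rho> * w)) ^ n = of_real (- (\<rho> ^ n / n)) * w ^ n" for n
    proof -
      have "(- (of_real \<rho> * w)) ^ n = (-1) ^ n * (of_real \<rho> ^ n * w ^ n)" by (simp add: power_minus[of "of_real \<rho> * w"] power_mult_distrib)
      moreover have "(-1) ^ n * (-1) ^ n = (1 :: complex)" by (simp add: power_mult_distrib[symmetric])
      ultimately show ?thesis by (simp add: field_simps)
    qed
    ultimately have "(\<lambda>n. of_real (- (\<rho> ^ n / n)) * w ^ n) sums Ln (1 - of_real \<rho> * w)" by (simp only:)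
    then have "(\<lambda>n. Re (of_real (- (\<rho> ^ n / n)) * w ^ n)) sums Re (Ln (1 - of_real \<rho> * w))" by (rule sums_Re)
    then show ?thesis by simp
  qed
  have "(\<lambda>n. 3 * (- (\<rho> ^ n / n) * Re (1 ^ n)) + 4 * (- (\<rho> ^ n / n) * Re (z ^ n)) + - (\<rho> ^ n / n) * Re ((z\<^sup>2) ^ n))
      sums (3 * Re (Ln (1 - of_real \<rho> * 1)) + 4 * Re (Ln (1 - of_real \<rho> * z)) + Re (Ln (1 - of_real \<rho> * z\<^sup>2)))"
    by (intro sums_add sums_mult ser) (auto simp: z1 norm_power)
  moreover have "3 * (- (\<rho> ^ n / n) * Re (1 ^ n)) + 4 * (- (\<rho> ^ n / n) * Re (z ^ n)) + - (\<rho> ^ n / n) * Re ((z\<^sup>2) ^ n) \<le> 0" for n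
  proof -
    have "norm (z ^ n) = 1" using z1 by (simp add: norm_power)
    then have n1: "(Re (z ^ n))\<^sup>2 + (Im (z ^ n))\<^sup>2 = 1" using cmod_power2[of "z ^ n"] by simp
    have "Re ((z\<^sup>2) ^ n) = Re ((z ^ n)\<^sup>2)" by (simp add: power_mult[symmetric] mult.commute)
    also have "\<dots> = (Re (z ^ n))\<^sup>2 - (Im (z ^ n))\<^sup>2" by (simp add: power2_eq_square)
    finally have re2: "Re ((z\<^sup>2) ^ n) = 2 * (Re (z ^ n))\<^sup>2 - 1" using n1 by linarith
    have "3 * (- (\<rho> ^ n / n) * Re (1 ^ n)) + 4 * (- (\<rho> ^ n / n) * Re (z ^ n)) + - (\<rho> ^ n / n) * Re ((z\<^sup>2) ^ n)
      = - (\<rho> ^ n / n) * (2 * (1 + Re (z ^ n))\<^sup>2)" unfolding re2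
      by (simp add: power2_eq_square algebra_simps)
    also have "\<dots> \<le> 0" using \<rho> by (simp add: mult_nonneg_nonneg)
    finally show ?thesis .
  qed
  ultimately have le: "3 * Re (Ln (1 - of_real \<rho> * 1)) + 4 * Re (Ln (1 - of_real \<rho> * z)) + Re (Ln (1 - of_real \<rho> * z\<^sup>2)) \<le> 0"
    by (rule sums_le[OF _ _ sums_zero, rotated])
  have nz: "1 - of_real \<rho> * w \<noteq> 0" if "norm w = 1" for w :: complex
  proof
    assume "1 - of_real \<rho> * w = 0"
    then have "of_real \<rho> * w = 1" by simp
    then have "norm (of_real \<rho> * w) = norm (1 :: complex)" by (rule arg_cong)
    then show False using \<rho> that by (simp add: norm_mult)
  qed
  have nn: "norm (1 - of_real \<rho> * w) = exp (Re (Ln (1 - of_real \<rho> * w)))" if "norm w = 1" for w :: complex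
    using nz[OF that] by (metis exp_Ln norm_exp_eq_Re)
  have "norm ((1 - of_real (norm x)) ^ 3 * (1 - x) ^ 4 * (1 - x\<^sup>2 / of_real (norm x)))
     = norm (1 - of_real \<rho> * (1::complex)) ^ 3 * norm (1 - of_real \<rho> * z) ^ 4 * norm (1 - of_real \<rho> * z\<^sup>2)"
    unfolding x2 norm_mult norm_power by (simp add: \<rho>_def[symmetric] x[symmetric])
  also have "\<dots> = exp (3 * Re (Ln (1 - of_real \<rho> * 1)) + 4 * Re (Ln (1 - of_real \<rho> * z)) + Re (Ln (1 - of_real \<rho> * z\<^sup>2)))"
    unfolding exp_add using nn[of 1] nn[OF z1] nn[of "z\<^sup>2"] z1 by (simp add: norm_power exp_of_nat_mult[symmetric])
  also have "\<dots> \<le> 1" using le by simp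
  finally show ?thesis .
qed simp

text \<open>Partial Euler products, raised to the powers 3, 4 and 1, have modulus at most 1 by the
  local inequality, whereas their product with the expression on the right tends to 1.\<close>

lemma three_four_one:
  assumes c: "cmult c" and lt: "\<And>p. prime p \<Longrightarrow> norm (c p) < 1"
    and c0: "cmult (\<lambda>n. of_real (norm (c n)))" and c2: "cmult (\<lambda>n. (c n)\<^sup>2 / of_real (norm (c n)))"
  shows "1 \<le> norm (infsum (\<lambda>n. of_real (norm (c n)) :: complex) UNIV ^ 3 * infsum c UNIV ^ 4 * infsum (\<lambda>n. (c n)\<^sup>2 / of_real (norm (c n))) UNIV)"
proof -
  define A B D where "A = infsum (\<lambda>n. of_real (norm (c n)) :: complex) UNIV" and "B = infsum c UNIV" and "D = infsum (\<lambda>n. (c n)\<^sup>2 / of_real (norm (c n))) UNIV"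
  define a b d where "a N = (\<Prod>p\<in>primes_upto N. 1 - of_real (norm (c p)) :: complex)" and "b N = (\<Prod>p\<in>primes_upto N. 1 - c p)"
    and "d N = (\<Prod>p\<in>primes_upto N. 1 - (c p)\<^sup>2 / of_real (norm (c p)))" for N
  have lim: "(\<lambda>N. norm ((a N * A) ^ 3 * (b N * B) ^ 4 * (d N * D))) \<longlonglongrightarrow> norm (1 ^ 3 * 1 ^ 4 * 1 :: complex)"
    unfolding a_def b_def d_def A_def B_def D_def
    by (intro tendsto_intros cmult.euler[OF c] cmult.euler[OF c0] cmult.euler[OF c2])
  have le: "norm ((a N * A) ^ 3 * (b N * B) ^ 4 * (d N * D)) \<le> norm (A ^ 3 * B ^ 4 * D)" for N
  proof -
    have "a N ^ 3 * b N ^ 4 * d N = (\<Prod>p\<in>primes_upto N. (1 - of_real (norm (c p))) ^ 3 * (1 - c p) ^ 4 * (1 - (c p)\<^sup>2 / of_real (norm (c p))))"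
      unfolding a_def b_def d_def by (simp add: prod.distrib prod_power_distrib)
    then have "norm (a N ^ 3 * b N ^ 4 * d N) \<le> 1"
      using lt by (auto simp: prod_norm[symmetric] primes_upto_def intro!: prod_le_1 three_four_one_local)
    then have "norm (a N ^ 3 * b N ^ 4 * d N) * norm (A ^ 3 * B ^ 4 * D) \<le> 1 * norm (A ^ 3 * B ^ 4 * D)" by (intro mult_right_mono) auto
    moreover have "(a N * A) ^ 3 * (b N * B) ^ 4 * (d N * D) = (a N ^ 3 * b N ^ 4 * d N) * (A ^ 3 * B ^ 4 * D)" by (simp add: power_mult_distrib mult_ac)
    ultimately show ?thesis by (simp only: norm_mult mult_1)
  qed
  have "norm (1 ^ 3 * 1 ^ 4 * 1 :: complex) \<le> norm (A ^ 3 * B ^ 4 * D)" using LIMSEQ_le_const2[OF lim] le by blast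
  then show ?thesis unfolding A_def B_def D_def by simp
qed

section \<open>A Tauberian theorem\<close>

lemma exp_tail_integral:
  fixes z :: complex assumes z: "Re z > 0"
  shows "has_bochner_integral lborel (\<lambda>u. indicator {c..} u *\<^sub>R exp (- z * of_real u)) (exp (- z * of_real c) / z)"
    and "has_bochner_integral lborel (\<lambda>u. norm (indicator {c..} u *\<^sub>R exp (- z * of_real u))) (exp (- Re z * c) / Re z)"
proof -
  have z0: "z \<noteq> 0" using z by auto
  have lim: "((\<lambda>u. - exp (- Re z * u) / Re z) \<longlongrightarrow> 0) at_top"
  proof -
    have "((\<lambda>u. exp (- Re z * u)) \<longlongrightarrow> 0) at_top"
      using z by (intro filterlim_compose[OF exp_at_bot] filterlim_tendsto_neg_mult_at_bot[OF tendsto_const]) (auto simp: filterlim_ident)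
    then have "((\<lambda>u. - exp (- Re z * u) / Re z) \<longlongrightarrow> - 0 / Re z) at_top" by (intro tendsto_intros) (use z in auto)
    then show ?thesis by simp
  qed
  have "(\<integral>\<^sup>+u. ennreal (exp (- Re z * u)) * indicator {c..} u \<partial>lborel) = ennreal (0 - (- exp (- Re z * c) / Re z))"
    by (rule nn_integral_FTC_atLeast[OF _ _ _ lim]) (use z in \<open>auto intro!: derivative_eq_intros\<close>)
  also have "(\<integral>\<^sup>+u. ennreal (exp (- Re z * u)) * indicator {c..} u \<partial>lborel) = (\<integral>\<^sup>+u. ennreal (norm (indicator {c..} u *\<^sub>R exp (- z * of_real u))) \<partial>lborel)"
    by (intro nn_integral_cong) (auto simp: indicator_def norm_exp_eq_Re)
  finally have n: "(\<integral>\<^sup>+u. ennreal (norm (indicator {c..} u *\<^sub>R exp (- z * of_real u))) \<partial>lborel) = ennreal (exp (- Re z * c) / Re z)" by simp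
  show 2: "has_bochner_integral lborel (\<lambda>u. norm (indicator {c..} u *\<^sub>R exp (- z * of_real u))) (exp (- Re z * c) / Re z)"
    by (rule has_bochner_integral_nn_integral[OF _ _ _ n]) (use z in auto)
  then have int: "integrable lborel (\<lambda>u. norm (indicator {c..} u *\<^sub>R exp (- z * of_real u)))" by (rule integrable.intros)
  then have int': "integrable lborel (\<lambda>u. indicator {c..} u *\<^sub>R exp (- z * of_real u))"
    by (subst (asm) integrable_norm_iff) auto
  define F where "F u = - exp (- z * of_real u) / z" for u :: real
  have FTC: "integral\<^sup>L lborel (\<lambda>u. indicator {c..c + real i} u *\<^sub>R exp (- z * of_real u)) = F (c + real i) - F c" for i :: nat
  proof (rule integral_FTC_Icc)
    fix u show "(F has_vector_derivative exp (- z * of_real u)) (at u within {c..c + real i})" unfolding F_def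
      by (rule has_vector_derivative_real_field[of "\<lambda>u. - exp (- z * u) / z" _ u, THEN has_vector_derivative_at_within]) (use z0 in \<open>auto intro!: derivative_eq_intros\<close>)
  qed (auto intro!: continuous_intros)
  have "(\<lambda>i. integral\<^sup>L lborel (\<lambda>u. indicator {c..c + real i} u *\<^sub>R exp (- z * of_real u))) \<longlonglongrightarrow> integral\<^sup>L lborel (\<lambda>u. indicator {c..} u *\<^sub>R exp (- z * of_real u))"
  proof (rule integral_dominated_convergence[OF _ _ int])
    show "AE u in lborel. (\<lambda>i. indicator {c..c + real i} u *\<^sub>R exp (- z * of_real u)) \<longlonglongrightarrow> indicator {c..} u *\<^sub>R exp (- z * of_real u)"
    proof (rule AE_I2)
      fix u :: real
      obtain n :: nat where n: "u - c \<le> real n" using real_arch_simple by blast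
      show "(\<lambda>i. indicator {c..c + real i} u *\<^sub>R exp (- z * of_real u)) \<longlonglongrightarrow> indicator {c..} u *\<^sub>R exp (- z * of_real u)"
        by (rule tendsto_eventually) (use n in \<open>auto simp: eventually_sequentially indicator_def intro!: exI[of _ n]\<close>)
    qed
  qed (auto simp: indicator_def)
  moreover have "(\<lambda>i. F (c + real i) - F c) \<longlonglongrightarrow> 0 - F c"
  proof (intro tendsto_diff tendsto_const)
    have "((\<lambda>u. norm (F u)) \<longlongrightarrow> 0) at_top"
    proof -
      have "(\<lambda>u. norm (F u)) = (\<lambda>u. exp (- Re z * u) / norm z)" by (auto simp: F_def norm_divide norm_exp_eq_Re)
      moreover have "((\<lambda>u. exp (- Re z * u)) \<longlongrightarrow> 0) at_top"
        using z by (intro filterlim_compose[OF exp_at_bot] filterlim_tendsto_neg_mult_at_bot[OF tendsto_const]) (auto simp: filterlim_ident)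
      ultimately show ?thesis using tendsto_divide[OF _ tendsto_const[of "norm z"], of "\<lambda>u. exp (- Re z * u)" 0 at_top] z0 by simp
    qed
    then have "(F \<longlongrightarrow> 0) at_top" by (rule tendsto_norm_zero_cancel)
    moreover have "filterlim (\<lambda>i. c + real i) at_top sequentially"
      by (rule filterlim_tendsto_add_at_top[OF tendsto_const filterlim_real_sequentially])
    ultimately show "(\<lambda>i. F (c + real i)) \<longlonglongrightarrow> 0" by (rule filterlim_compose)
  qed
  ultimately have "integral\<^sup>L lborel (\<lambda>u. indicator {c..} u *\<^sub>R exp (- z * of_real u)) = 0 - F c"
    unfolding FTC by (rule LIMSEQ_unique)
  then show "has_bochner_integral lborel (\<lambda>u. indicator {c..} u *\<^sub>R exp (- z * of_real u)) (exp (- z * of_real c) / z)"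
    using int' by (simp add: has_bochner_integral_iff F_def)
qed

section \<open>The Fejer kernel and the Riemann-Lebesgue lemma\<close>

definition tent :: "real \<Rightarrow> real" where "tent t = max 0 (1 - \<bar>t\<bar>)"

text \<open>The square of \<open>sin (w/2) / (w/2)\<close>, extended continuously to 0; it is the
  Fourier transform of \<open>tent\<close> by \<open>tent_fourier\<close>.\<close>

definition fejer :: "real \<Rightarrow> real" where "fejer w = (if w = 0 then 1 else 2 * (1 - cos w) / w\<^sup>2)"

lemma continuous_tent [continuous_intros]: "continuous_on S g \<Longrightarrow> continuous_on S (\<lambda>t. tent (g t))"
  unfolding tent_def by (intro continuous_intros)

lemma tent_measurable [measurable]: "tent \<in> borel_measurable borel"
  by (intro borel_measurable_continuous_onI continuous_intros)

lemma tent_bounds: "0 \<le> tent t" "tent t \<le> indicator {-1..1} t" "tent t \<le> 1"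
  by (auto simp: tent_def indicator_def)

lemma integrable_tent: "integrable lborel tent"
proof (rule Bochner_Integration.integrable_bound)
  show "integrable lborel (indicator {-1..1::real} :: real \<Rightarrow> real)" by (rule integrable_real_indicator) auto
qed (use tent_bounds in auto)

lemma tent_fourier: "has_bochner_integral lborel (\<lambda>t. of_real (tent t) * exp (\<i> * of_real (t * w))) (of_real (fejer w))"
proof -
  define I1 where "I1 = (\<lambda>t::real. indicator {0..1} t *\<^sub>R ((1 - of_real t) * exp (\<i> * of_real (t * w))) :: complex)"
  define I2 where "I2 = (\<lambda>t::real. indicator {-1..0} t *\<^sub>R ((1 + of_real t) * exp (\<i> * of_real (t * w))) :: complex)"
  \<comment> \<open>The two halves of the tent overlap at the single point 0.\<close>
  have eq: "AE t in lborel. I1 t + I2 t = of_real (tent t) * exp (\<i> * of_real (t * w))"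
    using AE_lborel_singleton[of 0] by eventually_elim (auto simp: I1_def I2_def tent_def indicator_def)
  have "has_bochner_integral lborel (\<lambda>t. I1 t + I2 t) (of_real (fejer w))"
  proof (cases "w = 0")
    case False
    define a where "a = \<i> * complex_of_real w"
    have a: "a \<noteq> 0" using False by (simp add: a_def)
    have ea: "\<i> * of_real (t * w) = a * of_real t" for t by (simp add: a_def)
    define F1 where "F1 t = (1 - t) * exp (a * t) / a + exp (a * t) / a\<^sup>2" for t
    define F2 where "F2 t = (1 + t) * exp (a * t) / a - exp (a * t) / a\<^sup>2" for t
    have d1: "(F1 has_field_derivative (1 - t) * exp (a * t)) (at t)" for t unfolding F1_def
      by (rule derivative_eq_intros refl | use a in \<open>simp add: field_simps power2_eq_square\<close>)+
    have d2: "(F2 has_field_derivative (1 + t) * exp (a * t)) (at t)" for t unfolding F2_def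
      by (rule derivative_eq_intros refl | use a in \<open>simp add: field_simps power2_eq_square\<close>)+
    have 1: "has_bochner_integral lborel I1 (F1 (of_real 1) - F1 (of_real 0))" unfolding I1_def ea
      by (rule has_bochner_integral_FTC_Icc[of 0 1 "\<lambda>t. F1 (of_real t)"])
        (auto intro!: continuous_intros has_vector_derivative_real_field[OF d1, THEN has_vector_derivative_at_within])
    have 2: "has_bochner_integral lborel I2 (F2 (of_real 0) - F2 (of_real (-1)))" unfolding I2_def ea
      by (rule has_bochner_integral_FTC_Icc[of "-1" 0 "\<lambda>t. F2 (of_real t)"])
        (auto intro!: continuous_intros has_vector_derivative_real_field[OF d2, THEN has_vector_derivative_at_within])
    have "(F1 (of_real 1) - F1 (of_real 0)) + (F2 (of_real 0) - F2 (of_real (-1))) = (exp a + exp (-a) - 2) / a\<^sup>2"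
      using a by (simp add: F1_def F2_def field_simps power2_eq_square)
    also have "exp a + exp (-a) = 2 * of_real (cos w)"
      unfolding a_def cos_of_real[symmetric] cos_exp_eq by simp
    also have "(2 * of_real (cos w) - 2) / a\<^sup>2 = of_real (fejer w)"
      using False by (simp add: a_def fejer_def power2_eq_square field_simps)
    finally have e: "(F1 (of_real 1) - F1 (of_real 0)) + (F2 (of_real 0) - F2 (of_real (-1))) = of_real (fejer w)" .
    show ?thesis using has_bochner_integral_add[OF 1 2] unfolding e .
  next
    case True
    have d1: "((\<lambda>t::complex. t - t\<^sup>2/2) has_field_derivative (1 - t)) (at t)" for t by (rule derivative_eq_intros refl | simp)+
    have d2: "((\<lambda>t::complex. t + t\<^sup>2/2) has_field_derivative (1 + t)) (at t)" for t by (rule derivative_eq_intros refl | simp)+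
    have 1: "has_bochner_integral lborel I1 ((1 - 1/2) - (0 - 0))" unfolding I1_def True
      using has_bochner_integral_FTC_Icc[of 0 1 "\<lambda>t. of_real t - (of_real t)\<^sup>2/2" "\<lambda>t. 1 - of_real t :: complex"]
        has_vector_derivative_real_field[OF d1, THEN has_vector_derivative_at_within] by (simp add: continuous_intros)
    have 2: "has_bochner_integral lborel I2 ((0 + 0) - (-1 + 1/2))" unfolding I2_def True
      using has_bochner_integral_FTC_Icc[of "-1" 0 "\<lambda>t. of_real t + (of_real t)\<^sup>2/2" "\<lambda>t. 1 + of_real t :: complex"]
        has_vector_derivative_real_field[OF d2, THEN has_vector_derivative_at_within] by (simp add: continuous_intros)
    show ?thesis using has_bochner_integral_add[OF 1 2] by (simp add: fejer_def True)
  qed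
  then show ?thesis by (rule has_bochner_integral_cong_AE[THEN iffD1, rotated 3]) (use eq in \<open>auto simp: I1_def I2_def\<close>)
qed

lemma fejer_measurable [measurable]: "fejer \<in> borel_measurable borel"
  unfolding fejer_def by measurable

lemma fejer_nonneg: "fejer w \<ge> 0" by (auto simp: fejer_def)

lemma fejer_le:
  assumes "w \<noteq> 0" shows "fejer w \<le> 4 / w\<^sup>2"
proof -
  have "2 * (1 - cos w) \<le> 2 * 2" using cos_ge_minus_one[of w] by (intro mult_left_mono) auto
  then have "2 * (1 - cos w) / w\<^sup>2 \<le> 4 / w\<^sup>2" by (intro divide_right_mono) auto
  then show ?thesis using assms by (simp add: fejer_def)
qed

lemma fejer_le_1: "fejer w \<le> 1"
proof (cases "w = 0")
  case False
  define t where "t = w / 2"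
  have w: "w = 2 * t" "t \<noteq> 0" using False by (auto simp: t_def)
  have "2 * (1 - cos w) = 4 * (sin t)\<^sup>2" unfolding w cos_double_sin by simp
  also have "\<dots> \<le> 4 * t\<^sup>2" using abs_sin_x_le_abs_x[of t] by (simp add: abs_le_square_iff)
  finally show ?thesis using False w by (auto simp: fejer_def divide_le_eq_1 power2_eq_square zero_less_mult_iff)
qed (simp add: fejer_def)

lemma integrable_fejer: "integrable lborel fejer"
proof -
  define g where "g w = indicator {-1..1} w + indicator {1..} w * (4 / w\<^sup>2) + indicator {1..} (-w) * (4 / (-w)\<^sup>2)" for w :: real
  have i1: "integrable lborel (\<lambda>w::real. indicator {1..} w * (4 / w\<^sup>2))"
  proof -
    have "((\<lambda>w. - 4 / w) \<longlongrightarrow> (0::real)) at_top" by (intro tendsto_divide_0[OF tendsto_const] filterlim_at_top_imp_at_infinity filterlim_ident)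
    then have "(\<integral>\<^sup>+w. ennreal (4 / w\<^sup>2) * indicator {1..} w \<partial>lborel) = ennreal (0 - (- 4 / 1))"
      by (intro nn_integral_FTC_atLeast[where F = "\<lambda>w. - 4 / w"]) (auto intro!: derivative_eq_intros simp: power2_eq_square)
    also have "(\<integral>\<^sup>+w. ennreal (4 / w\<^sup>2) * indicator {1..} w \<partial>lborel) = (\<integral>\<^sup>+w. ennreal (indicator {1..} w * (4 / w\<^sup>2)) \<partial>lborel)"
      by (intro nn_integral_cong) (auto simp: indicator_def)
    finally show ?thesis by (intro integrableI_nonneg) (auto simp: indicator_def)
  qed
  have "integrable lborel g" unfolding g_def
    using lborel_integrable_real_affine[OF i1, of "-1" 0] by (intro Bochner_Integration.integrable_add i1 integrable_real_indicator) auto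
  then show ?thesis
  proof (rule Bochner_Integration.integrable_bound)
    show "AE w in lborel. norm (fejer w) \<le> norm (g w)"
    proof (rule AE_I2)
      fix w :: real
      consider "w \<in> {-1..1}" | "w > 1" | "w < -1" by force
      then have "fejer w \<le> g w"
      proof cases
        case 1
        then have "fejer w \<le> indicator {-1..1} w" using fejer_le_1[of w] by simp
        also have "\<dots> \<le> g w" by (auto simp: g_def indicator_def)
        finally show ?thesis .
      qed (use fejer_le[of w] in \<open>auto simp: g_def indicator_def\<close>)
      then show "norm (fejer w) \<le> norm (g w)" using fejer_nonneg[of w] by simp
    qed
  qed simp
qed

lemma integral_fejer_pos: "integral\<^sup>L lborel fejer > 0"
proof -
  have "0 < (1 - cos 1) / (2::real)" using cos_monotone_0_pi[of 0 1] pi_gt3 by simp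
  also have "(1 - cos 1) / (2::real) = (\<integral>w. indicator {1..2::real} w * ((1 - cos 1) / 2) \<partial>lborel)" by simp
  also have "\<dots> \<le> integral\<^sup>L lborel fejer"
  proof (rule integral_mono)
    fix w :: real
    show "indicator {1..2} w * ((1 - cos 1) / 2) \<le> fejer w"
    proof (cases "w \<in> {1..2}")
      case True
      then have "cos w \<le> cos 1" using pi_gt3 by (intro cos_monotone_0_pi_le) auto
      moreover have "w\<^sup>2 \<le> 2\<^sup>2" using True by (intro power_mono) auto
      ultimately have "2 * (1 - cos 1) / 2\<^sup>2 \<le> 2 * (1 - cos w) / w\<^sup>2" using True by (intro frac_le) auto
      also have "\<dots> = fejer w" using True by (simp add: fejer_def)
      finally show ?thesis using True by simp
    qed (use fejer_nonneg in auto)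
  qed (auto intro!: integrable_fejer integrable_mult_left integrable_real_indicator)
  finally show ?thesis .
qed

text \<open>Translation by \<open>pi / y\<close> changes the sign of the exponential, so twice the
  integral is the integral of \<open>g t - g (t + pi / y)\<close> against it, which tends to 0 by
  continuity and dominated convergence.\<close>

lemma riemann_lebesgue:
  fixes g :: "real \<Rightarrow> complex"
  assumes cont: "continuous_on UNIV g" and supp: "\<And>t. \<bar>t\<bar> > 1 \<Longrightarrow> g t = 0"
  shows "((\<lambda>y. \<integral>t. g t * exp (\<i> * of_real (t * y)) \<partial>lborel) \<longlongrightarrow> 0) at_top"
proof -
  have "compact (g ` {-1..1})" by (intro compact_continuous_image continuous_on_subset[OF cont]) auto
  then obtain C where C: "\<And>t. t \<in> {-1..1} \<Longrightarrow> norm (g t) \<le> C" using compact_imp_bounded bounded_iff by (metis imageI)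
  have C0: "C \<ge> 0" using order.trans[OF norm_ge_zero C[of 0]] by simp
  have gC: "norm (g t) \<le> C * indicator {-1..1} t" for t using C[of t] supp[of t] C0 by (cases "\<bar>t\<bar> > 1") (auto simp: indicator_def)
  have gm [measurable]: "g \<in> borel_measurable borel" using cont by (rule borel_measurable_continuous_onI)
  have ind: "integrable lborel (\<lambda>t::real. C * indicator {-1..1} t)" by (intro integrable_mult_right integrable_real_indicator) auto
  have gi: "integrable lborel (\<lambda>t. g t * exp (\<i> * of_real (t * y)))" for y
    by (rule Bochner_Integration.integrable_bound[OF ind]) (use gC C0 in \<open>auto simp: norm_mult\<close>)
  define D where "D y t = norm (g t - g (t + pi / y))" for y t
  have D0: "((\<lambda>y. \<integral>t. D y t \<partial>lborel) \<longlongrightarrow> integral\<^sup>L lborel (\<lambda>t::real. 0::real)) at_top"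
  proof (rule integral_dominated_convergence_at_top[where s = D and f = "\<lambda>_. 0" and w = "\<lambda>t. 2 * C * indicator {-2..2} t"])
    show "integrable lborel (\<lambda>t::real. 2 * C * indicator {-2..2} t)" by (intro integrable_mult_right integrable_real_indicator) auto
    show "AE t in lborel. ((\<lambda>y. D y t) \<longlongrightarrow> 0) at_top"
    proof (rule AE_I2)
      fix t :: real
      have "((\<lambda>y. t + pi / y) \<longlongrightarrow> t + 0) at_top"
        by (intro tendsto_add tendsto_const tendsto_divide_0[OF tendsto_const] filterlim_at_top_imp_at_infinity filterlim_ident)
      then have l: "((\<lambda>y. t + pi / y) \<longlongrightarrow> t) at_top" by simp
      have "isCont g t" using cont by (simp add: continuous_on_eq_continuous_at)
      then have "((\<lambda>y. g (t + pi / y)) \<longlongrightarrow> g t) at_top" using l by (rule isCont_tendsto_compose)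
      then have "((\<lambda>y. norm (g t - g (t + pi / y))) \<longlongrightarrow> norm (g t - g t)) at_top" by (intro tendsto_intros)
      then show "((\<lambda>y. D y t) \<longlongrightarrow> 0) at_top" by (simp add: D_def)
    qed
    show "\<forall>\<^sub>F y in at_top. AE t in lborel. norm (D y t) \<le> 2 * C * indicator {-2..2} t"
    proof (rule eventually_mono[OF eventually_ge_at_top[of pi]], rule AE_I2)
      fix y t :: real assume y: "y \<ge> pi"
      have "y > 0" using y pi_gt_zero by linarith
      then have "pi / y \<le> 1" "pi / y \<ge> 0" using y by (auto simp: divide_le_eq_1)
      then have "indicator {-1..1} t \<le> (indicator {-2..2} t :: real)" "indicator {-1..1} (t + pi / y) \<le> (indicator {-2..2} t :: real)"
        by (auto simp: indicator_def)
      then have "C * indicator {-1..1} t + C * indicator {-1..1} (t + pi / y) \<le> C * indicator {-2..2} t + C * indicator {-2..2} t"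
        using C0 by (intro add_mono mult_left_mono) auto
      moreover have "D y t \<le> norm (g t) + norm (g (t + pi / y))" unfolding D_def by (rule norm_triangle_ineq4)
      ultimately show "norm (D y t) \<le> 2 * C * indicator {-2..2} t"
        using gC[of t] gC[of "t + pi / y"] by (simp add: D_def)
    qed
    show "D y \<in> borel_measurable lborel" for y unfolding D_def[abs_def] by measurable
  qed auto
  have bound: "norm (\<integral>t. g t * exp (\<i> * of_real (t * y)) \<partial>lborel) \<le> (\<integral>t. D y t \<partial>lborel)" if y: "y > 0" for y
  proof -
    define I where "I = (\<integral>t. g t * exp (\<i> * of_real (t * y)) \<partial>lborel)"
    have i2: "integrable lborel (\<lambda>t. g (t + pi / y) * exp (\<i> * of_real ((t + pi / y) * y)))"
      using lborel_integrable_real_affine[OF gi[of y], of 1 "pi / y"] by (simp add: add.commute)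
    have "I = (\<integral>t. g (t + pi / y) * exp (\<i> * of_real ((t + pi / y) * y)) \<partial>lborel)"
      unfolding I_def by (subst lborel_integral_real_affine[of 1 _ "pi / y"]) (simp_all add: add.commute)
    then have "I + I = (\<integral>t. g t * exp (\<i> * of_real (t * y)) + g (t + pi / y) * exp (\<i> * of_real ((t + pi / y) * y)) \<partial>lborel)"
      using Bochner_Integration.integral_add[OF gi[of y] i2] by (simp add: I_def)
    also have "(\<lambda>t. g t * exp (\<i> * of_real (t * y)) + g (t + pi / y) * exp (\<i> * of_real ((t + pi / y) * y))) = (\<lambda>t. (g t - g (t + pi / y)) * exp (\<i> * of_real (t * y)))"
    proof
      fix t
      have "(t + pi / y) * y = t * y + pi" using y by (simp add: field_simps)
      then have "exp (\<i> * of_real ((t + pi / y) * y)) = - exp (\<i> * of_real (t * y))" by (simp add: ring_distribs exp_add)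
      then show "g t * exp (\<i> * of_real (t * y)) + g (t + pi / y) * exp (\<i> * of_real ((t + pi / y) * y)) = (g t - g (t + pi / y)) * exp (\<i> * of_real (t * y))"
        by (simp only: left_diff_distrib mult_minus_right add_uminus_conv_diff)
    qed
    finally have "2 * norm I = norm (\<integral>t. (g t - g (t + pi / y)) * exp (\<i> * of_real (t * y)) \<partial>lborel)"
      by (metis mult_2 norm_mult norm_numeral)
    also have "\<dots> \<le> (\<integral>t. norm ((g t - g (t + pi / y)) * exp (\<i> * of_real (t * y))) \<partial>lborel)" by (rule integral_norm_bound)
    also have "\<dots> = (\<integral>t. D y t \<partial>lborel)" by (simp add: norm_mult D_def)
    finally show ?thesis unfolding I_def[symmetric] using norm_ge_zero[of I] by linarith
  qed
  show ?thesis
    by (rule Lim_null_comparison[OF eventually_mono[OF eventually_gt_at_top[of 0] bound] D0[simplified]])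
qed


text \<open>The Wiener-Ikehara setting without a pole: bounded coefficients, and a series that
  extends continuously to the closed half-plane. Arguments \<open>Suc n\<close> let the series start
  at 1.\<close>

locale dirichlet_boundary =
  fixes a :: "nat \<Rightarrow> complex" and G :: "complex \<Rightarrow> complex"
  assumes bd: "norm (a n) \<le> 1" and contG: "continuous_on {s. Re s \<ge> 1} G"
    and ser: "Re s > 1 \<Longrightarrow> (\<lambda>n. a (Suc n) * of_nat (Suc n) powr (-s)) sums G s"
begin

definition S where "S k = (\<Sum>n<k. a (Suc n))"
text \<open>The mean of the coefficients on the scale \<open>exp u\<close>. In this variable the
  Dirichlet series becomes a Laplace transform, namely \<open>Gh\<close>; see
  \<open>laplace\<close>.\<close>

definition \<phi> where "\<phi> u = of_real (exp (- u)) * S (nat \<lfloor>exp u\<rfloor>)" for u :: real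
definition Gh where "Gh s = G (1 + s) / (1 + s)"

lemma norm_S_diff: assumes "j \<le> k" shows "norm (S k - S j) \<le> real k - real j"
proof -
  have "S k - S j = (\<Sum>n\<in>{j..<k}. a (Suc n))" unfolding S_def lessThan_atLeast0
    using assms sum_diff_nat_ivl[of 0 j k "\<lambda>n. a (Suc n)"] by simp
  also have "norm \<dots> \<le> (\<Sum>n\<in>{j..<k}. 1)" by (intro sum_norm_le bd)
  finally show ?thesis using assms by (simp add: of_nat_diff)
qed

lemma norm_S: "norm (S k) \<le> real k" using norm_S_diff[of 0 k] by (simp add: S_def)

lemma nat_floor_exp: "real (nat \<lfloor>exp u\<rfloor>) \<le> exp u" "exp u - 1 < real (nat \<lfloor>exp u\<rfloor>)"
proof -
  have "\<lfloor>exp u\<rfloor> \<ge> 0" by simp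
  then show "real (nat \<lfloor>exp u\<rfloor>) \<le> exp u" by simp
  show "exp u - 1 < real (nat \<lfloor>exp u\<rfloor>)" using \<open>\<lfloor>exp u\<rfloor> \<ge> 0\<close> by linarith
qed

lemma norm_\<phi>: "norm (\<phi> u) \<le> 1"
proof -
  have "norm (\<phi> u) = exp (-u) * norm (S (nat \<lfloor>exp u\<rfloor>))" by (simp add: \<phi>_def norm_mult)
  also have "\<dots> \<le> exp (-u) * exp u" by (intro mult_left_mono order.trans[OF norm_S nat_floor_exp(1)]) auto
  finally show ?thesis by (simp add: exp_minus)
qed

lemma \<phi>_measurable [measurable]: "\<phi> \<in> borel_measurable borel" unfolding \<phi>_def by measurable

text \<open>The Tauberian condition. Coefficients of modulus at most 1 let \<open>S\<close> change
  by at most \<open>exp x - exp y + 1\<close>; the 1 is due to rounding and yields the term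
  \<open>exp (- x)\<close>.\<close>

lemma slowly_varying: "norm (\<phi> x - \<phi> y) \<le> 2 * \<bar>x - y\<bar> + exp (- x)"
proof -
  have *: "norm (\<phi> x - \<phi> y) \<le> 2 * (x - y) + exp (- x)" if "y \<le> x" for x y
  proof -
    define j k where "j = nat \<lfloor>exp y\<rfloor>" and "k = nat \<lfloor>exp x\<rfloor>"
    have jk: "j \<le> k" unfolding j_def k_def using that by (intro nat_mono floor_mono) simp
    have "norm (S k - S j) \<le> exp x - exp y + 1"
      using norm_S_diff[OF jk] nat_floor_exp(1)[of x] nat_floor_exp(2)[of y] unfolding j_def[symmetric] k_def[symmetric] by linarith
    then have 1: "exp (-x) * norm (S k - S j) \<le> exp (-x) * (exp x - exp y + 1)" by (intro mult_left_mono) auto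
    have "norm (S j) \<le> exp y" using norm_S[of j] nat_floor_exp(1)[of y] unfolding j_def[symmetric] by linarith
    then have 2: "(exp (-y) - exp (-x)) * norm (S j) \<le> (exp (-y) - exp (-x)) * exp y" using that by (intro mult_left_mono) auto
    have "\<phi> x - \<phi> y = of_real (exp (-x)) * (S k - S j) + of_real (exp (-x) - exp (-y)) * S j"
      unfolding \<phi>_def j_def[symmetric] k_def[symmetric] by (simp add: algebra_simps)
    then have "norm (\<phi> x - \<phi> y) \<le> norm (of_real (exp (-x)) * (S k - S j)) + norm (of_real (exp (-x) - exp (-y)) * S j)"
      by (simp only: norm_triangle_ineq)
    also have "\<dots> = exp (-x) * norm (S k - S j) + (exp (-y) - exp (-x)) * norm (S j)"
      using that by (simp add: norm_mult del: of_real_diff)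
    also have "\<dots> \<le> exp (-x) * (exp x - exp y + 1) + (exp (-y) - exp (-x)) * exp y" using 1 2 by (rule add_mono)
    also have "\<dots> = 2 * (1 - exp (y - x)) + exp (-x)" by (simp add: algebra_simps exp_add[symmetric] exp_diff exp_minus divide_inverse)
    also have "\<dots> \<le> 2 * (x - y) + exp (-x)" using exp_ge_add_one_self[of "y - x"] unfolding right_diff_distrib by linarith
    finally show ?thesis .
  qed
  show ?thesis
  proof (cases "y \<le> x")
    case True then show ?thesis using *[OF True] by simp
  next
    case False
    then have "norm (\<phi> y - \<phi> x) \<le> 2 * (y - x) + exp (- y)" using * by simp
    moreover have "exp (-y) \<le> exp (-x)" using False by simp
    moreover have "\<bar>x - y\<bar> = y - x" using False by simp
    ultimately show ?thesis unfolding norm_minus_commute[of "\<phi> x"] by (simp only:)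
  qed
qed

text \<open>Partial summation in integral form: the coefficient at \<open>n + 1\<close> is counted
  by \<open>S\<close> from \<open>u = ln (n + 1)\<close> on, and integrating
  \<open>exp (- (1 + s) * u)\<close> over this half-line gives its term in \<open>Gh s\<close>.
  Absolute convergence permits the interchange.\<close>

lemma laplace:
  assumes s: "Re s > 0"
  shows "integrable lborel (\<lambda>u. \<phi> u * exp (- s * of_real u))" "(\<integral>u. \<phi> u * exp (- s * of_real u) \<partial>lborel) = Gh s"
proof -
  have s1: "Re (1 + s) > 0" using s by simp
  define e where "e n u = indicator {ln (real (Suc n))..} u *\<^sub>R exp (- (1 + s) * of_real u)" for n u
  define f where "f n u = a (Suc n) * e n u" for n u
  have e1: "integrable lborel (e n)" "integral\<^sup>L lborel (e n) = exp (- (1 + s) * of_real (ln (real (Suc n)))) / (1 + s)"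
     "integral\<^sup>L lborel (\<lambda>u. norm (e n u)) = exp (- Re (1 + s) * ln (real (Suc n))) / Re (1 + s)" for n
    using exp_tail_integral[OF s1, of "ln (real (Suc n))"] unfolding e_def[symmetric] by (auto simp: has_bochner_integral_iff)
  have fs: "(\<lambda>n. f n u) sums (\<phi> u * exp (- s * of_real u))" and fns: "summable (\<lambda>n. norm (f n u))" for u
  proof -
    define K where "K = nat \<lfloor>exp u\<rfloor>"
    have iff: "ln (real (Suc n)) \<le> u \<longleftrightarrow> n < K" for n
    proof -
      have "ln (real (Suc n)) \<le> u \<longleftrightarrow> real (Suc n) \<le> exp u" by (metis exp_le_cancel_iff exp_ln of_nat_0_less_iff zero_less_Suc)
      also have "\<dots> \<longleftrightarrow> int (Suc n) \<le> \<lfloor>exp u\<rfloor>" by (simp add: le_floor_iff)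
      also have "\<dots> \<longleftrightarrow> n < K" unfolding K_def by linarith
      finally show ?thesis .
    qed
    have f: "f n u = (if n \<in> {..<K} then a (Suc n) * exp (- (1 + s) * of_real u) else 0)" for n
      unfolding f_def e_def using iff[of n] by (simp add: indicator_def)
    have "(\<lambda>n. f n u) sums (\<Sum>n<K. a (Suc n) * exp (- (1 + s) * of_real u))"
      unfolding f by (rule sums_If_finite_set) simp
    also have "(\<Sum>n<K. a (Suc n) * exp (- (1 + s) * of_real u)) = \<phi> u * exp (- s * of_real u)"
      unfolding \<phi>_def S_def K_def[symmetric] sum_distrib_right[symmetric]
      by (simp add: exp_of_real[symmetric] ring_distribs exp_add exp_diff exp_minus field_simps)
    finally show "(\<lambda>n. f n u) sums (\<phi> u * exp (- s * of_real u))" .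
    show "summable (\<lambda>n. norm (f n u))" by (rule summable_finite[of "{..<K}"]) (auto simp: f)
  qed
  have int: "integrable lborel (f n)" for n unfolding f_def by (intro integrable_mult_right e1)
  have sm: "summable (\<lambda>n. \<integral>u. norm (f n u) \<partial>lborel)"
  proof (rule summable_comparison_test')
    have "summable (\<lambda>n. real n powr (- Re (1 + s)))" using s by (subst summable_real_powr_iff) simp
    then have "summable (\<lambda>n. real (Suc n) powr (- Re (1 + s)))" by (subst summable_Suc_iff)
    then show "summable (\<lambda>n. real (Suc n) powr (- Re (1 + s)) / Re (1 + s))" by (rule summable_divide)
    fix n
    have "(\<integral>u. norm (f n u) \<partial>lborel) = norm (a (Suc n)) * (exp (- Re (1 + s) * ln (real (Suc n))) / Re (1 + s))"
      unfolding f_def norm_mult e1(3)[symmetric] by simp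
    also have "\<dots> \<le> 1 * (exp (- Re (1 + s) * ln (real (Suc n))) / Re (1 + s))" using s by (intro mult_right_mono bd) auto
    finally show "norm (\<integral>u. norm (f n u) \<partial>lborel) \<le> real (Suc n) powr (- Re (1 + s)) / Re (1 + s)"
      by (simp add: powr_def)
  qed
  have eq: "(\<lambda>u. \<Sum>n. f n u) = (\<lambda>u. \<phi> u * exp (- s * of_real u))" using sums_unique[OF fs] by auto
  show "integrable lborel (\<lambda>u. \<phi> u * exp (- s * of_real u))"
    using integrable_suminf[OF int _ sm] fns unfolding eq by simp
  have "(\<lambda>n. integral\<^sup>L lborel (f n)) sums (\<integral>u. \<phi> u * exp (- s * of_real u) \<partial>lborel)"
    using sums_integral[OF int _ sm] fns unfolding eq by simp
  moreover have "integral\<^sup>L lborel (f n) = a (Suc n) * of_nat (Suc n) powr (- (1 + s)) / (1 + s)" for n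
  proof -
    have "Ln (of_nat (Suc n)) = of_real (ln (real (Suc n)))" by (metis Ln_of_nat of_nat_0_less_iff zero_less_Suc nat.distinct(1))
    then have "of_nat (Suc n) powr (- (1 + s)) = exp (- (1 + s) * of_real (ln (real (Suc n))))"
      unfolding powr_def using of_nat_neq_0[of n] by (simp del: of_nat_Suc)
    then show ?thesis unfolding f_def by (simp add: e1 del: of_nat_Suc)
  qed
  moreover have "(\<lambda>n. a (Suc n) * of_nat (Suc n) powr (- (1 + s)) / (1 + s)) sums (G (1 + s) / (1 + s))"
    using ser[of "1 + s"] s by (intro sums_divide) simp
  ultimately show "(\<integral>u. \<phi> u * exp (- s * of_real u) \<partial>lborel) = Gh s" unfolding Gh_def using sums_unique2 by simp
qed

text \<open>
  The convolution of \<open>\<phi>\<close> with the Fejer kernel is the Fourier transform of a continuous function of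
  compact support, because the Fourier transform of the kernel is the tent function.
\<close>

lemma smoothed_eps:
  assumes \<epsilon>: "\<epsilon> > 0"
  shows "(\<integral>u. \<phi> u * of_real (exp (- \<epsilon> * u)) * of_real (fejer (l * (x - u))) \<partial>lborel)
    = (\<integral>t. of_real (tent t) * exp (\<i> * of_real (t * (l * x))) * Gh (Complex \<epsilon> (l * t)) \<partial>lborel)"
proof -
  define f where "f u t = \<phi> u * of_real (exp (- \<epsilon> * u)) * (of_real (tent t) * exp (\<i> * of_real (t * (l * (x - u)))))" for u t
  have ig: "integrable lborel (\<lambda>u. \<phi> u * of_real (exp (- \<epsilon> * u)))"
    using laplace(1)[of "of_real \<epsilon>"] \<epsilon> by (simp add: exp_of_real[symmetric])
  have "integrable (lborel \<Otimes>\<^sub>M lborel) (case_prod f)"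
  proof (rule lborel_pair.Fubini_integrable)
    show "case_prod f \<in> borel_measurable (lborel \<Otimes>\<^sub>M lborel)" unfolding f_def by measurable
    have "(\<lambda>u. \<integral>t. norm (case_prod f (u, t)) \<partial>lborel) = (\<lambda>u. norm (\<phi> u * of_real (exp (- \<epsilon> * u))) * integral\<^sup>L lborel tent)"
      by (auto simp: f_def norm_mult tent_bounds)
    then show "integrable lborel (\<lambda>u. \<integral>t. norm (case_prod f (u, t)) \<partial>lborel)"
      using integrable_norm[OF ig] by simp
    show "AE u in lborel. integrable lborel (\<lambda>t. case_prod f (u, t))"
      unfolding f_def prod.case by (intro AE_I2 integrable_mult_right integrable.intros[OF tent_fourier])
  qed
  then have "(\<integral>t. (\<integral>u. f u t \<partial>lborel) \<partial>lborel) = (\<integral>u. (\<integral>t. f u t \<partial>lborel) \<partial>lborel)"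
    by (rule lborel_pair.Fubini_integral)
  moreover have "(\<integral>t. f u t \<partial>lborel) = \<phi> u * of_real (exp (- \<epsilon> * u)) * of_real (fejer (l * (x - u)))" for u
    unfolding f_def using has_bochner_integral_integral_eq[OF tent_fourier[of "l * (x - u)"]] by simp
  moreover have "(\<integral>u. f u t \<partial>lborel) = of_real (tent t) * exp (\<i> * of_real (t * (l * x))) * Gh (Complex \<epsilon> (l * t))" for t
  proof -
    have "f u t = of_real (tent t) * exp (\<i> * of_real (t * (l * x))) * (\<phi> u * exp (- Complex \<epsilon> (l * t) * of_real u))" for u
    proof -
      have "of_real (exp (- \<epsilon> * u)) * exp (\<i> * of_real (t * (l * (x - u)))) = exp (\<i> * of_real (t * (l * x))) * exp (- Complex \<epsilon> (l * t) * of_real u)"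
        unfolding exp_of_real[symmetric] exp_add[symmetric] by (simp add: Complex_eq algebra_simps)
      then show ?thesis unfolding f_def by (simp only: mult_ac)
    qed
    then show ?thesis using laplace(2)[of "Complex \<epsilon> (l * t)"] \<epsilon> by simp
  qed
  ultimately show ?thesis by simp
qed

lemma continuous_Gh: "continuous_on {s. Re s \<ge> 0} Gh"
  unfolding Gh_def
proof (intro continuous_intros)
  show "continuous_on {s. 0 \<le> Re s} (\<lambda>s. G (1 + s))"
    by (rule continuous_on_compose2[OF contG]) (auto intro!: continuous_intros)
  show "\<forall>s\<in>{s. 0 \<le> Re s}. 1 + s \<noteq> 0" by (auto simp: complex_eq_iff)
qed

lemma continuous_Gh_line: "\<epsilon> \<ge> 0 \<Longrightarrow> continuous_on UNIV (\<lambda>t. Gh (Complex \<epsilon> (l * t)))"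
  by (rule continuous_on_compose2[OF continuous_Gh]) (auto simp: Complex_eq intro!: continuous_intros)

text \<open>Passage to the boundary. On the left the kernel dominates, as \<open>\<phi>\<close> is
  bounded; on the right the tent confines \<open>t\<close> to \<open>[-1, 1]\<close>, so that only
  values of \<open>Gh\<close> on a compact rectangle in the closed half-plane occur.\<close>

lemma smoothed:
  assumes l: "l > 0"
  shows "(\<integral>u. \<phi> u * of_real (fejer (l * (x - u))) \<partial>lborel)
    = (\<integral>t. of_real (tent t) * Gh (Complex 0 (l * t)) * exp (\<i> * of_real (t * (l * x))) \<partial>lborel)"
proof -
  define \<epsilon> where "\<epsilon> j = 1 / real (Suc j)" for j
  have \<epsilon>: "\<epsilon> j > 0" "\<epsilon> j \<le> 1" for j by (auto simp: \<epsilon>_def)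
  have \<epsilon>0: "\<epsilon> \<longlonglongrightarrow> 0" unfolding \<epsilon>_def using LIMSEQ_inverse_real_of_nat by (simp add: inverse_eq_divide)
  have fi: "integrable lborel (\<lambda>u. fejer (l * (x - u)))"
    using lborel_integrable_real_affine[OF integrable_fejer, of "-l" "l * x"] l by (simp add: algebra_simps)
  have "(\<lambda>j. \<integral>u. \<phi> u * of_real (exp (- \<epsilon> j * u)) * of_real (fejer (l * (x - u))) \<partial>lborel) \<longlonglongrightarrow> (\<integral>u. \<phi> u * of_real (fejer (l * (x - u))) \<partial>lborel)"
  proof (rule integral_dominated_convergence[OF _ _ fi])
    show "AE u in lborel. (\<lambda>j. \<phi> u * of_real (exp (- \<epsilon> j * u)) * of_real (fejer (l * (x - u)))) \<longlonglongrightarrow> \<phi> u * of_real (fejer (l * (x - u)))"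
    proof (rule AE_I2)
      fix u
      have "(\<lambda>j. \<phi> u * of_real (exp (- \<epsilon> j * u)) * of_real (fejer (l * (x - u)))) \<longlonglongrightarrow> \<phi> u * of_real (exp (- 0 * u)) * of_real (fejer (l * (x - u)))"
        by (intro tendsto_intros \<epsilon>0)
      then show "(\<lambda>j. \<phi> u * of_real (exp (- \<epsilon> j * u)) * of_real (fejer (l * (x - u)))) \<longlonglongrightarrow> \<phi> u * of_real (fejer (l * (x - u)))" by simp
    qed
    show "AE u in lborel. norm (\<phi> u * of_real (exp (- \<epsilon> j * u)) * of_real (fejer (l * (x - u)))) \<le> fejer (l * (x - u))" for j
    proof (rule AE_I2)
      fix u
      have "norm (\<phi> u) * exp (- \<epsilon> j * u) \<le> 1"
      proof (cases "u < 0")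
        case True
        \<comment> \<open>For negative \<open>u\<close>, where the damping factor exceeds 1,
          \<open>\<phi>\<close> vanishes.\<close>
        then have "nat \<lfloor>exp u\<rfloor> = 0" using exp_less_one_iff[of u] by (simp add: floor_less_one floor_le_zero)
        then show ?thesis by (simp add: \<phi>_def S_def)
      next
        case False
        then have "exp (- \<epsilon> j * u) \<le> 1" using \<epsilon>(1)[of j] by simp
        then show ?thesis using norm_\<phi>[of u] by (intro mult_le_one) auto
      qed
      then have "(norm (\<phi> u) * exp (- \<epsilon> j * u)) * fejer (l * (x - u)) \<le> 1 * fejer (l * (x - u))" by (intro mult_right_mono fejer_nonneg)
      then show "norm (\<phi> u * of_real (exp (- \<epsilon> j * u)) * of_real (fejer (l * (x - u)))) \<le> fejer (l * (x - u))"
        by (simp add: norm_mult fejer_nonneg)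
    qed
  qed auto
  moreover have "(\<lambda>j. \<integral>t. of_real (tent t) * exp (\<i> * of_real (t * (l * x))) * Gh (Complex (\<epsilon> j) (l * t)) \<partial>lborel)
    \<longlonglongrightarrow> (\<integral>t. of_real (tent t) * exp (\<i> * of_real (t * (l * x))) * Gh (Complex 0 (l * t)) \<partial>lborel)"
  proof -
    define B where "B = (\<lambda>(e, t). Complex e (l * t)) ` ({0..1} \<times> {-1..1::real})"
    have "compact B" unfolding B_def
      by (intro compact_continuous_image compact_Times) (auto simp: case_prod_unfold Complex_eq intro!: continuous_intros)
    moreover have "B \<subseteq> {s. Re s \<ge> 0}" by (auto simp: B_def)
    ultimately have "compact (Gh ` B)" by (intro compact_continuous_image continuous_on_subset[OF continuous_Gh])
    then obtain C where C: "\<And>s. s \<in> B \<Longrightarrow> norm (Gh s) \<le> C" using compact_imp_bounded bounded_iff by (metis imageI)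
    show ?thesis
    proof (rule integral_dominated_convergence[where w = "\<lambda>t. C * tent t"])
      show "integrable lborel (\<lambda>t. C * tent t)" by (intro integrable_mult_right integrable_tent)
      have [measurable]: "(\<lambda>t. Gh (Complex e (l * t))) \<in> borel_measurable borel" if "e \<ge> 0" for e
        using continuous_Gh_line[OF that] by (rule borel_measurable_continuous_onI)
      show "(\<lambda>t. of_real (tent t) * exp (\<i> * of_real (t * (l * x))) * Gh (Complex 0 (l * t))) \<in> borel_measurable lborel" by measurable
      show "(\<lambda>t. of_real (tent t) * exp (\<i> * of_real (t * (l * x))) * Gh (Complex (\<epsilon> j) (l * t))) \<in> borel_measurable lborel" for j
        using \<epsilon>(1)[of j] by (intro borel_measurable_times) (auto intro: less_imp_le)
      show "AE t in lborel. (\<lambda>j. of_real (tent t) * exp (\<i> * of_real (t * (l * x))) * Gh (Complex (\<epsilon> j) (l * t)))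
         \<longlonglongrightarrow> of_real (tent t) * exp (\<i> * of_real (t * (l * x))) * Gh (Complex 0 (l * t))"
      proof (rule AE_I2, intro tendsto_intros)
        fix t
        show "(\<lambda>j. Gh (Complex (\<epsilon> j) (l * t))) \<longlonglongrightarrow> Gh (Complex 0 (l * t))"
          by (rule continuous_on_tendsto_compose[OF continuous_Gh]) (use \<epsilon>(1) in \<open>auto intro!: tendsto_Complex \<epsilon>0 tendsto_const simp: less_imp_le\<close>)
      qed
      show "AE t in lborel. norm (of_real (tent t) * exp (\<i> * of_real (t * (l * x))) * Gh (Complex (\<epsilon> j) (l * t))) \<le> C * tent t" for j
      proof (rule AE_I2)
        fix t
        show "norm (of_real (tent t) * exp (\<i> * of_real (t * (l * x))) * Gh (Complex (\<epsilon> j) (l * t))) \<le> C * tent t"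
        proof (cases "\<bar>t\<bar> \<le> 1")
          case True
          then have "Complex (\<epsilon> j) (l * t) \<in> B" unfolding B_def using \<epsilon>[of j] by (force intro: less_imp_le)
          then have "norm (Gh (Complex (\<epsilon> j) (l * t))) \<le> C" by (rule C)
          then have "tent t * norm (Gh (Complex (\<epsilon> j) (l * t))) \<le> tent t * C" by (intro mult_left_mono tent_bounds(1))
          then show ?thesis using tent_bounds(1)[of t] by (simp add: norm_mult mult.commute)
        qed (simp add: tent_def)
      qed
    qed
  qed
  ultimately show ?thesis unfolding smoothed_eps[OF \<epsilon>(1)] using LIMSEQ_unique by (auto simp: mult_ac)
qed

lemma smoothed_tendsto:
  assumes l: "l > 0"
  shows "((\<lambda>x. \<integral>v. \<phi> (x - v / l) * of_real (fejer v) \<partial>lborel) \<longlongrightarrow> 0) at_top"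
proof -
  have "((\<lambda>y. \<integral>t. of_real (tent t) * Gh (Complex 0 (l * t)) * exp (\<i> * of_real (t * y)) \<partial>lborel) \<longlongrightarrow> 0) at_top"
    by (rule riemann_lebesgue) (auto intro!: continuous_intros continuous_Gh_line simp: tent_def)
  then have "((\<lambda>x. \<integral>t. of_real (tent t) * Gh (Complex 0 (l * t)) * exp (\<i> * of_real (t * (l * x))) \<partial>lborel) \<longlongrightarrow> 0) at_top"
    by (rule filterlim_compose) (rule filterlim_tendsto_pos_mult_at_top[OF tendsto_const l filterlim_ident])
  then have "((\<lambda>x. of_real l * (\<integral>u. \<phi> u * of_real (fejer (l * (x - u))) \<partial>lborel)) \<longlongrightarrow> of_real l * 0) at_top"
    unfolding smoothed[OF l] by (intro tendsto_intros)
  moreover have "of_real l * (\<integral>u. \<phi> u * of_real (fejer (l * (x - u))) \<partial>lborel) = (\<integral>v. \<phi> (x - v / l) * of_real (fejer v) \<partial>lborel)" for x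
    by (subst lborel_integral_real_affine[of "-1/l" _ x]) (use l in \<open>auto simp: scaleR_conv_of_real\<close>)
  ultimately show ?thesis by simp
qed

text \<open>For a fixed width \<open>1 / l\<close> the average of \<open>\<phi>\<close> against the
  kernel tends to 0. As \<open>\<phi>\<close> varies slowly, it is close to its average over a
  narrow kernel, so \<open>l\<close> is first taken large and then \<open>x\<close>.\<close>

lemma \<phi>_tendsto: "(\<phi> \<longlongrightarrow> 0) at_top"
proof (rule tendstoI)
  fix \<epsilon> :: real assume \<epsilon>: "\<epsilon> > 0"
  define c where "c = integral\<^sup>L lborel fejer"
  have c: "c > 0" unfolding c_def by (rule integral_fejer_pos)
  \<comment> \<open>The minimum with 2, which comes from \<open>norm_\<phi>\<close>, is essential:
    \<open>\<bar>v\<bar> * fejer v\<close> decays only like \<open>1 / \<bar>v\<bar>\<close> and is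
    not integrable.\<close>
  define W where "W l = (\<integral>v. min 2 (2 * \<bar>v\<bar> / l) * fejer v \<partial>lborel)" for l :: real
  have Wi: "integrable lborel (\<lambda>v. min 2 (2 * \<bar>v\<bar> / l) * fejer v)" if "l > 0" for l
  proof (rule Bochner_Integration.integrable_bound[OF integrable_mult_right[OF integrable_fejer, of 2]])
    show "AE v in lborel. norm (min 2 (2 * \<bar>v\<bar> / l) * fejer v) \<le> norm (2 * fejer v)"
      using fejer_nonneg that by (auto simp: abs_mult intro!: mult_right_mono)
  qed auto
  have "(W \<longlongrightarrow> integral\<^sup>L lborel (\<lambda>v::real. 0::real)) at_top" unfolding W_def
  proof (rule integral_dominated_convergence_at_top[where s = "\<lambda>l v. min 2 (2 * \<bar>v\<bar> / l) * fejer v" and f = "\<lambda>_. 0" and w = "\<lambda>v. 2 * fejer v"])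
    show "integrable lborel (\<lambda>v. 2 * fejer v)" by (intro integrable_mult_right integrable_fejer)
    show "AE v in lborel. ((\<lambda>l. min 2 (2 * \<bar>v\<bar> / l) * fejer v) \<longlongrightarrow> 0) at_top"
    proof (rule AE_I2)
      fix v :: real
      have "((\<lambda>l. min 2 (2 * \<bar>v\<bar> / l) * fejer v) \<longlongrightarrow> min 2 0 * fejer v) at_top"
        by (intro tendsto_mult tendsto_min tendsto_const tendsto_divide_0[OF tendsto_const] filterlim_at_top_imp_at_infinity filterlim_ident)
      then show "((\<lambda>l. min 2 (2 * \<bar>v\<bar> / l) * fejer v) \<longlongrightarrow> 0) at_top" by simp
    qed
    show "\<forall>\<^sub>F l in at_top. AE v in lborel. norm (min 2 (2 * \<bar>v\<bar> / l) * fejer v) \<le> 2 * fejer v"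
      using eventually_gt_at_top[of "0::real"]
      by eventually_elim (use fejer_nonneg in \<open>auto simp: abs_mult intro!: mult_right_mono\<close>)
  qed auto
  then have "(W \<longlongrightarrow> 0) at_top" by simp
  then have "\<forall>\<^sub>F l in at_top. W l < \<epsilon> * c / 3" using \<epsilon> c by (intro order_tendstoD(2)) auto
  then have "\<forall>\<^sub>F l in at_top. W l < \<epsilon> * c / 3 \<and> l > 0" using eventually_gt_at_top[of "0::real"] by eventually_elim auto
  then obtain l where l: "W l < \<epsilon> * c / 3" "l > 0" using eventually_happens[of _ "at_top :: real filter"] by auto
  define K where "K x = (\<integral>v. \<phi> (x - v / l) * of_real (fejer v) \<partial>lborel)" for x
  have Kb: "c * norm (\<phi> x) \<le> norm (K x) + (W l + exp (-x) * c)" for x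
  proof -
    have fc: "integrable lborel (\<lambda>v. complex_of_real (fejer v))" using integrable_fejer by simp
    have i1: "integrable lborel (\<lambda>v. \<phi> x * of_real (fejer v))" by (intro integrable_mult_right fc)
    have i2: "integrable lborel (\<lambda>v. \<phi> (x - v / l) * of_real (fejer v))"
      by (rule Bochner_Integration.integrable_bound[OF integrable_fejer])
        (use norm_\<phi> in \<open>auto simp: norm_mult fejer_nonneg intro!: mult_left_le_one_le\<close>)
    have "of_real c * \<phi> x = (\<integral>v. \<phi> x * of_real (fejer v) \<partial>lborel)" by (simp add: c_def mult.commute)
    then have "of_real c * \<phi> x = K x + (\<integral>v. \<phi> x * of_real (fejer v) - \<phi> (x - v / l) * of_real (fejer v) \<partial>lborel)"
      using Bochner_Integration.integral_diff[OF i1 i2] by (simp add: K_def)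
    then have "norm (of_real c * \<phi> x) \<le> norm (K x) + norm (\<integral>v. \<phi> x * of_real (fejer v) - \<phi> (x - v / l) * of_real (fejer v) \<partial>lborel)"
      by (simp only: norm_triangle_ineq)
    also have "norm (\<integral>v. \<phi> x * of_real (fejer v) - \<phi> (x - v / l) * of_real (fejer v) \<partial>lborel)
       \<le> (\<integral>v. norm (\<phi> x * of_real (fejer v) - \<phi> (x - v / l) * of_real (fejer v)) \<partial>lborel)" by (rule integral_norm_bound)
    also have "\<dots> \<le> (\<integral>v. min 2 (2 * \<bar>v\<bar> / l) * fejer v + exp (-x) * fejer v \<partial>lborel)"
    proof (rule integral_mono)
      show "integrable lborel (\<lambda>v. norm (\<phi> x * of_real (fejer v) - \<phi> (x - v / l) * of_real (fejer v)))"
        by (intro integrable_norm Bochner_Integration.integrable_diff i1 i2)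
      show "integrable lborel (\<lambda>v. min 2 (2 * \<bar>v\<bar> / l) * fejer v + exp (-x) * fejer v)"
        by (intro Bochner_Integration.integrable_add Wi l integrable_mult_right integrable_fejer)
      fix v
      have "norm (\<phi> x - \<phi> (x - v / l)) \<le> min 2 (2 * \<bar>v\<bar> / l) + exp (-x)"
      proof -
        have "norm (\<phi> x - \<phi> (x - v / l)) \<le> 2 * \<bar>v\<bar> / l + exp (-x)" using slowly_varying[of x "x - v / l"] l by simp
        moreover have "norm (\<phi> x - \<phi> (x - v / l)) \<le> 2"
          using norm_triangle_ineq4[of "\<phi> x" "\<phi> (x - v / l)"] norm_\<phi>[of x] norm_\<phi>[of "x - v / l"] by linarith
        moreover have "0 \<le> exp (-x)" by simp
        ultimately show ?thesis unfolding min_def by (auto intro: order.trans)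
      qed
      then have "norm (\<phi> x - \<phi> (x - v / l)) * fejer v \<le> (min 2 (2 * \<bar>v\<bar> / l) + exp (-x)) * fejer v" by (intro mult_right_mono fejer_nonneg)
      moreover have "norm (\<phi> x * of_real (fejer v) - \<phi> (x - v / l) * of_real (fejer v)) = norm (\<phi> x - \<phi> (x - v / l)) * fejer v"
        unfolding left_diff_distrib[symmetric] norm_mult by (simp add: fejer_nonneg)
      ultimately show "norm (\<phi> x * of_real (fejer v) - \<phi> (x - v / l) * of_real (fejer v)) \<le> min 2 (2 * \<bar>v\<bar> / l) * fejer v + exp (-x) * fejer v"
        by (simp only: distrib_right)
    qed
    also have "\<dots> = W l + exp (-x) * c" unfolding W_def c_def
      using Bochner_Integration.integral_add[OF Wi[OF l(2)] integrable_mult_right[OF integrable_fejer, of "exp (-x)"]] by simp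
    finally show ?thesis using c by (simp add: norm_mult)
  qed
  have "(K \<longlongrightarrow> 0) at_top" unfolding K_def by (rule smoothed_tendsto[OF l(2)])
  then have "\<forall>\<^sub>F x in at_top. dist (K x) 0 < \<epsilon> * c / 3" using \<epsilon> c by (intro tendstoD) auto
  moreover have "((\<lambda>x::real. exp (-x)) \<longlongrightarrow> 0) at_top" by (rule filterlim_compose[OF exp_at_bot filterlim_uminus_at_bot_at_top])
  then have "\<forall>\<^sub>F x::real in at_top. exp (-x) < \<epsilon> / 3" using \<epsilon> by (intro order_tendstoD(2)) auto
  ultimately show "\<forall>\<^sub>F x in at_top. dist (\<phi> x) 0 < \<epsilon>"
  proof eventually_elim
    case (elim x)
    have "exp (-x) * c < \<epsilon> / 3 * c" using elim(2) c by (intro mult_strict_right_mono)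
    then have "c * norm (\<phi> x) < \<epsilon> * c" using Kb[of x] elim(1) l(1) unfolding dist_norm diff_0_right by linarith
    then show ?case using c by (simp add: dist_norm)
  qed
qed

theorem mean_tendsto: "(\<lambda>N. (\<Sum>n<N. a n) / of_nat N) \<longlonglongrightarrow> 0"
proof -
  have "(\<lambda>N. \<phi> (ln (real N))) \<longlonglongrightarrow> 0"
    by (rule filterlim_compose[OF \<phi>_tendsto filterlim_compose[OF ln_at_top filterlim_real_sequentially]])
  then have l1: "(\<lambda>N. S N / of_nat N) \<longlonglongrightarrow> 0"
  proof (rule Lim_transform_eventually)
    show "\<forall>\<^sub>F N in sequentially. \<phi> (ln (real N)) = S N / of_nat N"
      using eventually_gt_at_top[of 0] by eventually_elim (simp add: \<phi>_def exp_minus field_simps)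
  qed
  \<comment> \<open>\<open>S N\<close> sums the indices from 1 to \<open>N\<close>, the claim those
    from 0 to \<open>N - 1\<close>.\<close>
  have l2: "(\<lambda>N. (a 0 - a N) / of_nat N) \<longlonglongrightarrow> 0"
  proof (rule Lim_null_comparison)
    show "\<forall>\<^sub>F N in sequentially. norm ((a 0 - a N) / of_nat N) \<le> 2 / real N"
    proof (rule always_eventually, rule allI)
      fix N
      have "norm (a 0 - a N) \<le> 2" using norm_triangle_ineq4[of "a 0" "a N"] bd[of 0] bd[of N] by linarith
      then show "norm ((a 0 - a N) / of_nat N) \<le> 2 / real N" by (simp add: norm_divide divide_right_mono)
    qed
    show "(\<lambda>N. 2 / real N) \<longlonglongrightarrow> 0" by (rule lim_const_over_n)
  qed
  have "(\<Sum>n<N. a n) = S N + (a 0 - a N)" for N unfolding S_def by (induction N) auto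
  then show ?thesis using tendsto_add[OF l1 l2] by (simp add: add_divide_distrib)
qed

end

section \<open>Dirichlet series near the line of abscissa 1\<close>

lemma norm_of_real_powr: "x > 0 \<Longrightarrow> norm (complex_of_real x powr w) = x powr Re w"
  by (simp add: norm_powr_real_powr)

lemma powr_diff_bound:
  fixes x y :: real and s :: complex
  assumes xy: "0 < x" "x \<le> y" "y \<le> x + 1" and s: "Re s \<ge> 0"
  shows "norm (of_real y powr (-s) - of_real x powr (-s)) \<le> norm s * x powr (- Re s - 1)"
proof -
  define S where "S = closed_segment (complex_of_real x) (complex_of_real y)"
  have S: "\<exists>t. z = of_real t \<and> x \<le> t \<and> t \<le> y" if "z \<in> S" for z
    using that xy unfolding S_def closed_segment_of_real by (auto simp: closed_segment_eq_real_ivl)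
  have "norm (of_real y powr (-s) - of_real x powr (-s)) \<le> (norm s * x powr (- Re s - 1)) * norm (of_real y - complex_of_real x)"
  proof (rule field_differentiable_bound[where S = S])
    fix z assume "z \<in> S"
    then obtain t where t: "z = of_real t" "x \<le> t" "t \<le> y" using S by blast
    have "z \<notin> \<real>\<^sub>\<le>\<^sub>0" using t xy by (auto simp: complex_nonpos_Reals_iff)
    then show "((\<lambda>z. z powr (-s)) has_field_derivative (-s) * z powr (-s - 1)) (at z within S)"
      by (rule has_field_derivative_at_within[OF has_field_derivative_powr])
    have "norm (z powr (-s - 1)) = t powr (- Re s - 1)" unfolding t(1) using t xy by (subst norm_of_real_powr) auto
    also have "\<dots> \<le> x powr (- Re s - 1)" using t xy s by (intro powr_mono2') auto
    finally show "norm ((-s) * z powr (-s - 1)) \<le> norm s * x powr (- Re s - 1)" by (simp add: norm_mult mult_left_mono)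
  qed (auto simp: S_def)
  also have "\<dots> \<le> (norm s * x powr (- Re s - 1)) * 1"
    using xy by (intro mult_left_mono) (auto simp flip: of_real_diff)
  finally show ?thesis by simp
qed

text \<open>The remainder of the first-order expansion of \<open>z powr (1 - s)\<close> at
  \<open>x\<close>: the derivative of \<open>f\<close> contains a difference that
  \<open>powr_diff_bound\<close> controls.\<close>

lemma powr_second_diff_bound:
  fixes x :: real and s :: complex
  assumes x: "0 < x" and s: "Re s \<ge> 0"
  shows "norm (of_real (x + 1) powr (1 - s) - of_real x powr (1 - s) + (s - 1) * of_real x powr (-s)) \<le> norm (1 - s) * norm s * x powr (- Re s - 1)"
proof -
  define S where "S = closed_segment (complex_of_real x) (complex_of_real (x + 1))"
  have S: "\<exists>t. z = of_real t \<and> x \<le> t \<and> t \<le> x + 1" if "z \<in> S" for z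
    using that unfolding S_def closed_segment_of_real by (auto simp: closed_segment_eq_real_ivl)
  define f where "f z = z powr (1 - s) - (z - of_real x) * ((1 - s) * of_real x powr (-s))" for z
  have "norm (f (of_real (x + 1)) - f (of_real x)) \<le> (norm (1 - s) * norm s * x powr (- Re s - 1)) * norm (of_real (x + 1) - complex_of_real x)"
  proof (rule field_differentiable_bound[where S = S])
    fix z assume "z \<in> S"
    then obtain t where t: "z = of_real t" "x \<le> t" "t \<le> x + 1" using S by blast
    have "z \<notin> \<real>\<^sub>\<le>\<^sub>0" using t x by (auto simp: complex_nonpos_Reals_iff)
    then have "(f has_field_derivative ((1 - s) * z powr (1 - s - 1) - 1 * ((1 - s) * of_real x powr (-s)))) (at z)" unfolding f_def
      by (intro derivative_eq_intros has_field_derivative_powr) auto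
    then have "(f has_field_derivative ((1 - s) * (z powr (-s) - of_real x powr (-s)))) (at z)" by (simp add: algebra_simps)
    then show "(f has_field_derivative ((1 - s) * (z powr (-s) - of_real x powr (-s)))) (at z within S)" by (rule has_field_derivative_at_within)
    show "norm ((1 - s) * (z powr (-s) - of_real x powr (-s))) \<le> norm (1 - s) * norm s * x powr (- Re s - 1)"
      unfolding norm_mult mult.assoc t(1) using t x s by (intro mult_left_mono powr_diff_bound) auto
  qed (auto simp: S_def)
  moreover have "norm (of_real (x + 1) - complex_of_real x) = 1" by simp
  moreover have "f (of_real (x + 1)) - f (of_real x) = of_real (x + 1) powr (1 - s) - of_real x powr (1 - s) + (s - 1) * of_real x powr (-s)"
    by (simp add: f_def algebra_simps)
  ultimately show ?thesis by simp
qed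

lemma series_holomorphic:
  fixes f :: "nat \<Rightarrow> complex \<Rightarrow> complex"
  assumes hol: "\<And>n. f n holomorphic_on {s. Re s > 0}"
    and bd: "\<And>K. \<exists>C. \<forall>n s. Re s > 0 \<longrightarrow> norm s \<le> K \<longrightarrow> norm (f n s) \<le> C * real (Suc n) powr (- Re s - 1)"
  shows "(\<lambda>s. \<Sum>n. f n s) holomorphic_on {s. Re s > 0}"
    and "Re s > 0 \<Longrightarrow> summable (\<lambda>n. f n s)"
proof -
  have sm: "summable (\<lambda>n. C * real (Suc n) powr (- d - 1))" if "d > 0" for C d
  proof -
    have "summable (\<lambda>n. real n powr (- d - 1))" using that by (subst summable_real_powr_iff) simp
    then have "summable (\<lambda>n. real (Suc n) powr (- d - 1))" by (subst summable_Suc_iff)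
    then show ?thesis by (rule summable_mult)
  qed
  show "summable (\<lambda>n. f n s)" if s: "Re s > 0"
  proof -
    obtain C where "\<And>n. norm (f n s) \<le> C * real (Suc n) powr (- Re s - 1)" using bd[of "norm s"] s by auto
    then show ?thesis by (intro summable_comparison_test'[OF sm[OF s]]) auto
  qed
  show "(\<lambda>s. \<Sum>n. f n s) holomorphic_on {s. Re s > 0}"
  proof (rule holomorphic_uniform_sequence[where f = "\<lambda>N s. \<Sum>n<N. f n s"])
    show "open {s. Re s > 0}" by (simp add: open_halfspace_Re_gt)
    show "(\<lambda>s. \<Sum>n<N. f n s) holomorphic_on {s. Re s > 0}" for N by (intro holomorphic_intros hol)
    fix s0 :: complex assume "s0 \<in> {s. Re s > 0}"
    then have s0: "Re s0 > 0" by simp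
    define d where "d = Re s0 / 2"
    have d: "d > 0" using s0 by (simp add: d_def)
    have B: "Re s \<ge> d" "norm s \<le> norm s0 + d" if "s \<in> cball s0 d" for s
    proof -
      have n: "norm (s - s0) \<le> d" using that by (simp add: dist_norm norm_minus_commute)
      have "\<bar>Re (s - s0)\<bar> \<le> norm (s - s0)" by (rule abs_Re_le_cmod)
      then have "Re s0 - Re s \<le> d" using n by simp
      then show "Re s \<ge> d" by (simp add: d_def)
      show "norm s \<le> norm s0 + d" using norm_triangle_ineq[of s0 "s - s0"] n by simp
    qed
    obtain C where C: "\<And>n s. Re s > 0 \<Longrightarrow> norm s \<le> norm s0 + d \<Longrightarrow> norm (f n s) \<le> C * real (Suc n) powr (- Re s - 1)" using bd by blast
    have "uniform_limit (cball s0 d) (\<lambda>N s. \<Sum>n<N. f n s) (\<lambda>s. \<Sum>n. f n s) sequentially"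
    proof (rule Weierstrass_m_test[OF _ sm[OF d, of "max C 0"]])
      fix n s assume s: "s \<in> cball s0 d"
      have "norm (f n s) \<le> C * real (Suc n) powr (- Re s - 1)" using B[OF s] d by (intro C) auto
      also have "\<dots> \<le> max C 0 * real (Suc n) powr (- Re s - 1)" by (intro mult_right_mono) auto
      also have "\<dots> \<le> max C 0 * real (Suc n) powr (- d - 1)" using B[OF s] by (intro mult_left_mono powr_mono) auto
      finally show "norm (f n s) \<le> max C 0 * real (Suc n) powr (- d - 1)" .
    qed
    moreover have "cball s0 d \<subseteq> {s. Re s > 0}" using B(1) d by force
    ultimately show "\<exists>d>0. cball s0 d \<subseteq> {s. Re s > 0} \<and> uniform_limit (cball s0 d) (\<lambda>N s. \<Sum>n<N. f n s) (\<lambda>s. \<Sum>n. f n s) sequentially"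
      using d by blast
  qed
qed

lemma Suc_powr_tendsto_0:
  assumes "Re w < 0" shows "(\<lambda>N. complex_of_real (real (Suc N)) powr w) \<longlonglongrightarrow> 0"
proof (rule tendsto_norm_zero_cancel)
  have "((\<lambda>x. x powr Re w) \<longlongrightarrow> 0) at_top" using assms by (intro tendsto_neg_powr filterlim_ident)
  moreover have "filterlim (\<lambda>N. real (Suc N)) at_top sequentially"
    by (rule filterlim_compose[OF filterlim_real_sequentially filterlim_Suc])
  ultimately have "(\<lambda>N. real (Suc N) powr Re w) \<longlonglongrightarrow> 0" by (rule filterlim_compose)
  then show "(\<lambda>N. norm (complex_of_real (real (Suc N)) powr w)) \<longlonglongrightarrow> 0" by (subst norm_of_real_powr) auto
qed

text \<open>Abel summation replaces the powers by their differences, of order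
  \<open>real (Suc n) powr (- Re s - 1)\<close>, so the transformed series converges locally
  uniformly for \<open>Re s > 0\<close>.\<close>

lemma dirichlet_series_bounded_partial_sums:
  fixes b :: "nat \<Rightarrow> complex"
  assumes B: "\<And>k. norm (\<Sum>n<k. b n) \<le> B"
  shows "\<exists>W. W holomorphic_on {s. Re s > 0} \<and> (\<forall>s. Re s > 0 \<longrightarrow> (\<lambda>n. b n * of_real (real (Suc n)) powr (-s)) sums W s)"
proof -
  have B0: "B \<ge> 0" using B[of 0] by simp
  define X where "X k = (\<Sum>n<k. b n)" for k
  define g where "g n s = complex_of_real (real (Suc n)) powr (-s)" for n s
  define f where "f n s = X (Suc n) * (g n s - g (Suc n) s)" for n s
  have gb: "norm (g n s - g (Suc n) s) \<le> norm s * real (Suc n) powr (- Re s - 1)" if "Re s > 0" for n s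
    unfolding g_def using powr_diff_bound[of "real (Suc n)" "real (Suc (Suc n))" s] that by (simp add: norm_minus_commute)
  have bd: "\<exists>C. \<forall>n s. Re s > 0 \<longrightarrow> norm s \<le> K \<longrightarrow> norm (f n s) \<le> C * real (Suc n) powr (- Re s - 1)" for K
  proof (intro exI allI impI)
    fix n s assume s: "Re s > 0" "norm s \<le> K"
    have "norm (X (Suc n)) \<le> B" unfolding X_def by (rule B)
    then have "norm (f n s) \<le> B * (norm s * real (Suc n) powr (- Re s - 1))"
      unfolding f_def norm_mult using B0 gb[OF s(1)] by (intro mult_mono) auto
    also have "\<dots> \<le> B * (K * real (Suc n) powr (- Re s - 1))" using s B0 by (intro mult_left_mono mult_right_mono) auto
    finally show "norm (f n s) \<le> B * K * real (Suc n) powr (- Re s - 1)" by (simp add: mult.assoc)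
  qed
  have hol: "f n holomorphic_on {s. Re s > 0}" for n unfolding f_def g_def by (intro holomorphic_intros)
  have part: "(\<Sum>n<N. b n * g n s) = X N * g N s + (\<Sum>n<N. f n s)" for N s
    by (induction N) (simp_all add: X_def f_def algebra_simps)
  have "(\<lambda>n. b n * g n s) sums (\<Sum>n. f n s)" if s: "Re s > 0" for s
    unfolding sums_def part
  proof -
    have "(\<lambda>N. X N * g N s) \<longlonglongrightarrow> 0"
    proof (rule Lim_null_comparison)
      have "(\<lambda>N. norm (g N s)) \<longlonglongrightarrow> 0" unfolding g_def using Suc_powr_tendsto_0[of "-s"] s by (intro tendsto_norm_zero) auto
      then show "(\<lambda>N. B * norm (g N s)) \<longlonglongrightarrow> 0" using tendsto_mult_right_zero by blast
      show "\<forall>\<^sub>F N in sequentially. norm (X N * g N s) \<le> B * norm (g N s)"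
        using B by (intro always_eventually allI) (auto simp: norm_mult X_def intro!: mult_right_mono)
    qed
    moreover have "(\<lambda>N. \<Sum>n<N. f n s) \<longlonglongrightarrow> (\<Sum>n. f n s)"
      using series_holomorphic(2)[OF hol bd s] by (simp add: summable_LIMSEQ)
    ultimately show "(\<lambda>N. X N * g N s + (\<Sum>n<N. f n s)) \<longlonglongrightarrow> (\<Sum>n. f n s)" using tendsto_add by fastforce
  qed
  then show ?thesis using series_holomorphic(1)[OF hol bd] unfolding g_def by blast
qed

text \<open>For \<open>Re s > 1\<close> the sum of all \<open>V n s\<close> telescopes to
  \<open>(s - 1)\<close> times zeta, minus 1. Being a Taylor remainder, \<open>V n s\<close> is of
  order \<open>real (Suc n) powr (- Re s - 1)\<close>, which carries the convergence down to
  \<open>Re s > 0\<close>; at \<open>s = 1\<close> every \<open>V n\<close> vanishes.\<close>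

lemma zeta_times_pole:
  "\<exists>E. E holomorphic_on {s. Re s > 0} \<and> E 1 = 1 \<and> (\<forall>s. Re s > 1 \<longrightarrow> (\<lambda>n. complex_of_real (real (Suc n)) powr (-s)) sums (E s / (s - 1)))"
proof -
  define V where "V n s = complex_of_real (real (Suc n) + 1) powr (1 - s) - of_real (real (Suc n)) powr (1 - s) + (s - 1) * of_real (real (Suc n)) powr (-s)" for n s
  have bd: "\<exists>C. \<forall>n s. Re s > 0 \<longrightarrow> norm s \<le> K \<longrightarrow> norm (V n s) \<le> C * real (Suc n) powr (- Re s - 1)" for K
  proof (intro exI allI impI)
    fix n s assume s: "Re s > 0" "norm s \<le> K"
    have K: "K \<ge> 0" using s(2) norm_ge_zero order.trans by blast
    have "norm (V n s) \<le> norm (1 - s) * norm s * real (Suc n) powr (- Re s - 1)"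
      unfolding V_def by (rule powr_second_diff_bound) (use s in auto)
    also have "\<dots> \<le> (1 + K) * K * real (Suc n) powr (- Re s - 1)"
      using s K norm_triangle_ineq4[of 1 s] by (intro mult_right_mono mult_mono) auto
    finally show "norm (V n s) \<le> (1 + K) * K * real (Suc n) powr (- Re s - 1)" .
  qed
  have hol: "V n holomorphic_on {s. Re s > 0}" for n unfolding V_def by (intro holomorphic_intros)
  define E where "E s = 1 + (\<Sum>n. V n s)" for s
  have "E holomorphic_on {s. Re s > 0}" unfolding E_def by (intro holomorphic_intros series_holomorphic(1)[OF hol bd])
  moreover have "E 1 = 1"
  proof -
    have "complex_of_real (real (Suc n) + 1) \<noteq> 0" "complex_of_real (real (Suc n)) \<noteq> 0" for n
      unfolding of_real_eq_0_iff by linarith+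
    then have "V n 1 = 0" for n unfolding V_def by (simp del: of_real_add of_nat_Suc of_real_of_nat_eq)
    then show ?thesis by (simp add: E_def)
  qed
  moreover have "(\<lambda>n. complex_of_real (real (Suc n)) powr (-s)) sums (E s / (s - 1))" if s: "Re s > 1" for s
  proof -
    have s1: "s - 1 \<noteq> 0" using s by auto
    have "(\<Sum>n<N. V n s) = of_real (real (Suc N)) powr (1 - s) - 1 + (s - 1) * (\<Sum>n<N. complex_of_real (real (Suc n)) powr (-s))" for N
      by (induction N) (simp_all add: V_def algebra_simps)
    then have eq: "(\<Sum>n<N. complex_of_real (real (Suc n)) powr (-s)) = ((\<Sum>n<N. V n s) - of_real (real (Suc N)) powr (1 - s) + 1) / (s - 1)" for N
      using s1 by (simp add: field_simps)
    have "(\<lambda>N. \<Sum>n<N. V n s) \<longlonglongrightarrow> (\<Sum>n. V n s)" using series_holomorphic(2)[OF hol bd, of s] s by (simp add: summable_LIMSEQ)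
    moreover have "(\<lambda>N. complex_of_real (real (Suc N)) powr (1 - s)) \<longlonglongrightarrow> 0" by (rule Suc_powr_tendsto_0) (use s in simp)
    ultimately have "(\<lambda>N. ((\<Sum>n<N. V n s) - of_real (real (Suc N)) powr (1 - s) + 1) / (s - 1)) \<longlonglongrightarrow> ((\<Sum>n. V n s) - 0 + 1) / (s - 1)"
      using s1 by (intro tendsto_intros)
    then show ?thesis unfolding sums_def eq E_def by (simp add: add.commute)
  qed
  ultimately show ?thesis by blast
qed

section \<open>Non-vanishing at 1 for real characters\<close>

text \<open>Pair the exponents \<open>i\<close> and \<open>n - i\<close> and apply the inequality of
  the means to each pair.\<close>

lemma geometric_sum_ge:
  fixes u :: real assumes u: "u > 0"
  shows "real (Suc n) * u ^ n \<le> (\<Sum>i<Suc n. (u\<^sup>2) ^ i)"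
proof -
  have "2 * (\<Sum>i<Suc n. (u\<^sup>2) ^ i) = (\<Sum>i<Suc n. (u\<^sup>2) ^ i) + (\<Sum>i<Suc n. (u\<^sup>2) ^ (Suc n - Suc i))"
    unfolding sum.nat_diff_reindex by simp
  also have "\<dots> = (\<Sum>i<Suc n. (u ^ i)\<^sup>2 + (u ^ (n - i))\<^sup>2)"
    by (simp add: sum.distrib power_mult[symmetric] mult.commute)
  also have "\<dots> \<ge> (\<Sum>i<Suc n. 2 * u ^ n)"
  proof (rule sum_mono)
    fix i assume "i \<in> {..<Suc n}"
    then have "u ^ i * u ^ (n - i) = u ^ n" by (simp add: power_add[symmetric])
    then show "2 * u ^ n \<le> (u ^ i)\<^sup>2 + (u ^ (n - i))\<^sup>2" using sum_squares_bound[of "u ^ i" "u ^ (n - i)"] by simp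
  qed
  finally show ?thesis by simp
qed

lemma geometric_sum_prod_ge:
  fixes t :: real assumes t: "0 < t" "t < 1"
  shows "real (Suc n) * real (Suc (Suc n)) * t ^ Suc n \<le> (\<Sum>i<Suc n. t ^ i) * (\<Sum>i<Suc (Suc n). t ^ i)"
proof -
  define u where "u = sqrt t"
  have u: "u > 0" "u < 1" "t = u\<^sup>2" using t by (auto simp: u_def)
  have "u ^ (2 * Suc n) \<le> u ^ (n + Suc n)" using u by (intro power_decreasing) auto
  moreover have "t ^ Suc n = u ^ (2 * Suc n)" unfolding u(3) by (simp only: power_mult)
  ultimately have "t ^ Suc n \<le> u ^ n * u ^ Suc n" by (simp only: power_add)
  then have "real (Suc n) * real (Suc (Suc n)) * t ^ Suc n \<le> real (Suc n) * real (Suc (Suc n)) * (u ^ n * u ^ Suc n)"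
    by (rule mult_left_mono) simp
  also have "\<dots> = (real (Suc n) * u ^ n) * (real (Suc (Suc n)) * u ^ Suc n)" by (simp only: mult_ac)
  also have "\<dots> \<le> (\<Sum>i<Suc n. t ^ i) * (\<Sum>i<Suc (Suc n). t ^ i)"
    unfolding u(3) using u by (intro mult_mono geometric_sum_ge sum_nonneg mult_nonneg_nonneg) auto
  finally show ?thesis .
qed

lemma divide_le_one_divide: "M > 0 \<Longrightarrow> Q > 0 \<Longrightarrow> M * T \<le> Q \<Longrightarrow> T / Q \<le> 1 / (M :: real)"
  by (simp add: field_simps)

text \<open>If the sum of \<open>\<psi> n / n\<close> is 0, then \<open>- (1 - t) * f\<close> is the
  sum of \<open>\<psi> (Suc n) * d n\<close>. The weights \<open>d\<close> are non-negative and
  decreasing, by \<open>geometric_sum_prod_ge\<close>, so Abel summation bounds this sum by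
  \<open>B * d 0 = B * (1 - t)\<close>, and the factor \<open>1 - t\<close> cancels.\<close>

lemma monsky_bounded:
  fixes \<psi> :: "nat \<Rightarrow> real" and t :: real
  assumes t: "0 < t" "t < 1" and B: "\<And>k. \<bar>\<Sum>n<k. \<psi> (Suc n)\<bar> \<le> B"
    and zero: "(\<lambda>n. \<psi> (Suc n) / real (Suc n)) sums 0"
    and f: "(\<lambda>n. \<psi> (Suc n) * (t ^ Suc n / (1 - t ^ Suc n))) sums f"
  shows "\<bar>f\<bar> \<le> B"
proof -
  define s where "s n = (\<Sum>i<n. t ^ i)" for n
  have s1: "1 - t ^ n = (1 - t) * s n" for n
    unfolding s_def using sum_gp_strict[of t n] t by simp
  have spos: "s (Suc n) > 0" for n unfolding s_def using t by (intro sum_pos) auto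
  have srec: "s (Suc n) = 1 + t * s n" for n unfolding s_def by (simp add: sum.lessThan_Suc_shift sum_distrib_left del: sum.lessThan_Suc)
  \<comment> \<open>As \<open>s n = (1 - t ^ n) / (1 - t)\<close>, the second term is
    \<open>1 - t\<close> times the corresponding factor of the Lambert series.\<close>
  define d where "d n = 1 / real (Suc n) - t ^ Suc n / s (Suc n)" for n
  have d0: "d n \<ge> 0" for n
  proof -
    have "real (Suc n) * t ^ Suc n = (\<Sum>i<Suc n. t ^ Suc n)" by simp
    also have "\<dots> \<le> s (Suc n)" unfolding s_def using t by (intro sum_mono power_decreasing) auto
    finally show ?thesis unfolding d_def using spos[of n] by (simp add: field_simps)
  qed
  have dec: "d (Suc n) \<le> d n" for n
  proof -
    define x y where "x = s (Suc n)" and "y = s (Suc (Suc n))"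
    have xy: "x > 0" "y > 0" "y = 1 + t * x" using spos srec unfolding x_def y_def by blast+
    have "real (Suc n) * real (Suc (Suc n)) * t ^ Suc n \<le> x * y"
      unfolding x_def y_def s_def by (rule geometric_sum_prod_ge[OF t])
    then have "t ^ Suc n / (x * y) \<le> 1 / (real (Suc n) * real (Suc (Suc n)))" by (intro divide_le_one_divide) (use xy in auto)
    moreover have "t ^ Suc n / x - t ^ Suc (Suc n) / y = t ^ Suc n / (x * y)"
    proof -
      have "t ^ Suc n / x - t ^ Suc (Suc n) / y = t ^ Suc n * (y - t * x) / (x * y)" using xy(1,2) by (simp add: field_simps)
      then show ?thesis using xy(3) by simp
    qed
    moreover have "1 / real (Suc n) - 1 / real (Suc (Suc n)) = 1 / (real (Suc n) * real (Suc (Suc n)))" by (simp add: field_simps)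
    ultimately show ?thesis unfolding d_def x_def[symmetric] y_def[symmetric] by linarith
  qed
  define X where "X k = (\<Sum>n<k. \<psi> (Suc n))" for k
  have part: "(\<Sum>n<N. \<psi> (Suc n) * d n) = X N * d N + (\<Sum>n<N. X (Suc n) * (d n - d (Suc n)))" for N
    by (induction N) (simp_all add: X_def algebra_simps)
  have bnd: "\<bar>\<Sum>n<N. \<psi> (Suc n) * d n\<bar> \<le> B * (1 - t)" for N
  proof -
    have "\<bar>\<Sum>n<N. \<psi> (Suc n) * d n\<bar> \<le> \<bar>X N * d N\<bar> + \<bar>\<Sum>n<N. X (Suc n) * (d n - d (Suc n))\<bar>" unfolding part by (rule abs_triangle_ineq)
    also have "\<bar>\<Sum>n<N. X (Suc n) * (d n - d (Suc n))\<bar> \<le> (\<Sum>n<N. \<bar>X (Suc n) * (d n - d (Suc n))\<bar>)" by (rule sum_abs)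
    also have "\<dots> \<le> (\<Sum>n<N. B * (d n - d (Suc n)))"
    proof (rule sum_mono)
      fix n
      have "\<bar>X (Suc n)\<bar> \<le> B" unfolding X_def by (rule B)
      then show "\<bar>X (Suc n) * (d n - d (Suc n))\<bar> \<le> B * (d n - d (Suc n))"
        unfolding abs_mult using dec[of n] by (auto intro!: mult_mono)
    qed
    also have "\<dots> = B * (d 0 - d N)" unfolding sum_distrib_left[symmetric] sum_lessThan_telescope' ..
    also have "\<bar>X N * d N\<bar> \<le> B * d N" unfolding abs_mult using B[of N] d0[of N] by (auto simp: X_def intro!: mult_right_mono)
    finally have "\<bar>\<Sum>n<N. \<psi> (Suc n) * d n\<bar> \<le> B * d 0" by (simp add: algebra_simps)
    moreover have "d 0 = 1 - t" by (simp add: d_def s_def)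
    ultimately show ?thesis by simp
  qed
  have "(\<lambda>n. \<psi> (Suc n) / real (Suc n) - (1 - t) * (\<psi> (Suc n) * (t ^ Suc n / (1 - t ^ Suc n)))) sums (0 - (1 - t) * f)"
    by (intro sums_diff sums_mult zero f)
  moreover have "\<psi> (Suc n) / real (Suc n) - (1 - t) * (\<psi> (Suc n) * (t ^ Suc n / (1 - t ^ Suc n))) = \<psi> (Suc n) * d n" for n
  proof -
    have "(1 - t) * (t ^ Suc n / ((1 - t) * s (Suc n))) = t ^ Suc n / s (Suc n)" using t by simp
    then show ?thesis unfolding s1[of "Suc n"] d_def using t by (simp add: right_diff_distrib mult.left_commute)
  qed
  ultimately have "(\<lambda>n. \<psi> (Suc n) * d n) sums (0 - (1 - t) * f)" by simp
  then have "(\<lambda>N. \<bar>\<Sum>n<N. \<psi> (Suc n) * d n\<bar>) \<longlonglongrightarrow> \<bar>0 - (1 - t) * f\<bar>" unfolding sums_def by (rule tendsto_rabs)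
  then have "\<bar>0 - (1 - t) * f\<bar> \<le> B * (1 - t)" using LIMSEQ_le_const2 bnd by blast
  then have "(1 - t) * \<bar>f\<bar> \<le> (1 - t) * B" using t by (simp add: abs_mult mult.commute)
  then show ?thesis using t by simp
qed

locale real_char =
  fixes \<psi> :: "nat \<Rightarrow> real"
  assumes one: "\<psi> 1 = 1" and mult: "\<psi> (a * b) = \<psi> a * \<psi> b" and vals: "\<psi> n \<in> {-1, 0, 1}"
begin

text \<open>The coefficients of the product of zeta and the L-function of \<open>\<psi>\<close>; the
  non-vanishing rests on their lower bounds in \<open>r_ge\<close>.\<close>

definition r where "r n = (\<Sum>d | d dvd n. \<psi> d)"

lemma \<psi>_power: "\<psi> (p ^ k) = \<psi> p ^ k" by (induction k) (use one in \<open>simp_all add: mult\<close>)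

lemma r_prime_power_mult:
  assumes p: "prime p" "\<not> p dvd n" and n: "n > 0"
  shows "r (p ^ k * n) = (\<Sum>i\<le>k. \<psi> p ^ i) * r n"
proof -
  have p0: "p > 0" using p by (simp add: prime_gt_0_nat)
  have set: "{d. d dvd p ^ k * n} = (\<lambda>(i, d). p ^ i * d) ` ({..k} \<times> {d. d dvd n})"
  proof (intro equalityI subsetI)
    fix d assume "d \<in> {d. d dvd p ^ k * n}"
    then obtain a b where ab: "d = a * b" "a dvd p ^ k" "b dvd n" using division_decomp[of d "p ^ k" n] by blast
    then obtain i where "i \<le> k" "a = p ^ i" using divides_primepow_nat[OF p(1)] by blast
    then show "d \<in> (\<lambda>(i, d). p ^ i * d) ` ({..k} \<times> {d. d dvd n})" using ab by auto
  qed (auto intro!: mult_dvd_mono le_imp_power_dvd)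
  have le: "i \<le> j" if "p ^ i * d = p ^ j * e" "e dvd n" for i j d e
  proof (rule ccontr)
    assume "\<not> i \<le> j"
    then have "p ^ i * d = p ^ j * (p * (p ^ (i - j - 1) * d))" by (simp add: power_add[symmetric] power_Suc[symmetric] mult.assoc[symmetric] del: power_Suc)
    then have "p * (p ^ (i - j - 1) * d) = e" using that(1) p0 by simp
    then have "p dvd e" by (metis dvd_triv_left)
    then show False using that(2) p(2) dvd_trans by blast
  qed
  have inj: "inj_on (\<lambda>(i, d). p ^ i * d) ({..k} \<times> {d. d dvd n})"
  proof (rule inj_onI, clarsimp)
    fix i d j e assume "d dvd n" "e dvd n" and eq: "p ^ i * d = p ^ j * e"
    then have "i = j" using le[of i d j e] le[of j e i d] by simp
    then show "i = j \<and> d = e" using eq p0 by simp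
  qed
  have "r (p ^ k * n) = (\<Sum>(i, d)\<in>{..k} \<times> {d. d dvd n}. \<psi> (p ^ i * d))"
    unfolding r_def set by (subst sum.reindex[OF inj]) (simp add: case_prod_unfold)
  also have "\<dots> = (\<Sum>i\<le>k. \<Sum>d | d dvd n. \<psi> p ^ i * \<psi> d)"
    by (subst sum.cartesian_product) (simp add: mult \<psi>_power)
  also have "\<dots> = (\<Sum>i\<le>k. \<psi> p ^ i) * r n" unfolding r_def sum_product ..
  finally show ?thesis .
qed

lemma power_sum_ge: "(\<Sum>i\<le>k. \<psi> p ^ i) \<ge> 0" "(\<Sum>i\<le>2 * k. \<psi> p ^ i) \<ge> 1"
proof -
  consider "\<psi> p = 1" | "\<psi> p = 0" | "\<psi> p = -1" using vals[of p] by auto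
  then have "(\<Sum>i\<le>k. \<psi> p ^ i) \<ge> 0 \<and> (\<Sum>i\<le>2 * k. \<psi> p ^ i) \<ge> 1"
  proof cases
    case 2
    have "(\<Sum>i\<le>k. (0::real) ^ i) = 1" for k by (induction k) auto
    then show ?thesis using 2 by simp
  next
    case 3
    have "(\<Sum>i\<le>k. (-1::real) ^ i) = (if even k then 1 else 0)" for k by (induction k) auto
    then show ?thesis using 3 by simp
  qed simp
  then show "(\<Sum>i\<le>k. \<psi> p ^ i) \<ge> 0" "(\<Sum>i\<le>2 * k. \<psi> p ^ i) \<ge> 1" by blast+
qed

text \<open>Split off the full power of one prime. Its local factor is a sum of powers of
  \<open>\<psi> p \<in> {-1, 0, 1}\<close>, which is never negative, and at least 1 if the exponent
  is even; hence the squares.\<close>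

lemma r_ge: "n > 0 \<Longrightarrow> r n \<ge> 0 \<and> r (n\<^sup>2) \<ge> 1"
proof (induction n rule: less_induct)
  case (less n)
  show ?case
  proof (cases "n = 1")
    case True
    have "r 1 = 1" using one by (simp add: r_def)
    then show ?thesis using True by simp
  next
    case False
    then obtain p where p: "prime p" "p dvd n" using prime_factor_nat by blast
    obtain n' where n': "n = p ^ multiplicity p n * n'" "\<not> p dvd n'"
      using multiplicity_decompose'[of n p] less.prems p(1) by (metis less_not_refl not_prime_unit)
    define k where "k = multiplicity p n"
    have k: "k > 0" using n' p by (cases "k = 0") (auto simp: k_def)
    have n0: "n' > 0" using n' less.prems by (cases "n' = 0") auto
    have "n' < n"
    proof -
      have "p ^ k > 1" by (metis k one_less_power p(1) prime_gt_1_nat)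
      then show ?thesis using n'(1) n0 unfolding k_def[symmetric] by (metis mult.commute n_less_m_mult_n One_nat_def)
    qed
    then have IH: "r n' \<ge> 0" "r (n'\<^sup>2) \<ge> 1" using less.IH n0 by auto
    have "r n = (\<Sum>i\<le>k. \<psi> p ^ i) * r n'" using r_prime_power_mult[OF p(1) n'(2) n0, of k] n'(1) by (simp add: k_def)
    then have "r n \<ge> 0" using IH power_sum_ge(1) by simp
    moreover have "r (n\<^sup>2) \<ge> 1"
    proof -
      have "n\<^sup>2 = p ^ (2 * k) * n'\<^sup>2" using n'(1) unfolding k_def[symmetric] by (simp add: power_mult_distrib power_mult[symmetric] mult.commute)
      moreover have "\<not> p dvd n'\<^sup>2" using n'(2) p(1) prime_dvd_power by blast
      ultimately have "r (n\<^sup>2) = (\<Sum>i\<le>2 * k. \<psi> p ^ i) * r (n'\<^sup>2)" using r_prime_power_mult[OF p(1), of "n'\<^sup>2" "2 * k"] n0 by simp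
      also have "\<dots> \<ge> 1 * 1" using IH power_sum_ge(1)[where k = "2 * k"] power_sum_ge(2) by (intro mult_mono) auto
      finally show ?thesis by simp
    qed
    ultimately show ?thesis by blast
  qed
qed

text \<open>Expanding the quotient as a geometric series and collecting the pairs with product
  \<open>N\<close> turns the Lambert series into the power series with coefficients
  \<open>r N\<close>. By \<open>r_ge\<close> all terms but those at squares may be dropped.\<close>

lemma lambert_lower_bound:
  assumes t: "0 < t" "t < (1::real)"
  shows "\<exists>f. (\<lambda>n. \<psi> (Suc n) * (t ^ Suc n / (1 - t ^ Suc n))) sums f \<and> (\<forall>K. (\<Sum>k<K. t ^ ((Suc k)\<^sup>2)) \<le> f)"
proof -
  define A where "A = {1::nat..} \<times> {1::nat..}"
  define g where "g = (\<lambda>(n, j). \<psi> n * t ^ (n * j))"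
  have ps: "\<bar>\<psi> n\<bar> \<le> 1" for n using vals[of n] by auto
  have inner: "((\<lambda>j. t ^ (n * j)) has_sum (t ^ n / (1 - t ^ n))) {1..}" if n: "n \<ge> 1" for n
  proof -
    have x: "norm (t ^ n) < 1" using t n by (simp add: power_less_one_iff)
    have "summable (\<lambda>j. norm ((t ^ n) ^ j))" using summable_geometric[OF x] t by simp
    then have "((\<lambda>j. (t ^ n) ^ j) has_sum (1 / (1 - t ^ n))) UNIV"
      by (rule norm_summable_imp_has_sum[OF _ geometric_sums[OF x]])
    then have "((\<lambda>j. t ^ n * (t ^ n) ^ j) has_sum (t ^ n * (1 / (1 - t ^ n)))) UNIV" by (rule has_sum_cmult_right)
    then have "((\<lambda>j. t ^ (n * Suc j)) has_sum (t ^ n / (1 - t ^ n))) UNIV" by (simp add: power_add power_mult)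
    moreover have "bij_betw Suc UNIV {1..}" by (auto simp: bij_betw_def image_iff) (metis Suc_le_D One_nat_def)
    ultimately show ?thesis using has_sum_reindex_bij_betw[of Suc UNIV "{1..}" "\<lambda>j. t ^ (n * j)"] by simp
  qed
  have gabs: "(\<lambda>x. norm (g x)) summable_on A"
  proof -
    have "(\<lambda>(n, j). t ^ (n * j)) summable_on A" unfolding A_def
    proof (rule summable_on_SigmaI[where g = "\<lambda>n. t ^ n / (1 - t ^ n)"])
      have "summable (\<lambda>n. t ^ n / (1 - t))" using t by (intro summable_divide summable_geometric) auto
      then have "(\<lambda>n. t ^ n / (1 - t)) summable_on UNIV" using t by (subst summable_on_UNIV_nonneg_real_iff) auto
      then have "(\<lambda>n. t ^ n / (1 - t)) summable_on {1..}" by (rule summable_on_subset_banach) simp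
      then show "(\<lambda>n. t ^ n / (1 - t ^ n)) summable_on {1..}"
      proof (rule summable_on_comparison_test)
        fix n :: nat assume n: "n \<in> {1..}"
        then have "t ^ n \<le> t ^ 1" using t by (intro power_decreasing) auto
        then show "t ^ n / (1 - t ^ n) \<le> t ^ n / (1 - t)" using t by (intro divide_left_mono) auto
        show "0 \<le> t ^ n / (1 - t ^ n)" using t \<open>t ^ n \<le> t ^ 1\<close> by auto
      qed
    qed (use inner t in auto)
    then show ?thesis
    proof (rule summable_on_comparison_test)
      fix x assume "x \<in> A"
      obtain n j where x: "x = (n, j)" by (cases x)
      have "\<bar>\<psi> n\<bar> * t ^ (n * j) \<le> 1 * t ^ (n * j)" using t ps by (intro mult_right_mono) auto
      then show "norm (g x) \<le> (case x of (n, j) \<Rightarrow> t ^ (n * j))" using t by (simp add: x g_def abs_mult)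
    qed auto
  qed
  have gs: "g summable_on A" using gabs by (rule Infinite_Sum.abs_summable_summable)
  define f where "f = infsum g A"
  have gi: "infsum (\<lambda>j. g (n, j)) {1..} = \<psi> n * (t ^ n / (1 - t ^ n))" if "n \<in> {1..}" for n
    using has_sum_cmult_right[OF inner, of n "\<psi> n"] that by (auto simp: g_def intro!: infsumI)
  have "infsum (\<lambda>n. infsum (\<lambda>j. g (n, j)) {1..}) {1..} = f" and "(\<lambda>n. infsum (\<lambda>j. g (n, j)) {1..}) summable_on {1..}"
    using infsum_Sigma_banach[of g "{1..}" "\<lambda>_. {1..}"] summable_on_Sigma_banach[of "\<lambda>n j. g (n, j)" "{1..}" "\<lambda>_. {1..}"] gs unfolding A_def f_def by auto
  then have "((\<lambda>n. infsum (\<lambda>j. g (n, j)) {1..}) has_sum f) {1..}" by (metis has_sum_infsum)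
  then have "((\<lambda>n. \<psi> n * (t ^ n / (1 - t ^ n))) has_sum f) {1..}" using gi has_sum_cong by (metis (no_types, lifting))
  moreover have "bij_betw Suc UNIV {1..}" by (auto simp: bij_betw_def image_iff) (metis Suc_le_D One_nat_def)
  ultimately have "((\<lambda>n. \<psi> (Suc n) * (t ^ Suc n / (1 - t ^ Suc n))) has_sum f) UNIV"
    using has_sum_reindex_bij_betw[of Suc UNIV "{1..}" "\<lambda>n. \<psi> n * (t ^ n / (1 - t ^ n))" f] by simp
  then have sums: "(\<lambda>n. \<psi> (Suc n) * (t ^ Suc n / (1 - t ^ Suc n))) sums f" by (rule has_sum_imp_sums)
  define D where "D = Sigma {1::nat..} (\<lambda>N. {d. d dvd N})"
  have bij: "bij_betw (\<lambda>(N, d). (d, N div d)) D A"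
  proof (rule bij_betwI[where g = "\<lambda>(n, j). (n * j, n)"])
    show "(\<lambda>(N, d). (d, N div d)) \<in> D \<rightarrow> A" unfolding D_def A_def
      by (auto simp: Suc_le_eq dvd_pos_nat intro!: Nat.gr0I)
  qed (auto simp: D_def A_def Suc_le_eq)
  define G where "G = (\<lambda>(N, d). \<psi> d * t ^ N)"
  have Gg: "G x = g ((\<lambda>(N, d). (d, N div d)) x)" if "x \<in> D" for x using that by (auto simp: D_def G_def g_def)
  have "f = infsum (\<lambda>x. g ((\<lambda>(N, d). (d, N div d)) x)) D" unfolding f_def by (rule infsum_reindex_bij_betw[OF bij, symmetric])
  also have "\<dots> = infsum G D" by (rule infsum_cong) (use Gg in auto)
  finally have fG: "f = infsum G D" .
  have "(\<lambda>x. g ((\<lambda>(N, d). (d, N div d)) x)) summable_on D" using summable_on_reindex_bij_betw[OF bij] gs by blast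
  then have Gs: "G summable_on D" using Gg summable_on_cong by (metis (no_types, lifting))
  have Gi: "infsum (\<lambda>d. G (N, d)) {d. d dvd N} = r N * t ^ N" if "N \<in> {1..}" for N
    using that by (simp add: G_def r_def sum_distrib_right)
  have "infsum (\<lambda>N. infsum (\<lambda>d. G (N, d)) {d. d dvd N}) {1..} = f" and rs: "(\<lambda>N. infsum (\<lambda>d. G (N, d)) {d. d dvd N}) summable_on {1..}"
    using infsum_Sigma_banach[of G "{1..}" "\<lambda>N. {d. d dvd N}"] summable_on_Sigma_banach[of "\<lambda>N d. G (N, d)" "{1..}" "\<lambda>N. {d. d dvd N}"] Gs unfolding D_def fG by auto
  then have fr: "f = infsum (\<lambda>N. r N * t ^ N) {1..}" using Gi infsum_cong by (metis (no_types, lifting))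
  have rs': "(\<lambda>N. r N * t ^ N) summable_on {1..}" using rs Gi summable_on_cong by (metis (no_types, lifting))
  have "(\<Sum>k<K. t ^ ((Suc k)\<^sup>2)) \<le> f" for K
  proof -
    have inj: "inj_on (\<lambda>k. (Suc k)\<^sup>2) {..<K}" by (auto simp: inj_on_def)
    have "(\<Sum>k<K. t ^ ((Suc k)\<^sup>2)) \<le> (\<Sum>k<K. r ((Suc k)\<^sup>2) * t ^ ((Suc k)\<^sup>2))"
    proof (rule sum_mono)
      fix k
      have "1 * t ^ ((Suc k)\<^sup>2) \<le> r ((Suc k)\<^sup>2) * t ^ ((Suc k)\<^sup>2)" using r_ge[of "Suc k"] t by (intro mult_right_mono) auto
      then show "t ^ ((Suc k)\<^sup>2) \<le> r ((Suc k)\<^sup>2) * t ^ ((Suc k)\<^sup>2)" by simp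
    qed
    also have "\<dots> = (\<Sum>N\<in>(\<lambda>k. (Suc k)\<^sup>2) ` {..<K}. r N * t ^ N)" by (subst sum.reindex[OF inj]) simp
    also have "\<dots> \<le> f" unfolding fr
      by (rule finite_sum_le_infsum[OF rs']) (use t r_ge in \<open>auto intro!: mult_nonneg_nonneg\<close>)
    finally show ?thesis .
  qed
  then show ?thesis using sums by blast
qed

text \<open>Otherwise \<open>monsky_bounded\<close> keeps the Lambert series below \<open>B\<close>
  for all \<open>t < 1\<close>, whereas finitely many of its square terms tend to any prescribed
  number \<open>K\<close> as \<open>t\<close> approaches 1.\<close>

theorem sum_over_n_nonzero:
  assumes B: "\<And>k. \<bar>\<Sum>n<k. \<psi> (Suc n)\<bar> \<le> B"
  shows "\<not> (\<lambda>n. \<psi> (Suc n) / real (Suc n)) sums 0"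
proof
  assume zero: "(\<lambda>n. \<psi> (Suc n) / real (Suc n)) sums 0"
  obtain K :: nat where K: "B < real K" using reals_Archimedean2 by blast
  have le: "(\<Sum>k<K. t ^ ((Suc k)\<^sup>2)) \<le> B" if t: "0 < t" "t < 1" for t :: real
  proof -
    obtain f where f: "(\<lambda>n. \<psi> (Suc n) * (t ^ Suc n / (1 - t ^ Suc n))) sums f" "(\<Sum>k<K. t ^ ((Suc k)\<^sup>2)) \<le> f"
      using lambert_lower_bound[OF t] by blast
    show ?thesis using monsky_bounded[OF t B zero f(1)] f(2) by linarith
  qed
  have "((\<lambda>t::real. \<Sum>k<K. t ^ ((Suc k)\<^sup>2)) \<longlongrightarrow> (\<Sum>k<K. 1 ^ ((Suc k)\<^sup>2))) (at_left 1)" by (intro tendsto_intros)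
  then have "((\<lambda>t::real. \<Sum>k<K. t ^ ((Suc k)\<^sup>2)) \<longlongrightarrow> real K) (at_left 1)" by simp
  moreover have "\<forall>\<^sub>F t in at_left (1::real). (\<Sum>k<K. t ^ ((Suc k)\<^sup>2)) \<le> B"
    using eventually_at_left_real[of 0 "1::real"] by (rule eventually_mono) (use le in auto)
  ultimately have "real K \<le> B" using tendsto_upperbound by (metis trivial_limit_at_left_real)
  then show False using K by simp
qed

end

section \<open>Non-vanishing on the line of abscissa 1\<close>

text \<open>
  The function \<open>zeta_reg\<close> is \<open>(s - 1) \<zeta>(s)\<close>, and \<open>L_reg m \<xi>\<close> is the part of the L-function of \<open>\<xi>\<close> that remains after
  subtracting \<open>mean_value m \<xi> * \<zeta>(s)\<close>. At \<open>s = 1\<close>, the value of \<open>L_fun m \<xi>\<close> is that of the L-function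
  only if \<open>mean_value m \<xi> = 0\<close>.
\<close>

definition zeta_reg :: "complex \<Rightarrow> complex" where
  "zeta_reg = (SOME E. E holomorphic_on {s. Re s > 0} \<and> E 1 = 1 \<and> (\<forall>s. Re s > 1 \<longrightarrow> (\<lambda>n. complex_of_real (real (Suc n)) powr (-s)) sums (E s / (s - 1))))"

lemma zeta_reg: "zeta_reg holomorphic_on {s. Re s > 0}" "zeta_reg 1 = 1"
  "Re s > 1 \<Longrightarrow> (\<lambda>n. complex_of_real (real (Suc n)) powr (-s)) sums (zeta_reg s / (s - 1))"
  using someI_ex[OF zeta_times_pole] unfolding zeta_reg_def[symmetric] by auto

definition mean_value :: "nat \<Rightarrow> (nat \<Rightarrow> complex) \<Rightarrow> complex" where "mean_value m \<xi> = (\<Sum>n<m. \<xi> (Suc n)) / of_nat m"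

definition L_reg :: "nat \<Rightarrow> (nat \<Rightarrow> complex) \<Rightarrow> complex \<Rightarrow> complex" where
  "L_reg m \<xi> = (SOME W. W holomorphic_on {s. Re s > 0} \<and>
     (\<forall>s. Re s > 0 \<longrightarrow> (\<lambda>n. (\<xi> (Suc n) - mean_value m \<xi>) * of_real (real (Suc n)) powr (-s)) sums W s))"

definition L_fun :: "nat \<Rightarrow> (nat \<Rightarrow> complex) \<Rightarrow> complex \<Rightarrow> complex" where
  "L_fun m \<xi> s = mean_value m \<xi> * zeta_reg s / (s - 1) + L_reg m \<xi> s"

text \<open>As \<open>0 powr w = 0\<close>, the value at \<open>n = 0\<close> is 0, which
  \<open>cmult\<close> demands.\<close>

definition char_powr :: "(nat \<Rightarrow> complex) \<Rightarrow> complex \<Rightarrow> nat \<Rightarrow> complex" where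
  "char_powr \<xi> s n = \<xi> n * of_real (real n) powr (-s)"

lemma sum_lessThan_add:
  fixes F :: "nat \<Rightarrow> 'a::comm_monoid_add"
  shows "(\<Sum>n<a + c. F n) = (\<Sum>n<a. F n) + (\<Sum>v<c. F (a + v))"
  by (induction c) (simp_all add: add.assoc)

locale dirichlet_char =
  fixes m :: nat and \<xi> :: "nat \<Rightarrow> complex"
  assumes m: "m > 0" and \<xi>: "dchar m \<xi>"
begin

lemma one: "\<xi> 1 = 1" and mult: "\<xi> (a * b) = \<xi> a * \<xi> b" and per: "\<xi> (n + m) = \<xi> n" and nz: "\<xi> n \<noteq> 0 \<longleftrightarrow> coprime n m"
  using \<xi> unfolding dchar_def by blast+

lemma power: "\<xi> (n ^ k) = \<xi> n ^ k" by (induction k) (use one in \<open>simp_all add: mult\<close>)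

lemma norm_char: "norm (\<xi> n) = (if coprime n m then 1 else 0)"
proof (cases "coprime n m")
  case True
  have "\<xi> (n ^ totient m) = \<xi> 1" by (rule periodic_cong[of \<xi> m, OF per]) (rule euler_theorem[OF True])
  then have "\<xi> n ^ totient m = 1" using one by (simp add: power)
  then show ?thesis using True m norm_root_of_unity[of "\<xi> n" "totient m"] by simp
qed (use nz in auto)

lemma norm_le_1: "norm (\<xi> n) \<le> 1" by (simp add: norm_char)

lemma norm_mean: "norm (mean_value m \<xi>) \<le> 1"
proof -
  have "norm (\<Sum>n<m. \<xi> (Suc n)) \<le> (\<Sum>n<m. 1)" by (intro sum_norm_le norm_le_1)
  then show ?thesis using m by (simp add: mean_value_def norm_divide)
qed

text \<open>Over a full period the differences from the mean cancel, so only the last, incomplete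
  period contributes.\<close>

lemma partial_sums: "norm (\<Sum>n<k. \<xi> (Suc n) - mean_value m \<xi>) \<le> 2 * real m"
proof -
  define b where "b n = \<xi> (Suc n) - mean_value m \<xi>" for n
  have bper: "b (m * u + v) = b v" for u v unfolding b_def using periodic_mult[of \<xi> m, OF per, of "Suc v" u] by (simp add: add.commute)
  have b0: "(\<Sum>v<m. b v) = 0" unfolding b_def mean_value_def using m by (simp add: sum_subtractf)
  have bn: "norm (b v) \<le> 2" for v unfolding b_def using norm_triangle_ineq4[of "\<xi> (Suc v)" "mean_value m \<xi>"] norm_le_1[of "Suc v"] norm_mean by linarith
  have "(\<Sum>n<k. b n) = (\<Sum>n<k div m * m + k mod m. b n)" by simp
  also have "\<dots> = (\<Sum>u<k div m. \<Sum>v<m. b (m * u + v)) + (\<Sum>v<k mod m. b (m * (k div m) + v))"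
    unfolding sum_lessThan_add sum_blocks by (simp add: mult.commute)
  also have "\<dots> = (\<Sum>v<k mod m. b v)" unfolding bper b0 by simp
  also have "norm \<dots> \<le> (\<Sum>v<k mod m. 2)" by (intro sum_norm_le bn)
  also have "\<dots> \<le> 2 * real m" using m by simp
  finally show ?thesis by (simp add: b_def)
qed

lemma L_reg: "L_reg m \<xi> holomorphic_on {s. Re s > 0}"
  "Re s > 0 \<Longrightarrow> (\<lambda>n. (\<xi> (Suc n) - mean_value m \<xi>) * of_real (real (Suc n)) powr (-s)) sums L_reg m \<xi> s"
  using someI_ex[OF dirichlet_series_bounded_partial_sums[OF partial_sums]] unfolding L_reg_def[symmetric] by auto

lemma L_fun_sums:
  assumes "Re s > 1"
  shows "(\<lambda>n. \<xi> (Suc n) * of_real (real (Suc n)) powr (-s)) sums L_fun m \<xi> s"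
proof -
  have "(\<lambda>n. mean_value m \<xi> * of_real (real (Suc n)) powr (-s) + (\<xi> (Suc n) - mean_value m \<xi>) * of_real (real (Suc n)) powr (-s)) sums (mean_value m \<xi> * (zeta_reg s / (s - 1)) + L_reg m \<xi> s)"
    using assms by (intro sums_add sums_mult zeta_reg L_reg) auto
  moreover have "mean_value m \<xi> * X + (\<xi> (Suc n) - mean_value m \<xi>) * X = \<xi> (Suc n) * X" for n X by (simp add: algebra_simps)
  ultimately show ?thesis unfolding L_fun_def by simp
qed

lemma norm_char_powr: "norm (char_powr \<xi> s n) = norm (\<xi> n) * real n powr (- Re s)"
  by (cases "n = 0") (simp_all add: char_powr_def norm_mult norm_powr_real_powr)

lemma cmult_char_powr: assumes s: "Re s > 1" shows "cmult (char_powr \<xi> s)"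
proof
  show "char_powr \<xi> s 0 = 0" by (simp add: char_powr_def)
  show "char_powr \<xi> s 1 = 1" using one by (simp add: char_powr_def)
  fix a b
  have "complex_of_real (real (a * b)) powr (-s) = of_real (real a) powr (-s) * of_real (real b) powr (-s)"
    unfolding of_nat_mult of_real_mult by (rule powr_times_real) auto
  then show "char_powr \<xi> s (a * b) = char_powr \<xi> s a * char_powr \<xi> s b" unfolding char_powr_def mult by (simp only: mult_ac)
next
  have "summable (\<lambda>n. real n powr (- Re s))" using s by (subst summable_real_powr_iff) simp
  then have "(\<lambda>n. real n powr (- Re s)) summable_on UNIV" by (subst summable_on_UNIV_nonneg_real_iff) auto
  then show "(\<lambda>n. norm (char_powr \<xi> s n)) summable_on UNIV"
    by (rule summable_on_comparison_test) (auto simp: norm_char_powr norm_le_1 mult_left_le_one_le)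
qed

lemma infsum_to_sums:
  assumes s: "Re s > 1" and g: "\<And>n. norm (g n) \<le> 1"
  shows "(\<lambda>n. g (Suc n) * char_powr \<xi> s (Suc n)) sums infsum (\<lambda>n. g n * char_powr \<xi> s n) UNIV"
proof -
  have "(\<lambda>n. g n * char_powr \<xi> s n) sums infsum (\<lambda>n. g n * char_powr \<xi> s n) UNIV"
    by (rule has_sum_imp_sums[OF has_sum_infsum[OF Infinite_Sum.abs_summable_summable[OF cmult.abs_bounded_mult[OF cmult_char_powr[OF s] g]]]])
  then show ?thesis using sums_Suc_iff[of "\<lambda>n. g n * char_powr \<xi> s n"] by (simp add: char_powr_def)
qed

lemma infsum_char_powr: assumes "Re s > 1" shows "infsum (char_powr \<xi> s) UNIV = L_fun m \<xi> s"
proof (rule sums_unique2)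
  show "(\<lambda>n. char_powr \<xi> s (Suc n)) sums infsum (char_powr \<xi> s) UNIV" using infsum_to_sums[OF assms, of "\<lambda>_. 1"] by simp
  show "(\<lambda>n. char_powr \<xi> s (Suc n)) sums L_fun m \<xi> s" unfolding char_powr_def by (rule L_fun_sums[OF assms])
qed

lemma moebius_sums:
  assumes "Re s > 1"
  shows "(\<lambda>n. (of_int (moebius_mu (Suc n)) * \<xi> (Suc n)) * of_nat (Suc n) powr (-s)) sums (1 / L_fun m \<xi> s)" and "L_fun m \<xi> s \<noteq> 0"
proof -
  define M where "M = infsum (\<lambda>n. of_int (moebius_mu n) * char_powr \<xi> s n) UNIV"
  have inv1: "M * L_fun m \<xi> s = 1" using cmult.moebius_inverse[OF cmult_char_powr[OF assms]] infsum_char_powr[OF assms] by (simp add: M_def)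
  then show nz: "L_fun m \<xi> s \<noteq> 0" by auto
  have "M = 1 / L_fun m \<xi> s" using inv1 nz by (simp add: field_simps)
  moreover have "(\<lambda>n. of_int (moebius_mu (Suc n)) * char_powr \<xi> s (Suc n)) sums M"
    unfolding M_def by (rule infsum_to_sums[OF assms norm_moebius_mu_le])
  ultimately show "(\<lambda>n. (of_int (moebius_mu (Suc n)) * \<xi> (Suc n)) * of_nat (Suc n) powr (-s)) sums (1 / L_fun m \<xi> s)"
    by (simp add: char_powr_def mult.assoc)
qed

text \<open>Multiplication by \<open>g\<close> permutes the residues, so the sum over a period is
  unchanged when multiplied by \<open>\<xi> g \<noteq> 1\<close>.\<close>

lemma mean_nonprincipal:
  assumes "coprime g m" "\<xi> g \<noteq> 1" shows "mean_value m \<xi> = 0"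
proof -
  define S where "S = (\<Sum>n<m. \<xi> n)"
  have "(\<Sum>n<m. \<xi> (Suc n)) + \<xi> 0 = S + \<xi> m" unfolding S_def using sum.lessThan_Suc_shift[of \<xi> m] by (simp add: add.commute)
  then have S1: "(\<Sum>n<m. \<xi> (Suc n)) = S" using per[of 0] by simp
  have inj: "inj_on (\<lambda>n. g * n mod m) {..<m}"
  proof (rule inj_onI)
    fix x y assume xy: "x \<in> {..<m}" "y \<in> {..<m}" "g * x mod m = g * y mod m"
    then have "[g * x = g * y] (mod m)" by (simp add: cong_def)
    then have "[x = y] (mod m)" using assms(1) cong_mult_lcancel_nat by blast
    then show "x = y" using xy by (simp add: cong_less_modulus_unique_nat)
  qed
  have "(\<lambda>n. g * n mod m) ` {..<m} = {..<m}" by (rule endo_inj_surj) (use inj m in auto)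
  then have "S = (\<Sum>n<m. \<xi> (g * n mod m))" unfolding S_def using sum.reindex[OF inj, of \<xi>] by simp
  also have "\<dots> = (\<Sum>n<m. \<xi> (g * n))" by (intro sum.cong refl periodic_cong[of \<xi> m, OF per]) (simp add: cong_def)
  also have "\<dots> = \<xi> g * S" unfolding S_def mult by (simp add: sum_distrib_left)
  finally have "(1 - \<xi> g) * S = 0" by (simp add: algebra_simps)
  then have "S = 0" using assms by simp
  then show ?thesis using S1 by (simp add: mean_value_def)
qed

lemma L_fun_differentiable:
  assumes "Re s > 0" "mean_value m \<xi> = 0 \<or> s \<noteq> 1" shows "L_fun m \<xi> field_differentiable at s"
proof -
  have op: "open {s. Re s > 0}" by (simp add: open_halfspace_Re_gt)
  have h: "zeta_reg field_differentiable at s" "L_reg m \<xi> field_differentiable at s"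
    using holomorphic_on_imp_differentiable_at[OF _ op] zeta_reg(1) L_reg(1) assms(1) by auto
  show ?thesis
  proof (cases "mean_value m \<xi> = 0")
    case True
    then have "L_fun m \<xi> = L_reg m \<xi>" by (auto simp: L_fun_def)
    then show ?thesis using h by simp
  next
    case False
    then have "s - 1 \<noteq> 0" using assms by simp
    then show ?thesis unfolding L_fun_def[abs_def]
      by (intro field_differentiable_add field_differentiable_divide field_differentiable_mult field_differentiable_diff field_differentiable_const field_differentiable_ident h)
  qed
qed

end

lemma of_real_at_right_0: "((\<lambda>\<delta>::real. complex_of_real \<delta>) \<longlongrightarrow> 0) (at_right 0)"
  using tendsto_of_real[OF tendsto_ident_at, of 0 "{0<..}"] by simp

lemma (in dirichlet_char) residue: "((\<lambda>\<delta>. of_real \<delta> * L_fun m \<xi> (1 + of_real \<delta>)) \<longlongrightarrow> mean_value m \<xi>) (at_right 0)"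
proof (rule Lim_transform_eventually)
  have op: "open {s. Re s > 0}" by (simp add: open_halfspace_Re_gt)
  have "isCont zeta_reg (1 + 0)" "isCont (L_reg m \<xi>) (1 + 0)"
    using holomorphic_on_imp_continuous_on[OF zeta_reg(1)] holomorphic_on_imp_continuous_on[OF L_reg(1)] op by (auto simp: continuous_on_eq_continuous_at)
  then have "((\<lambda>\<delta>. mean_value m \<xi> * zeta_reg (1 + of_real \<delta>) + of_real \<delta> * L_reg m \<xi> (1 + of_real \<delta>)) \<longlongrightarrow> mean_value m \<xi> * zeta_reg (1 + 0) + 0 * L_reg m \<xi> (1 + 0)) (at_right 0)"
    by (intro tendsto_intros of_real_at_right_0 isCont_tendsto_compose[of _ zeta_reg] isCont_tendsto_compose[of _ "L_reg m \<xi>"])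
  then show "((\<lambda>\<delta>. mean_value m \<xi> * zeta_reg (1 + of_real \<delta>) + of_real \<delta> * L_reg m \<xi> (1 + of_real \<delta>)) \<longlongrightarrow> mean_value m \<xi>) (at_right 0)"
    by (simp add: zeta_reg(2))
  show "\<forall>\<^sub>F \<delta> in at_right 0. mean_value m \<xi> * zeta_reg (1 + of_real \<delta>) + of_real \<delta> * L_reg m \<xi> (1 + of_real \<delta>) = of_real \<delta> * L_fun m \<xi> (1 + of_real \<delta>)"
    using eventually_at_right_less[of 0] by eventually_elim (auto simp: L_fun_def field_simps)
qed

text \<open>This is the principal character modulo \<open>m\<close>, whichever \<open>\<xi>\<close>
  one starts from.\<close>

lemma dirichlet_char_norm: assumes "dirichlet_char m \<xi>" shows "dirichlet_char m (\<lambda>n. of_real (norm (\<xi> n)))"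
proof -
  interpret dirichlet_char m \<xi> by fact
  show ?thesis by unfold_locales (use m one per nz in \<open>auto simp: dchar_def mult norm_mult\<close>)
qed

lemma dirichlet_char_square: assumes "dirichlet_char m \<xi>" shows "dirichlet_char m (\<lambda>n. (\<xi> n)\<^sup>2)"
proof -
  interpret dirichlet_char m \<xi> by fact
  show ?thesis by unfold_locales (use m one per nz in \<open>auto simp: dchar_def mult power_mult_distrib\<close>)
qed

context dirichlet_char
begin

lemma real_char_Lx_nonzero:
  assumes mean0: "mean_value m \<xi> = 0" and sq: "\<And>n. coprime n m \<Longrightarrow> (\<xi> n)\<^sup>2 = 1"
  shows "L_fun m \<xi> 1 \<noteq> 0"
proof
  assume z: "L_fun m \<xi> 1 = 0"
  have vals: "\<xi> n \<in> {-1, 0, 1}" for n using sq[of n] nz[of n] by (cases "coprime n m") (auto simp: power2_eq_1_iff)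
  then have re: "\<xi> n = of_real (Re (\<xi> n))" for n by (metis insert_iff empty_iff of_real_Re Reals_minus Reals_0 Reals_1)
  define \<psi> where "\<psi> n = Re (\<xi> n)" for n
  interpret real_char \<psi>
  proof
    show "\<psi> 1 = 1" using one by (simp add: \<psi>_def)
    show "\<psi> (a * b) = \<psi> a * \<psi> b" for a b unfolding \<psi>_def mult using re[of a] re[of b] by (metis Re_complex_of_real of_real_mult)
    show "\<psi> n \<in> {-1, 0, 1}" for n using vals[of n] by (auto simp: \<psi>_def)
  qed
  have B: "\<bar>\<Sum>n<k. \<psi> (Suc n)\<bar> \<le> 2 * real m" for k
  proof -
    have "\<bar>\<Sum>n<k. \<psi> (Suc n)\<bar> = \<bar>Re (\<Sum>n<k. \<xi> (Suc n))\<bar>" by (simp add: \<psi>_def)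
    also have "\<dots> \<le> 2 * real m" using order.trans[OF abs_Re_le_cmod partial_sums[of k]] by (simp add: mean0)
    finally show ?thesis .
  qed
  \<comment> \<open>With mean 0, \<open>L_fun\<close> is \<open>L_reg\<close>, whose series still
    converges at \<open>s = 1\<close>; so a zero there is exactly the situation that
    \<open>sum_over_n_nonzero\<close> excludes.\<close>
  have "(\<lambda>n. \<xi> (Suc n) * of_real (real (Suc n)) powr (-1)) sums 0"
    using L_reg(2)[of 1] z mean0 by (simp add: L_fun_def)
  moreover have "\<xi> (Suc n) * of_real (real (Suc n)) powr (-1) = of_real (\<psi> (Suc n) / real (Suc n))" for n
  proof -
    have "of_real (real (Suc n)) powr (-1 :: complex) = of_real (1 / real (Suc n))"
      by (simp add: powr_minus field_simps del: of_nat_Suc)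
    then show ?thesis using re[of "Suc n"] unfolding \<psi>_def by (simp add: mult.commute divide_inverse del: of_nat_Suc)
  qed
  ultimately have "(\<lambda>n. complex_of_real (\<psi> (Suc n) / real (Suc n))) sums of_real 0" by (simp only: of_real_0)
  then have "(\<lambda>n. \<psi> (Suc n) / real (Suc n)) sums 0" by (simp only: sums_of_real_iff)
  then show False using sum_over_n_nonzero[OF B] by blast
qed

text \<open>At a zero, the fourth power of \<open>L_fun m \<xi>\<close> outweighs the triple pole of
  the principal character at 1, so the product in the 3-4-1 inequality would tend to 0, provided
  that the third factor stays bounded.\<close>

theorem L_fun_nonzero:
  assumes s: "Re s = 1" and cond: "mean_value m \<xi> = 0 \<or> s \<noteq> 1"
  shows "L_fun m \<xi> s \<noteq> 0"
proof
  assume zero: "L_fun m \<xi> s = 0"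
  define \<xi>0 where "\<xi>0 n = complex_of_real (norm (\<xi> n))" for n
  define \<xi>2 where "\<xi>2 n = (\<xi> n)\<^sup>2" for n
  interpret c0: dirichlet_char m \<xi>0 unfolding \<xi>0_def by (rule dirichlet_char_norm) unfold_locales
  interpret c2: dirichlet_char m \<xi>2 unfolding \<xi>2_def by (rule dirichlet_char_square) unfold_locales
  txt \<open>If \<open>s = 1 + i t\<close> then \<open>s2 = 1 + 2 i t\<close>.\<close>
  define s2 where "s2 = 2 * s - 1"
  \<comment> \<open>A pole of the third factor would force \<open>s = 1\<close> and
    \<open>\<xi>\<close> to take only the values 1 and -1 on the units; this case is left to
    \<open>real_char_Lx_nonzero\<close>.\<close>
  have cond2: "mean_value m \<xi>2 = 0 \<or> s2 \<noteq> 1"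
  proof (rule ccontr)
    assume "\<not> ?thesis"
    then have h: "mean_value m \<xi>2 \<noteq> 0" "s = 1" by (auto simp: s2_def)
    then have "\<xi>2 n = 1" if "coprime n m" for n using c2.mean_nonprincipal that by blast
    then show False using real_char_Lx_nonzero cond h zero by (auto simp: \<xi>2_def)
  qed
  have s2: "Re s2 = 1" using s by (simp add: s2_def)
  have ineq: "1 \<le> norm (L_fun m \<xi>0 (1 + of_real \<delta>) ^ 3 * L_fun m \<xi> (s + of_real \<delta>) ^ 4 * L_fun m \<xi>2 (s2 + of_real \<delta>))" if \<delta>: "\<delta> > 0" for \<delta>
  proof -
    have r: "Re (s + of_real \<delta>) > 1" "Re (1 + of_real \<delta>) > 1" "Re (s2 + of_real \<delta>) > 1" using \<delta> s s2 by auto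
    define c where "c = char_powr \<xi> (s + of_real \<delta>)"
    have a0: "of_real (norm (c n)) = char_powr \<xi>0 (1 + of_real \<delta>) n" for n
      unfolding c_def norm_char_powr using s by (cases "n = 0") (simp_all add: char_powr_def \<xi>0_def powr_of_real[symmetric])
    have a2: "(c n)\<^sup>2 / of_real (norm (c n)) = char_powr \<xi>2 (s2 + of_real \<delta>) n" for n
    proof (cases "n = 0 \<or> \<xi> n = 0")
      case False
      then have n: "norm (\<xi> n) = 1" "complex_of_real (real n) \<noteq> 0" using norm_char[of n] by (auto split: if_splits)
      have "of_real (real n) powr (- (s2 + of_real \<delta>)) = (of_real (real n) powr (- (s + of_real \<delta>)))\<^sup>2 / of_real (real n) powr (- (1 + of_real \<delta>))"
      proof -
        have "- (s2 + of_real \<delta>) = 2 * (- (s + of_real \<delta>)) - (- (1 + of_real \<delta>))" by (simp add: s2_def algebra_simps)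
        then show ?thesis using n by (simp only: powr_diff powr_add mult_2 power2_eq_square)
      qed
      moreover have "complex_of_real (norm (c n)) = of_real (real n) powr (- (1 + of_real \<delta>))" using a0[of n] n by (simp add: char_powr_def \<xi>0_def)
      ultimately show ?thesis by (simp add: c_def char_powr_def \<xi>2_def power_mult_distrib)
    qed (auto simp: c_def char_powr_def \<xi>2_def)
    have lt: "norm (c p) < 1" if "prime p" for p
    proof -
      have "norm (c p) \<le> 1 * real p powr (- Re (s + of_real \<delta>))" unfolding c_def norm_char_powr by (intro mult_right_mono norm_le_1) auto
      also have "\<dots> < 1" using r prime_gt_1_nat[OF that] by (simp add: powr_less_one)
      finally show ?thesis .
    qed
    have e0: "(\<lambda>n. complex_of_real (norm (c n))) = char_powr \<xi>0 (1 + of_real \<delta>)" by (rule ext) (rule a0)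
    have e2: "(\<lambda>n. (c n)\<^sup>2 / of_real (norm (c n))) = char_powr \<xi>2 (s2 + of_real \<delta>)" by (rule ext) (rule a2)
    have "1 \<le> norm (infsum (\<lambda>n. of_real (norm (c n)) :: complex) UNIV ^ 3 * infsum c UNIV ^ 4 * infsum (\<lambda>n. (c n)\<^sup>2 / of_real (norm (c n))) UNIV)"
    proof (rule three_four_one[OF _ lt])
      show "cmult c" unfolding c_def by (rule cmult_char_powr[OF r(1)])
      show "cmult (\<lambda>n. of_real (norm (c n)))" unfolding e0 by (rule c0.cmult_char_powr[OF r(2)])
      show "cmult (\<lambda>n. (c n)\<^sup>2 / of_real (norm (c n)))" unfolding e2 by (rule c2.cmult_char_powr[OF r(3)])
    qed
    then show ?thesis unfolding e2 unfolding e0 unfolding c_def infsum_char_powr[OF r(1)] c0.infsum_char_powr[OF r(2)] c2.infsum_char_powr[OF r(3)] .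
  qed
  obtain D where D: "(L_fun m \<xi> has_field_derivative D) (at s)" using L_fun_differentiable[OF _ cond] s unfolding field_differentiable_def by auto
  have t1: "((\<lambda>\<delta>. L_fun m \<xi> (s + of_real \<delta>) / of_real \<delta>) \<longlongrightarrow> D) (at_right 0)"
  proof -
    have "((\<lambda>h. L_fun m \<xi> (s + h) / h) \<longlongrightarrow> D) (at 0)" using D zero unfolding DERIV_def by simp
    moreover have "filterlim complex_of_real (at 0) (at_right 0)"
      using of_real_at_right_0 eventually_at_right_less[of "0::real"] by (intro filterlim_atI) (auto elim: eventually_mono)
    ultimately show ?thesis by (rule filterlim_compose)
  qed
  have t2: "((\<lambda>\<delta>. L_fun m \<xi>2 (s2 + of_real \<delta>)) \<longlongrightarrow> L_fun m \<xi>2 (s2 + 0)) (at_right 0)"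
  proof -
    have "isCont (L_fun m \<xi>2) (s2 + 0)" using c2.L_fun_differentiable[OF _ cond2] s2 field_differentiable_imp_continuous_at by auto
    then show ?thesis by (rule isCont_tendsto_compose) (intro tendsto_intros of_real_at_right_0)
  qed
  \<comment> \<open>The powers of \<open>\<delta>\<close> add up to \<open>3 - 4 + 1 = 0\<close>:
    three compensate the pole, four turn the zero into a derivative, and the remaining one makes the
    limit 0.\<close>
  have "((\<lambda>\<delta>. norm ((of_real \<delta> * L_fun m \<xi>0 (1 + of_real \<delta>)) ^ 3 * (L_fun m \<xi> (s + of_real \<delta>) / of_real \<delta>) ^ 4 * L_fun m \<xi>2 (s2 + of_real \<delta>) * of_real \<delta>))
     \<longlongrightarrow> norm (mean_value m \<xi>0 ^ 3 * D ^ 4 * L_fun m \<xi>2 (s2 + 0) * 0)) (at_right 0)"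
    by (intro tendsto_intros c0.residue t1 t2 of_real_at_right_0)
  moreover have "\<forall>\<^sub>F \<delta> in at_right 0. 1 \<le> norm ((of_real \<delta> * L_fun m \<xi>0 (1 + of_real \<delta>)) ^ 3 * (L_fun m \<xi> (s + of_real \<delta>) / of_real \<delta>) ^ 4 * L_fun m \<xi>2 (s2 + of_real \<delta>) * of_real \<delta>)"
    using eventually_at_right_less[of "0::real"]
  proof eventually_elim
    case (elim \<delta>)
    have "(of_real \<delta> * A) ^ 3 * (B / of_real \<delta>) ^ 4 * C * of_real \<delta> = A ^ 3 * B ^ 4 * C" for A B C :: complex
      using elim by (simp add: power_divide power_mult_distrib field_simps eval_nat_numeral)
    then show ?case using ineq[OF elim] by (simp only:)
  qed
  ultimately have "1 \<le> norm (mean_value m \<xi>0 ^ 3 * D ^ 4 * L_fun m \<xi>2 (s2 + 0) * 0)"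
    by (rule tendsto_lowerbound) simp
  then show False by simp
qed

theorem moebius_mean: "(\<lambda>N. (\<Sum>n<N. of_int (moebius_mu n) * \<xi> n) / of_nat N) \<longlonglongrightarrow> 0"
proof -
  define a where "a n = of_int (moebius_mu n) * \<xi> n" for n
  define H where "H s = mean_value m \<xi> * zeta_reg s + (s - 1) * L_reg m \<xi> s" for s
  \<comment> \<open>For \<open>s \<noteq> 1\<close> this is \<open>1 / L_fun m \<xi> s\<close>.
    Clearing the pole with the factor \<open>s - 1\<close> gives the correct boundary value
    \<open>G 1 = 0\<close> if the mean is not 0.\<close>
  define G where "G s = (if mean_value m \<xi> = 0 then 1 / L_reg m \<xi> s else (s - 1) / H s)" for s
  have nzL: "L_fun m \<xi> s \<noteq> 0" if "Re s \<ge> 1" "mean_value m \<xi> = 0 \<or> s \<noteq> 1" for s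
    using moebius_sums(2)[of s] L_fun_nonzero[of s] that by (cases "Re s = 1") auto
  have L0: "L_fun m \<xi> = L_reg m \<xi>" if "mean_value m \<xi> = 0" using that by (auto simp: L_fun_def)
  have HL: "H s = (s - 1) * L_fun m \<xi> s" if "s \<noteq> 1" for s using that by (simp add: H_def L_fun_def field_simps)
  have cont: "continuous_on {s. Re s \<ge> 1} zeta_reg" "continuous_on {s. Re s \<ge> 1} (L_reg m \<xi>)"
  proof -
    have "{s. Re s \<ge> 1} \<subseteq> {s. Re s > 0}" by auto
    then show "continuous_on {s. Re s \<ge> 1} zeta_reg" "continuous_on {s. Re s \<ge> 1} (L_reg m \<xi>)"
      by (blast intro: continuous_on_subset[OF holomorphic_on_imp_continuous_on[OF zeta_reg(1)]] continuous_on_subset[OF holomorphic_on_imp_continuous_on[OF L_reg(1)]])+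
  qed
  have contG: "continuous_on {s. Re s \<ge> 1} G"
  proof (cases "mean_value m \<xi> = 0")
    case True
    then have "\<forall>s\<in>{s. Re s \<ge> 1}. L_reg m \<xi> s \<noteq> 0" using nzL L0 by auto
    then show ?thesis unfolding G_def if_P[OF True] by (intro continuous_intros cont)
  next
    case False
    have "H s \<noteq> 0" if "Re s \<ge> 1" for s
      using nzL[OF that] HL[of s] False by (cases "s = 1") (auto simp: H_def zeta_reg(2))
    then show ?thesis unfolding G_def if_not_P[OF False] by (intro continuous_intros) (auto simp: H_def intro!: continuous_intros cont)
  qed
  interpret dirichlet_boundary a G
  proof
    show "norm (a n) \<le> 1" for n unfolding a_def norm_mult using norm_moebius_mu_le norm_le_1 by (intro mult_le_one) auto
    show "continuous_on {s. 1 \<le> Re s} G" by (rule contG)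
    fix s :: complex assume s: "Re s > 1"
    then have "s \<noteq> 1" by auto
    then have "G s = 1 / L_fun m \<xi> s" unfolding G_def using L0 HL[of s] by simp
    then show "(\<lambda>n. a (Suc n) * of_nat (Suc n) powr (-s)) sums G s" unfolding a_def using moebius_sums(1)[OF s] by simp
  qed
  show ?thesis using mean_tendsto unfolding a_def .
qed

end


section \<open>Divergence of the sum of the reciprocals of the primes\<close>

lemma exp_neg_le_one_minus:
  assumes "0 \<le> x" "x \<le> (1/2::real)" shows "exp (-2 * x) \<le> 1 - x"
proof -
  have "2 * x\<^sup>2 \<le> x" using assms mult_left_mono[of x "1/2" x] by (simp add: power2_eq_square)
  then have "-2 * x \<le> - x - 2 * x\<^sup>2" by simp
  also have "\<dots> \<le> ln (1 - x)" by (rule ln_one_minus_pos_lower_bound[OF assms])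
  finally have "exp (-2 * x) \<le> exp (ln (1 - x))" by (simp only: exp_le_cancel_iff)
  then show ?thesis using assms by simp
qed

text \<open>A bound for these sums would keep the partial products of \<open>1 - c p\<close> away
  from 0, hence zeta bounded at \<open>1 + \<delta>\<close> as \<open>\<delta>\<close> tends to 0,
  against its residue 1 at the pole. Zeta is obtained as the L-function of the character modulo
  1.\<close>

lemma prime_reciprocals_unbounded: "\<exists>P. finite P \<and> (\<forall>p\<in>P. prime p) \<and> B \<le> (\<Sum>p\<in>P. 1 / real p)"
proof (rule ccontr)
  assume "\<not> ?thesis"
  then have lt: "(\<Sum>p\<in>P. 1 / real p) < B" if "finite P" "\<forall>p\<in>P. prime p" for P using that not_le by blast
  interpret dirichlet_char 1 "\<lambda>_. 1" by unfold_locales (auto simp: dchar_def)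
  have mean1: "mean_value 1 (\<lambda>_. 1) = 1" by (simp add: mean_value_def)
  have bd: "norm (L_fun 1 (\<lambda>_. 1) (1 + of_real \<delta>)) \<le> exp (2 * B)" if \<delta>: "\<delta> > 0" for \<delta>
  proof -
    define c where "c = char_powr (\<lambda>_. 1) (1 + of_real \<delta>)"
    have r: "Re (1 + of_real \<delta>) > 1" using \<delta> by simp
    define Z where "Z = L_fun 1 (\<lambda>_. 1) (1 + of_real \<delta>)"
    have low: "exp (-2 * B) \<le> norm (\<Prod>p\<in>primes_upto N. 1 - c p)" for N
    proof -
      have "exp (-2 * B) \<le> exp (\<Sum>p\<in>primes_upto N. -2 * (1 / real p))"
      proof -
        have "\<forall>p\<in>primes_upto N. prime p" by (auto simp: primes_upto_def)
        from lt[OF finite_primes_upto this] have "-2 * B \<le> -2 * (\<Sum>p\<in>primes_upto N. 1 / real p)" by linarith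
        then show ?thesis unfolding sum_distrib_left[symmetric] exp_le_cancel_iff .
      qed
      also have "\<dots> = (\<Prod>p\<in>primes_upto N. exp (-2 * (1 / real p)))" by (rule exp_sum) simp
      also have "\<dots> \<le> (\<Prod>p\<in>primes_upto N. norm (1 - c p))"
      proof (rule prod_mono, intro conjI)
        fix p assume "p \<in> primes_upto N"
        then have p: "prime p" by (simp add: primes_upto_def)
        then have p2: "real p \<ge> 2" using prime_ge_2_nat by simp
        have "norm (c p) = real p powr (- (1 + \<delta>))" unfolding c_def norm_char_powr by simp
        also have "\<dots> \<le> real p powr (-1)" using p2 \<delta> by (intro powr_mono) auto
        finally have cp: "norm (c p) \<le> 1 / real p" using p2 by (simp add: powr_minus_divide)
        have "exp (-2 * (1 / real p)) \<le> 1 - 1 / real p" using p2 by (intro exp_neg_le_one_minus) (auto simp: field_simps)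
        also have "\<dots> \<le> norm (1 - c p)" using cp norm_triangle_ineq2[of 1 "c p"] by simp
        finally show "exp (-2 * (1 / real p)) \<le> norm (1 - c p)" .
      qed simp
      finally show ?thesis by (simp only: prod_norm)
    qed
    have "(\<lambda>N. norm ((\<Prod>p\<in>primes_upto N. 1 - c p) * Z)) \<longlonglongrightarrow> norm (1::complex)"
      using tendsto_norm[OF cmult.euler[OF cmult_char_powr[OF r]]] unfolding infsum_char_powr[OF r] c_def Z_def .
    moreover have "exp (-2 * B) * norm Z \<le> norm ((\<Prod>p\<in>primes_upto N. 1 - c p) * Z)" for N
      unfolding norm_mult using low by (intro mult_right_mono) auto
    ultimately have "exp (-2 * B) * norm Z \<le> norm (1::complex)" using LIMSEQ_le_const by blast
    then show ?thesis unfolding Z_def by (simp add: exp_minus field_simps)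
  qed
  have lim0: "((\<lambda>\<delta>::real. of_real \<delta> * L_fun 1 (\<lambda>_. 1) (1 + of_real \<delta>)) \<longlongrightarrow> 0) (at_right 0)"
  proof (rule Lim_null_comparison)
    have "((\<lambda>\<delta>::real. \<delta> * exp (2 * B)) \<longlongrightarrow> 0 * exp (2 * B)) (at_right 0)" by (intro tendsto_intros)
    then show "((\<lambda>\<delta>::real. \<delta> * exp (2 * B)) \<longlongrightarrow> 0) (at_right 0)" by simp
    show "\<forall>\<^sub>F \<delta> in at_right 0. norm (of_real \<delta> * L_fun 1 (\<lambda>_. 1) (1 + of_real \<delta>)) \<le> \<delta> * exp (2 * B)"
      using eventually_at_right_less[of "0::real"]
    proof eventually_elim
      case (elim \<delta>)
      then show ?case unfolding norm_mult norm_of_real abs_of_pos[OF elim] by (intro mult_left_mono bd) auto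
    qed
  qed
  have "(1::complex) = 0" using tendsto_unique[OF _ residue lim0] mean1 by simp
  then show False by simp
qed

section \<open>Orthogonality to the Moebius function\<close>

lemma moebius_mu_mult_coprime:
  assumes cop: "coprime a b" and nz: "a \<noteq> 0" "b \<noteq> 0"
  shows "moebius_mu (a * b) = moebius_mu a * moebius_mu b"
proof -
  have sq: "squarefree (a * b) \<longleftrightarrow> squarefree a \<and> squarefree b"
    using squarefree_mult_coprime[OF cop] squarefree_multD by blast
  have "prime_factors (a * b) = prime_factors a \<union> prime_factors b" using nz by (simp add: prime_factorization_mult)
  moreover have "prime_factors a \<inter> prime_factors b = {}"
  proof (rule ccontr)
    assume "prime_factors a \<inter> prime_factors b \<noteq> {}"
    then obtain p where "prime p" "p dvd a" "p dvd b" by auto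
    then show False using cop by (metis coprime_common_divisor not_prime_unit)
  qed
  ultimately have "card (prime_factors (a * b)) = card (prime_factors a) + card (prime_factors b)" by (simp add: card_Un_disjoint)
  then show ?thesis by (simp add: moebius_mu_def sq power_add)
qed

lemma moebius_periodic_coprime:
  assumes m: "m > 0" and \<phi>: "unit_periodic m \<phi>"
  shows "(\<lambda>N. (\<Sum>n<N. of_int (moebius_mu n) * \<phi> n) / of_nat N) \<longlonglongrightarrow> 0"
proof (rule unit_periodic_induct[OF m \<phi>])
  fix \<phi> \<psi> :: "nat \<Rightarrow> complex"
  assume "(\<lambda>N. (\<Sum>n<N. of_int (moebius_mu n) * \<phi> n) / of_nat N) \<longlonglongrightarrow> 0" "(\<lambda>N. (\<Sum>n<N. of_int (moebius_mu n) * \<psi> n) / of_nat N) \<longlonglongrightarrow> 0"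
  from tendsto_add[OF this] show "(\<lambda>N. (\<Sum>n<N. of_int (moebius_mu n) * (\<phi> n + \<psi> n)) / of_nat N) \<longlonglongrightarrow> 0"
    by (simp add: distrib_left sum.distrib add_divide_distrib)
next
  fix c :: complex and \<xi> assume "dchar m \<xi>"
  then interpret dirichlet_char m \<xi> by unfold_locales (use m in auto)
  show "(\<lambda>N. (\<Sum>n<N. of_int (moebius_mu n) * (c * \<xi> n)) / of_nat N) \<longlonglongrightarrow> 0"
    using tendsto_mult_right_zero[OF moebius_mean, of c] by (simp add: sum_distrib_left mult.left_commute)
qed simp

text \<open>Only \<open>g = gcd n m\<close> can give a non-zero term, since coprimality of
  \<open>n div g\<close> and \<open>m\<close> forces it. If coprimality fails for this
  \<open>g\<close>, a prime divides both \<open>g\<close> and \<open>n div g\<close>, so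
  \<open>n\<close> is not squarefree and both sides vanish.\<close>

lemma moebius_gcd_decomposition:
  fixes P :: "nat \<Rightarrow> complex"
  assumes m: "m > 0"
  shows "P n * of_int (moebius_mu n) = (\<Sum>g | g dvd m. if g dvd n then of_int (moebius_mu g) *
     (of_int (moebius_mu (n div g)) * (if coprime (n div g) m then P (g * (n div g)) else 0)) else 0)"
proof (cases "n = 0")
  case True then show ?thesis by (simp add: moebius_mu_def)
next
  case False
  define T where "T g = (if g dvd n then of_int (moebius_mu g) *
     (of_int (moebius_mu (n div g)) * (if coprime (n div g) m then P (g * (n div g)) else 0)) else 0 :: complex)" for g
  define d where "d = gcd n m"
  have dm: "d dvd m" "d dvd n" by (auto simp: d_def)
  have uniq: "T g = 0" if "g dvd m" "g \<noteq> d" for g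
  proof (cases "g dvd n \<and> coprime (n div g) m")
    case True
    then have "d = gcd (g * (n div g)) m" by (simp add: d_def)
    also have "\<dots> = gcd g m"
    proof -
      have "coprime m (n div g)" using True by (simp add: coprime_commute)
      then have "gcd m (g * (n div g)) = gcd m g" by (rule gcd_mult_right_right_cancel)
      then show ?thesis by (simp only: gcd.commute)
    qed
    also have "\<dots> = g" using that by (simp add: gcd_nat.absorb1)
    finally show ?thesis using that by simp
  qed (auto simp: T_def)
  have "(\<Sum>g | g dvd m. T g) = (\<Sum>g\<in>{d}. T g)" by (rule sum.mono_neutral_right) (use m dm uniq in auto)
  also have "\<dots> = P n * of_int (moebius_mu n)"
  proof (cases "coprime (n div d) m")
    case True
    have "coprime d (n div d)" using True dm by (meson coprime_commute coprime_divisors dvd_refl)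
    moreover have "n div d \<noteq> 0" "d \<noteq> 0" using False dm by (auto simp: dvd_div_eq_0_iff)
    ultimately have "moebius_mu n = moebius_mu d * moebius_mu (n div d)" using moebius_mu_mult_coprime[of d "n div d"] dm by simp
    then show ?thesis using True dm by (simp add: T_def)
  next
    case F: False
    then have "gcd (n div d) m \<noteq> 1" by (simp only: coprime_iff_gcd_eq_1 not_False_eq_True)
    then obtain p where "prime p" "p dvd gcd (n div d) m" using prime_factor_nat by blast
    then have p: "prime p" "p dvd n div d" "p dvd m" by (blast dest: dvd_trans[OF _ gcd_dvd1] dvd_trans[OF _ gcd_dvd2])+
    then have "p dvd n" using dm by (metis dvd_mult dvd_mult_div_cancel)
    then have "p dvd d" using p by (simp add: d_def)
    then have "p * p dvd d * (n div d)" using p by (intro mult_dvd_mono)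
    then have "p ^ 2 dvd n" using dm by (simp add: power2_eq_square)
    then have "\<not> squarefree n" using p by (metis squarefreeD not_prime_unit)
    then show ?thesis using F by (simp add: T_def moebius_mu_def)
  qed
  finally show ?thesis unfolding T_def by simp
qed

text \<open>Sorting by \<open>g = gcd n m\<close> leaves, for each divisor \<open>g\<close> of
  \<open>m\<close>, a sum over \<open>k = n div g\<close> of \<open>\<mu>\<close> against a function
  carried by the units modulo \<open>m\<close>, to which characters apply.\<close>

theorem moebius_periodic:
  fixes P :: "nat \<Rightarrow> complex"
  assumes m: "m > 0" and per: "\<And>n. P (n + m) = P n"
  shows "(\<lambda>N. (\<Sum>n<N. P n * of_int (moebius_mu n)) / of_nat N) \<longlonglongrightarrow> 0"
proof -
  define \<phi> where "\<phi> g n = (if coprime n m then P (g * n) else 0)" for g n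
  have unit_periodic: "unit_periodic m (\<phi> g)" for g
  proof -
    have "P (g * (n + m)) = P (g * n)" for n using periodic_mult[of P m, OF per, of "g * n" g] by (simp add: algebra_simps)
    moreover have "coprime (n + m) m \<longleftrightarrow> coprime n m" for n by (metis coprime_iff_gcd_eq_1 gcd_add1)
    ultimately show ?thesis by (simp add: unit_periodic_def \<phi>_def)
  qed
  define S where "S g K = (\<Sum>n<K. of_int (moebius_mu n) * \<phi> g n)" for g K
  have S: "(\<lambda>K. S g K / of_nat K) \<longlonglongrightarrow> 0" for g unfolding S_def by (rule moebius_periodic_coprime[OF m unit_periodic])
  define K where "K g N = (N + g - 1) div g" for g N :: nat
  have gpos: "g > 0" if "g dvd m" for g using that m by (auto intro: Nat.gr0I)
  have eq: "(\<Sum>n<N. P n * of_int (moebius_mu n)) = (\<Sum>g | g dvd m. of_int (moebius_mu g) * S g (K g N))" for N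
  proof -
    have "(\<Sum>n<N. P n * of_int (moebius_mu n)) = (\<Sum>n<N. \<Sum>g | g dvd m. if g dvd n then of_int (moebius_mu g) * (of_int (moebius_mu (n div g)) * \<phi> g (n div g)) else 0)"
      unfolding \<phi>_def by (intro sum.cong refl moebius_gcd_decomposition m)
    also have "\<dots> = (\<Sum>g | g dvd m. \<Sum>n<N. if g dvd n then of_int (moebius_mu g) * (of_int (moebius_mu (n div g)) * \<phi> g (n div g)) else 0)" by (rule sum.swap)
    also have "\<dots> = (\<Sum>g | g dvd m. of_int (moebius_mu g) * S g (K g N))"
    proof (rule sum.cong[OF refl])
      fix g assume "g \<in> {g. g dvd m}"
      then have g: "g > 0" using gpos by simp
      have "(\<Sum>n<N. if g dvd n then of_int (moebius_mu g) * (of_int (moebius_mu (n div g)) * \<phi> g (n div g)) else 0)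
         = (\<Sum>n | n < N \<and> g dvd n. of_int (moebius_mu g) * (of_int (moebius_mu (n div g)) * \<phi> g (n div g)))"
        by (subst sum.inter_filter[symmetric]) auto
      also have "\<dots> = (\<Sum>k | g * k < N. of_int (moebius_mu g) * (of_int (moebius_mu k) * \<phi> g k))"
        by (subst sum_multiples[OF g]) (use g in auto)
      also have "{k. g * k < N} = {..<K g N}" unfolding K_def using mult_less_iff_less_ceil_div[OF g] by auto
      finally show "(\<Sum>n<N. if g dvd n then of_int (moebius_mu g) * (of_int (moebius_mu (n div g)) * \<phi> g (n div g)) else 0) = of_int (moebius_mu g) * S g (K g N)"
        by (simp add: S_def sum_distrib_left)
    qed
    finally show ?thesis .
  qed
  have lim: "(\<lambda>N. S g (K g N) / of_nat N) \<longlonglongrightarrow> 0" if "g dvd m" for g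
  proof -
    have g: "g > 0" by (rule gpos[OF that])
    have KN: "K g N \<le> N" for N
    proof (rule ccontr)
      assume "\<not> K g N \<le> N"
      then have "g * N < N" using mult_less_iff_less_ceil_div[OF g, of N N] by (simp add: K_def)
      then show False using g by simp
    qed
    have "filterlim (K g) at_top sequentially"
      unfolding filterlim_at_top eventually_sequentially
    proof (intro allI exI impI)
      fix Z N assume "g * Z + 1 \<le> N"
      then have "g * Z < N" by simp
      then show "Z \<le> K g N" using mult_less_iff_less_ceil_div[OF g, of Z N] by (simp add: K_def)
    qed
    with S[of g] have l: "(\<lambda>N. S g (K g N) / of_nat (K g N)) \<longlonglongrightarrow> 0" by (rule filterlim_compose)
    show ?thesis
    proof (rule Lim_null_comparison[OF _ tendsto_norm_zero[OF l]])
      show "\<forall>\<^sub>F N in sequentially. norm (S g (K g N) / of_nat N) \<le> norm (S g (K g N) / of_nat (K g N))"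
      proof (rule always_eventually, rule allI)
        fix N
        show "norm (S g (K g N) / of_nat N) \<le> norm (S g (K g N) / of_nat (K g N))"
        proof (cases "K g N = 0")
          case True then show ?thesis by (simp add: S_def)
        next
          case False
          then show ?thesis using KN[of N] by (simp add: norm_divide divide_left_mono)
        qed
      qed
    qed
  qed
  have "(\<lambda>N. \<Sum>g | g dvd m. of_int (moebius_mu g) * (S g (K g N) / of_nat N)) \<longlonglongrightarrow> (\<Sum>g | g dvd m. of_int (moebius_mu g) * 0)"
    by (intro tendsto_intros lim) auto
  then show ?thesis unfolding eq by (simp add: sum_divide_distrib)
qed

text \<open>Write \<open>q ^ l * z = w + M\<close>, where \<open>w\<close> is a multiple of
  \<open>q ^ (l + r)\<close> and \<open>M\<close> is smaller than it. The relation with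
  \<open>n + w\<close> and the relation with \<open>w\<close> in the role of \<open>n\<close>
  contain the same factor \<open>f (M + k) / f M\<close>, which is eliminated.\<close>

lemma semimultiplicative_star:
  fixes f :: "nat \<Rightarrow> complex"
  assumes q: "q \<ge> 2" and unit: "\<And>n. norm (f n) = 1" and sm: "semimultiplicative q f"
  shows "\<exists>r. semimult q r f"
proof -
  obtain r where f0: "f 0 = 1" and r: "\<And>n m k l. k < q ^ l \<Longrightarrow> q ^ l dvd m \<Longrightarrow> m < q ^ (l + r) \<Longrightarrow> q ^ (l + r) dvd n \<Longrightarrow>
     f (n + m + k) = f (n + m) * f (m + k) / f m" using sm unfolding semimultiplicative_def by blast
  have "semimult q r f"
  proof
    fix k l n z assume k: "k < q ^ l" and n: "q ^ (l + r) dvd n"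
    define z0 z1 where "z0 = z mod q ^ r" and "z1 = z div q ^ r"
    define w where "w = q ^ (l + r) * z1"
    define M where "M = q ^ l * z0"
    have z: "q ^ l * z = w + M" unfolding w_def M_def z0_def z1_def
      by (simp add: power_add mult.assoc distrib_left[symmetric])
    have "z0 < q ^ r" unfolding z0_def using q by simp
    then have M: "M < q ^ (l + r)" using q by (simp add: M_def power_add)
    have "f ((n + w) + M + k) = f ((n + w) + M) * f (M + k) / f M"
      by (rule r[OF k _ M]) (use n in \<open>auto simp: M_def w_def\<close>)
    moreover have "f (w + M + k) = f (w + M) * f (M + k) / f M"
      by (rule r[OF k _ M]) (auto simp: M_def w_def)
    ultimately show "f (n + q ^ l * z + k) * f (q ^ l * z) = f (q ^ l * z + k) * f (n + q ^ l * z)"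
      unfolding z by (simp add: add.assoc)
  qed (use q unit f0 in auto)
  then show ?thesis by blast
qed

theorem theoremA:
  fixes q :: nat and f :: "nat \<Rightarrow> complex"
  assumes "q \<ge> 2"
    and "\<And>n. f n \<in> sphere 0 1"
    and "semimultiplicative q f"
  shows "(\<lambda>N. 1 / of_nat N * (\<Sum>n<N. f n * of_int (moebius_mu n))) \<longlonglongrightarrow> 0"
proof -
  have unit: "norm (f n) = 1" for n using assms(2)[of n] by simp
  obtain r where "semimult q r f" using semimultiplicative_star[OF assms(1) unit assms(3)] by blast
  then interpret semimult q r f .
  define \<nu> where "\<nu> n = complex_of_int (moebius_mu n)" for n
  have \<nu>: "norm (\<nu> n) \<le> 1" for n unfolding \<nu>_def by (rule norm_moebius_mu_le)
  \<comment> \<open>These are the primes that \<open>D_periodic_qr\<close> can handle; all but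
    finitely many are included, so their reciprocals still have a divergent sum.\<close>
  define Q where "Q = {p. prime p \<and> p \<ge> 3 \<and> coprime p q}"
  have "(\<lambda>N. (\<Sum>n<N. f n * \<nu> n) / of_nat N) \<longlonglongrightarrow> 0"
  proof (cases "\<forall>p\<in>Q. \<forall>p'\<in>Q. p \<noteq> p' \<longrightarrow> (\<lambda>N. (\<Sum>n<N. f (p * n) * cnj (f (p' * n))) / of_nat N) \<longlonglongrightarrow> 0")
    case True
    show ?thesis
    proof (rule katai_criterion[of Q])
      show "\<exists>P. finite P \<and> P \<subseteq> Q \<and> B \<le> (\<Sum>p\<in>P. 1 / real p)" for B
      proof -
        define E where "E = {p. prime p \<and> p \<le> 2} \<union> {p. prime p \<and> p dvd q}"
        have "p \<le> q" if "p \<in> E" for p using that assms(1) dvd_imp_le[of p q] by (auto simp: E_def)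
        then have "E \<subseteq> {..q}" by blast
        then have finE: "finite E" by (rule finite_subset) simp
        obtain P where P: "finite P" "\<forall>p\<in>P. prime p" "B + (\<Sum>p\<in>E. 1 / real p) \<le> (\<Sum>p\<in>P. 1 / real p)"
          using prime_reciprocals_unbounded by blast
        have "(\<Sum>p\<in>P. 1 / real p) \<le> (\<Sum>p\<in>(P - E) \<union> E. 1 / real p)" using P finE by (intro sum_mono2) auto
        also have "\<dots> = (\<Sum>p\<in>P - E. 1 / real p) + (\<Sum>p\<in>E. 1 / real p)" using P finE by (intro sum.union_disjoint) auto
        finally have "B \<le> (\<Sum>p\<in>P - E. 1 / real p)" using P(3) by linarith
        moreover have "P - E \<subseteq> Q" using P(2) by (auto simp: E_def Q_def prime_imp_coprime)
        ultimately show ?thesis using P(1) by blast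
      qed
      show "\<nu> (p * n) = \<nu> p * \<nu> n" if p: "prime p" "\<not> p dvd n" for p n
      proof -
        have "n \<noteq> 0" by (metis dvd_0_right p(2))
        then show ?thesis using moebius_mu_mult_prime[OF p(1), of n] moebius_mu_mult_prime[OF p(1), of 1] p
          unfolding \<nu>_def by (simp add: moebius_mu_one[unfolded One_nat_def] prime_nat_iff)
      qed
    qed (use True unit \<nu> in \<open>auto simp: Q_def\<close>)
  next
    case False
    then obtain p p' where p: "p \<in> Q" "p' \<in> Q" "p \<noteq> p'" and nc: "\<not> (\<lambda>N. (\<Sum>n<N. f (p * n) * cnj (f (p' * n))) / of_nat N) \<longlonglongrightarrow> 0" by blast
    then have pp: "prime p" "prime p'" "p \<ge> 3" "p' \<ge> 3" "coprime p q" "coprime p' q" "p > 0" "p' > 0" by (auto simp: Q_def)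
    have FF: "F (p * u) \<doteq> F (p' * u)" for u
      unfolding F_def l2_close_def by (rule corr_or_summable[OF pp(7,8) nc])
    show ?thesis
    proof (rule LIMSEQ_I)
      fix \<epsilon> :: real assume \<epsilon>: "\<epsilon> > 0"
      obtain P m N0 where P: "m > 0" "\<And>n. P (n + m) = P n"
        "\<And>N. N \<ge> N0 \<Longrightarrow> \<exists>c. norm c = 1 \<and> (\<Sum>n<N. norm (f n - c * P n)) \<le> \<epsilon> / 3 * N"
        using periodic_approximation[OF FF pp(1,2) p(3) pp(3-6), of "\<epsilon> / 3"] \<epsilon> by auto
      obtain N1 where N1: "\<And>N. N \<ge> N1 \<Longrightarrow> norm ((\<Sum>n<N. P n * \<nu> n) / of_nat N) < \<epsilon> / 3"
        using LIMSEQ_D[OF moebius_periodic[of m P, OF P(1,2)], of "\<epsilon> / 3"] \<epsilon> unfolding \<nu>_def by auto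
      have "norm ((\<Sum>n<N. f n * \<nu> n) / of_nat N - 0) < \<epsilon>" if N: "N \<ge> max (max N0 N1) 1" for N
      proof -
        have N': "real N > 0" using N by simp
        obtain c where c: "norm c = 1" "(\<Sum>n<N. norm (f n - c * P n)) \<le> \<epsilon> / 3 * N" using P(3)[of N] N by auto
        \<comment> \<open>\<open>c\<close> may change with \<open>N\<close>, but only its modulus
          enters the bound of the periodic part, so a single \<open>P\<close> serves for all large
          \<open>N\<close>.\<close>
        have "(\<Sum>n<N. f n * \<nu> n) = (\<Sum>n<N. (f n - c * P n) * \<nu> n) + c * (\<Sum>n<N. P n * \<nu> n)"
          unfolding sum_distrib_left sum.distrib[symmetric] by (intro sum.cong refl) (simp add: algebra_simps)
        then have "norm (\<Sum>n<N. f n * \<nu> n) \<le> norm (\<Sum>n<N. (f n - c * P n) * \<nu> n) + norm (c * (\<Sum>n<N. P n * \<nu> n))"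
          by (simp only: norm_triangle_ineq)
        moreover have "norm (\<Sum>n<N. (f n - c * P n) * \<nu> n) \<le> (\<Sum>n<N. norm (f n - c * P n))"
          using \<nu> by (intro sum_norm_le) (simp add: norm_mult mult_left_le)
        moreover have "norm (c * (\<Sum>n<N. P n * \<nu> n)) \<le> \<epsilon> / 3 * N"
          using N1[of N] N N' c(1) by (simp add: norm_mult norm_divide field_simps)
        moreover have "\<epsilon> / 3 * N + \<epsilon> / 3 * N < \<epsilon> * N" using \<epsilon> N' by (simp add: field_simps)
        ultimately have "norm (\<Sum>n<N. f n * \<nu> n) < \<epsilon> * N" using c(2) by linarith
        then show ?thesis using N' by (simp add: norm_divide field_simps)
      qed
      then show "\<exists>no. \<forall>N\<ge>no. norm ((\<Sum>n<N. f n * \<nu> n) / of_nat N - 0) < \<epsilon>" by blast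
    qed
  qed
  then show ?thesis unfolding \<nu>_def by simp
qed

end
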